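(* For $0\le k\le n^2$, each of the following subsets of $B_n$, endowed with the map $w\mapsto\mathrm{sDes}(w)$, is a fine set for the $B_n$-character $\chi^B_{n,k}$: (i) $\{w\in B_n:\mathrm{finv}(w^{-1})=k\}$; (ii) $\{w\in B_n:\mathrm{fmaj}(w^{-1})=k\}$.
   Context: Let $F$ be a field of characteristic zero and $P_n=F[x_1,\dots,x_n]$. $B_n$ (signed permutations) acts on $P_n$ by permuting variables and changing their signs. Let $I^B_n$ be the ideal generated by the $B_n$-invariant polynomials with zero constant term; $B_n$ acts on each homogeneous component of the graded quotient $P_n/I^B_n$, and $\chi^B_{n,k}$ is the character of the action on the degree-$k$ component. Signed permutations are written $w=(w(1),\dots,w(n))$, with $\{1,\dots,n,\bar1,\dots,\bar n\}$ ordered by $\bar1<_r\cdots<_r\bar n<_r1<_r\cdots<_rn$. $\mathrm{Des}(w)=\{i\in[n-1]:w(i)>_rw(i+1)\}$, $\mathrm{maj}(w)=\sum_{i\in\mathrm{Des}(w)}i$, $\mathrm{inv}(w)=|\{i<j:w(i)>_rw(j)\}|$, $\mathrm{bar}(w)$ the number of barred entries, $\mathrm{fmaj}(w)=2\,\mathrm{maj}(w)+\mathrm{bar}(w)$, $\mathrm{finv}(w)=2\,\mathrm{inv}(w)+\mathrm{bar}(w)$. $\mathrm{sDes}(w)=(S,\varepsilon)$ where $S$ consists of $n$ and all $s\in[n-1]$ with $w(s)>_rw(s+1)$ or with $w(s)$ barred and $w(s+1)$ unbarred; $\varepsilon(s)=-$ if $w(s)$ is barred, $+$ otherwise. Fine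 sets: for $\sigma=(S,\varepsilon)$ ($n\in S\subseteq[n]$) with sign vector $\tilde\varepsilon(j)=\varepsilon(\min\{s\in S:s\ge j\})$ and a signed composition $\gamma=(\gamma_1,\dots,\gamma_k)$ of $n$ (some parts barred), partial sums $r_i$, $r_0=0$, $S(\gamma)=\{r_1,\dots\}$, blocks $I_i=\{r_{i-1}+1,\dots,r_i\}$: $\mathrm{wt}_\gamma(\sigma)=0$ if for some $i$, $S\cap\{r_{i-1}+1,\dots,r_i-1\}$ is not an initial segment of $\{r_{i-1}+1,\dots,r_i-1\}$ or $\tilde\varepsilon$ is not constant on $I_i$; else $(-1)^{|S\setminus S(\gamma)|+n_\gamma(\sigma)}$ with $n_\gamma(\sigma)$ the number of $i$ with $\tilde\varepsilon=-$ on $I_i$ and $\gamma_i$ barred. A finite set $\mathcal B$ with map $\mathrm{sDes}$ is fine for a class function $\chi$ of $B_n$ if $\chi(\gamma)=\sum_{b\in\mathcal B}\mathrm{wt}_\gamma(\mathrm{sDes}(b))$ for all $\gamma$, where $\chi(\gamma)$ is the value of $\chi$ on elements whose signed cycle type (lengths of positive cycles; lengths of negative cycles) is (sorted unbarred parts of $\gamma$; sorted barred parts of $\gamma$). *)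

theory Defs
  imports Complex_Main "HOL-Library.Poly_Mapping" "HOL-Library.Multiset"
    "HOL-Combinatorics.Permutations" "HOL-Combinatorics.Orbits"
begin

section \<open>Signed permutations\<close>

text \<open>
  The letter \<open>i\<close> with a bar is encoded as the negative integer \<open>- i\<close>, both in signed permutations
  and in signed compositions.  The window of \<open>w\<close> is \<open>(w 1, \<dots>, w n)\<close>; the product is composition
  and the inverse is \<^term>\<open>inv w\<close>.
\<close>

type_synonym signed_perm = "int \<Rightarrow> int"

definition signed_perms :: "nat \<Rightarrow> signed_perm set" where
  "signed_perms n = {w. w permutes ({- int n..int n} - {0}) \<and> (\<forall>i. w (- i) = - w i)}"

definition less_r :: "int \<Rightarrow> int \<Rightarrow> bool" (infix "<\<^sub>r" 50) where
  "a <\<^sub>r b \<longleftrightarrow>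
    (a < 0 \<and> 0 < b) \<or> (a < 0 \<and> b < 0 \<and> \<bar>a\<bar> < \<bar>b\<bar>) \<or> (0 < a \<and> 0 < b \<and> a < b)"

definition Des :: "nat \<Rightarrow> signed_perm \<Rightarrow> nat set" where
  "Des n w = {i. 1 \<le> i \<and> i < n \<and> w (int (i + 1)) <\<^sub>r w (int i)}"

definition maj :: "nat \<Rightarrow> signed_perm \<Rightarrow> nat" where
  "maj n w = \<Sum> (Des n w)"

definition inv_num :: "nat \<Rightarrow> signed_perm \<Rightarrow> nat" where
  "inv_num n w = card {(i, j). 1 \<le> i \<and> i < j \<and> j \<le> n \<and> w (int j) <\<^sub>r w (int i)}"

definition bar_num :: "nat \<Rightarrow> signed_perm \<Rightarrow> nat" where
  "bar_num n w = card {i \<in> {1..n}. w (int i) < 0}"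

definition fmaj :: "nat \<Rightarrow> signed_perm \<Rightarrow> nat" where
  "fmaj n w = 2 * maj n w + bar_num n w"

definition finv :: "nat \<Rightarrow> signed_perm \<Rightarrow> nat" where
  "finv n w = 2 * inv_num n w + bar_num n w"

definition cycles_of :: "nat \<Rightarrow> signed_perm \<Rightarrow> nat set set" where
  "cycles_of n w = (\<lambda>i. orbit (\<lambda>j. nat \<bar>w (int j)\<bar>) i) ` {1..n}"

text \<open>
  A cycle is positive if it contains an even number of barred entries, negative otherwise.
  The partitions of cycle lengths are represented as multisets.
\<close>

definition positive_cycle :: "signed_perm \<Rightarrow> nat set \<Rightarrow> bool" where
  "positive_cycle w C \<longleftrightarrow> even (card {i \<in> C. w (int i) < 0})"

definition signed_cycle_type :: "nat \<Rightarrow> signed_perm \<Rightarrow> nat multiset \<times> nat multiset" where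
  "signed_cycle_type n w =
    (image_mset card (mset_set {C \<in> cycles_of n w. positive_cycle w C}),
     image_mset card (mset_set {C \<in> cycles_of n w. \<not> positive_cycle w C}))"


section \<open>Signed sets, signed compositions and fine sets\<close>

text \<open>
  A pair \<open>(S, \<epsilon>)\<close>, where \<open>\<epsilon> s = True\<close> stands for the sign minus; only the values of \<open>\<epsilon>\<close> on
  \<open>S\<close> are relevant.
\<close>

type_synonym signed_set = "nat set \<times> (nat \<Rightarrow> bool)"

definition is_signed_set :: "nat \<Rightarrow> signed_set \<Rightarrow> bool" where
  "is_signed_set n \<sigma> \<longleftrightarrow> fst \<sigma> \<subseteq> {1..n} \<and> n \<in> fst \<sigma>"

definition sDes :: "nat \<Rightarrow> signed_perm \<Rightarrow> signed_set" where
  "sDes n w =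
    (insert n {s. 1 \<le> s \<and> s < n \<and>
       (w (int (s + 1)) <\<^sub>r w (int s) \<or> (w (int s) < 0 \<and> 0 < w (int (s + 1))))},
     \<lambda>s. w (int s) < 0)"

definition sign_vector :: "signed_set \<Rightarrow> nat \<Rightarrow> bool" where
  "sign_vector \<sigma> j = snd \<sigma> (LEAST s. s \<in> fst \<sigma> \<and> j \<le> s)"

definition signed_composition :: "nat \<Rightarrow> int list \<Rightarrow> bool" where
  "signed_composition n \<gamma> \<longleftrightarrow> 0 \<notin> set \<gamma> \<and> (\<Sum>c\<leftarrow>\<gamma>. nat \<bar>c\<bar>) = n"

definition partial_sum :: "int list \<Rightarrow> nat \<Rightarrow> nat" where
  "partial_sum \<gamma> i = (\<Sum>c\<leftarrow>take i \<gamma>. nat \<bar>c\<bar>)"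

definition partial_sums :: "int list \<Rightarrow> nat set" where
  "partial_sums \<gamma> = partial_sum \<gamma> ` {1..length \<gamma>}"

text \<open>The parts of \<open>\<gamma>\<close> and the blocks are indexed from 0.\<close>

definition block :: "int list \<Rightarrow> nat \<Rightarrow> nat set" where
  "block \<gamma> i = {partial_sum \<gamma> i + 1..partial_sum \<gamma> (i + 1)}"

definition initial_segment :: "nat set \<Rightarrow> nat set \<Rightarrow> bool" where
  "initial_segment A B \<longleftrightarrow> A \<subseteq> B \<and> (\<forall>a\<in>A. \<forall>b\<in>B. b < a \<longrightarrow> b \<in> A)"

definition wt :: "int list \<Rightarrow> signed_set \<Rightarrow> int" where
  "wt \<gamma> \<sigma> =
    (if \<exists>i<length \<gamma>.
          \<not> initial_segment (fst \<sigma> \<inter> (block \<gamma> i - {partial_sum \<gamma> (i + 1)}))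
                            (block \<gamma> i - {partial_sum \<gamma> (i + 1)}) \<or>
          \<not> (\<forall>j\<in>block \<gamma> i. \<forall>j'\<in>block \<gamma> i. sign_vector \<sigma> j = sign_vector \<sigma> j')
     then 0
     else (- 1) ^ (card (fst \<sigma> - partial_sums \<gamma>) +
            card {i. i < length \<gamma> \<and> (\<forall>j\<in>block \<gamma> i. sign_vector \<sigma> j) \<and> \<gamma> ! i < 0}))"

definition composition_type :: "int list \<Rightarrow> nat multiset \<times> nat multiset" where
  "composition_type \<gamma> =
    (mset (map nat (filter (\<lambda>c. 0 < c) \<gamma>)), mset (map (\<lambda>c. nat \<bar>c\<bar>) (filter (\<lambda>c. c < 0) \<gamma>)))"

definition fine_set ::
  "nat \<Rightarrow> (signed_perm \<Rightarrow> 'a::field_char_0) \<Rightarrow> 'b set \<Rightarrow> ('b \<Rightarrow> signed_set) \<Rightarrow> bool" where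
  "fine_set n \<chi> B D \<longleftrightarrow> finite B \<and> (\<forall>b\<in>B. is_signed_set n (D b)) \<and>
    (\<forall>\<gamma>. signed_composition n \<gamma> \<longrightarrow>
      (\<forall>w\<in>signed_perms n. signed_cycle_type n w = composition_type \<gamma> \<longrightarrow>
        \<chi> w = of_int (\<Sum>b\<in>B. wt \<gamma> (D b))))"


section \<open>The coinvariant algebra of type B and its graded characters\<close>

text \<open>
  A monomial is its exponent vector, a polynomial maps monomials to their coefficients.
  The variables are \<open>x\<^sub>i\<close> for \<open>i :: nat\<close>.
\<close>

type_synonym 'a mpoly = "(nat \<Rightarrow>\<^sub>0 nat) \<Rightarrow>\<^sub>0 'a"

definition Const :: "'a \<Rightarrow> 'a::field_char_0 mpoly" where
  "Const c = Poly_Mapping.single 0 c"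

text \<open>The variable indexed by a signed letter: \<open>x\<close> with index \<open>- i\<close> is \<open>- x\<^sub>i\<close>.\<close>

definition Var :: "int \<Rightarrow> 'a::field_char_0 mpoly" where
  "Var i = Const (of_int (sgn i)) * Poly_Mapping.single (Poly_Mapping.single (nat \<bar>i\<bar>) 1) 1"

definition polys :: "nat \<Rightarrow> 'a::field_char_0 mpoly set" where
  "polys n = {p. \<forall>m\<in>Poly_Mapping.keys p. Poly_Mapping.keys m \<subseteq> {1..n}}"

definition homogeneous_polys :: "nat \<Rightarrow> nat \<Rightarrow> 'a::field_char_0 mpoly set" where
  "homogeneous_polys n k =
    {p \<in> polys n. \<forall>m\<in>Poly_Mapping.keys p. (\<Sum>i\<in>Poly_Mapping.keys m. Poly_Mapping.lookup m i) = k}"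

text \<open>The substitution \<open>x\<^sub>i \<mapsto> x\<close> with index \<open>w i\<close>.\<close>

definition act :: "signed_perm \<Rightarrow> 'a::field_char_0 mpoly \<Rightarrow> 'a mpoly" where
  "act w p = (\<Sum>m\<in>Poly_Mapping.keys p. Const (Poly_Mapping.lookup p m) *
     (\<Prod>i\<in>Poly_Mapping.keys m. Var (w (int i)) ^ Poly_Mapping.lookup m i))"

definition invariants0 :: "nat \<Rightarrow> 'a::field_char_0 mpoly set" where
  "invariants0 n =
    {p \<in> polys n. (\<forall>w\<in>signed_perms n. act w p = p) \<and> Poly_Mapping.lookup p 0 = 0}"

definition ideal_of :: "nat \<Rightarrow> 'a::field_char_0 mpoly set \<Rightarrow> 'a mpoly set" where
  "ideal_of n G =
    {\<Sum>g\<in>A. h g * g | A h. finite A \<and> A \<subseteq> G \<and> (\<forall>g\<in>A. h g \<in> polys n)}"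

definition coinv_ideal :: "nat \<Rightarrow> 'a::field_char_0 mpoly set" where
  "coinv_ideal n = ideal_of n (invariants0 n)"

text \<open>
  Linear algebra in the image of a subspace \<open>V\<close> in the quotient by a subspace \<open>U\<close>, expressed on
  representatives.  \<open>coords_mod U B v c\<close> says that the coset of \<open>v\<close> is the linear combination with
  coefficients \<open>c\<close> of the cosets of the elements of \<open>B\<close>; \<open>basis_mod V U B\<close> says that the cosets of
  the elements of \<open>B\<close> are distinct and form a basis of the image of \<open>V\<close>.  For a linear map \<open>T\<close>
  that preserves \<open>V\<close> and \<open>U\<close>, \<open>trace_mod V U T\<close> is the trace of the induced map; it does not
  depend on the basis chosen.
\<close>

definition coords_mod ::
  "'a::field_char_0 mpoly set \<Rightarrow> 'a mpoly set \<Rightarrow> 'a mpoly \<Rightarrow> ('a mpoly \<Rightarrow> 'a) \<Rightarrow> bool" where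
  "coords_mod U B v c \<longleftrightarrow> (\<forall>b. b \<notin> B \<longrightarrow> c b = 0) \<and> v - (\<Sum>b\<in>B. Const (c b) * b) \<in> U"

definition basis_mod ::
  "'a::field_char_0 mpoly set \<Rightarrow> 'a mpoly set \<Rightarrow> 'a mpoly set \<Rightarrow> bool" where
  "basis_mod V U B \<longleftrightarrow> finite B \<and> B \<subseteq> V \<and> (\<forall>v\<in>V. \<exists>!c. coords_mod U B v c)"

definition trace_mod ::
  "'a::field_char_0 mpoly set \<Rightarrow> 'a mpoly set \<Rightarrow> ('a mpoly \<Rightarrow> 'a mpoly) \<Rightarrow> 'a" where
  "trace_mod V U T =
    (let B = (SOME B. basis_mod V U B) in \<Sum>b\<in>B. (THE c. coords_mod U B (T b) c) b)"

definition coinv_char :: "nat \<Rightarrow> nat \<Rightarrow> signed_perm \<Rightarrow> 'a::field_char_0" where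
  "coinv_char n k w = trace_mod (homogeneous_polys n k) (coinv_ideal n) (act w)"

end

theory Submission
  imports Defs "HOL-Computational_Algebra.Formal_Power_Series"
begin

text \<open>
  Sorting an exponent vector \<open>a\<close> decreasingly, with ties broken by position, and recording parities
  as bars gives a bijection \<open>a \<leftrightarrow> (w, l)\<close> with \<open>w\<close> a signed permutation and \<open>l\<close> a partition into at
  most \<open>n\<close> even parts, such that \<open>|a| = fmaj (inv w) + |l|\<close> and \<open>sDes w\<close> can be read off \<open>a\<close>.  The
  product of the orbit sum of \<open>x\<^sup>l\<close> with the descent monomial of \<open>w\<close> is \<open>x\<^sup>a\<close> plus terms that are
  smaller for a quadratic statistic, by the rearrangement inequality; hence these products form a
  basis of the polynomial ring, which is therefore free over the invariants on the descent
  monomials, and those of degree \<open>k\<close> form a basis of the degree \<open>k\<close> part of the coinvariant algebra.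
  So the graded trace of a signed permutation on polynomials is its graded trace on coinvariants
  times the Hilbert series \<open>H\<close> of the invariants.

  On the other side, the sum of \<open>wt \<gamma> (sDes w)\<close>, graded by \<open>fmaj (inv w)\<close>, times the same \<open>H\<close> is the
  sum of the weights of all words \<open>a\<close>.  It factors over the blocks of \<open>\<gamma>\<close>, and in each block rotating
  unimodal words cancels everything but the constant words.  What remains is the sum over
  functions that are constant on cycles, which is the trace on polynomials in the monomial basis.
  This proves the statement for \<open>fmaj\<close>.  Foata's bijection, applied to the window of \<open>inv w\<close>, carries
  \<open>fmaj\<close> to \<open>finv\<close>; it keeps the set of letters and the relative order of consecutive letters, hence
  it preserves \<open>sDes w\<close>.
\<close>

text \<open>The invariants are the symmetric polynomials in the squares of the variables. This is
  why the partitions have even parts, and why the parity of an exponent is free to store a bar.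
  Breaking ties by position has two effects: rises of the exponent vector become descents of |w| on
  stretches of equal sign, which the weights need, and the keys 2n a_i - i become pairwise distinct,
  which a strict rearrangement inequality needs. The quadratic statistic is built so that these keys
  appear as its cross terms. \<open>trace_mod\<close> uses a basis picked by choice, whereas the
  argument computes one trace in two bases, once in monomials and once in products of orbit sums and
  descent monomials. Independence of the basis is therefore the hinge of the algebraic half. The
  series H has constant term 1, so a common factor H can be cancelled degree by degree. Foata's map
  is used because equidistribution of the two statistics alone would not suffice: the relative order
  of neighbouring letters must survive. The letters are first moved to integers so that neighbours
  of equal sign differ by one.\<close>

subsection \<open>Foata's bijection\<close>

text \<open>The rotation step of Foata's construction: the list is cut behind every element
  satisfying P, and the last element of each piece moves to its front. A tail without such an
  element stays as it is; the hypothesis \<open>xs \<noteq> [] \<longrightarrow> P (last xs)\<close>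
  in the lemmas rules such a tail out.\<close>

function rotate_blocks :: "('a \<Rightarrow> bool) \<Rightarrow> 'a list \<Rightarrow> 'a list" where
  "rotate_blocks P xs =
    (case dropWhile (\<lambda>x. \<not> P x) xs of
       [] \<Rightarrow> xs
     | p # ys \<Rightarrow> p # takeWhile (\<lambda>x. \<not> P x) xs @ rotate_blocks P ys)"
  by auto
termination
proof (relation "measure (\<lambda>(P, xs). length xs)")
  fix P :: "'a \<Rightarrow> bool" and xs p ys
  assume "dropWhile (\<lambda>x. \<not> P x) xs = p # ys"
  then have "length (p # ys) \<le> length xs" by (metis length_dropWhile_le)
  then show "((P, ys), (P, xs)) \<in> measure (\<lambda>(P, xs). length xs)" by simp
qed simp

declare rotate_blocks.simps [simp del]

lemma rotate_blocks_Nil [simp]: "rotate_blocks P [] = []"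
  by (subst rotate_blocks.simps) simp

lemma rotate_blocks_block:
  assumes "\<forall>b\<in>set bs. \<not> P b" and "P p"
  shows "rotate_blocks P (bs @ p # ys) = p # bs @ rotate_blocks P ys"
proof -
  have "dropWhile (\<lambda>x. \<not> P x) (bs @ p # ys) = p # ys" using assms by (subst dropWhile_append2) auto
  moreover have "takeWhile (\<lambda>x. \<not> P x) (bs @ p # ys) = bs"
    using assms by (subst takeWhile_append2) auto
  ultimately show ?thesis by (subst rotate_blocks.simps) simp
qed

text \<open>A list whose last element satisfies P is a sequence of pieces \<open>bs @ [p]\<close> in
  which p is the only element in P. The induction peels off the first piece and thus matches the
  recursion of \<open>rotate_blocks\<close>.\<close>

lemma last_block_induct [consumes 1, case_names Nil block]:
  assumes "xs \<noteq> [] \<longrightarrow> P (last xs)"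
    and "R []"
    and "\<And>bs p ys. \<forall>b\<in>set bs. \<not> P b \<Longrightarrow> P p \<Longrightarrow> ys \<noteq> [] \<longrightarrow> P (last ys) \<Longrightarrow> R ys \<Longrightarrow> R (bs @ p # ys)"
  shows "R xs"
  using assms(1)
proof (induction xs rule: length_induct)
  case (1 xs)
  show ?case
  proof (cases "xs = []")
    case False
    then have "\<exists>x\<in>set xs. P x" using 1 last_in_set by blast
    then obtain bs p ys where *: "xs = bs @ p # ys" "P p" "\<forall>b\<in>set bs. \<not> P b"
      by (metis split_list_first_prop)
    moreover have "ys \<noteq> [] \<longrightarrow> P (last ys)" using 1 * by auto
    moreover have "R ys" using 1 * \<open>ys \<noteq> [] \<longrightarrow> P (last ys)\<close> by simp
    ultimately show ?thesis using assms(3) by blast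
  qed (use assms in simp)
qed

lemma mset_rotate_blocks:
  assumes "xs \<noteq> [] \<longrightarrow> P (last xs)"
  shows "mset (rotate_blocks P xs) = mset xs"
  using assms by (induction rule: last_block_induct) (auto simp: rotate_blocks_block)

text \<open>Inside a piece, p jumps only over elements outside P, so neither class is reordered.
  This later protects the order of two letters that lie on the same side of a new one.\<close>

lemma filter_rotate_blocks:
  assumes "xs \<noteq> [] \<longrightarrow> P (last xs)"
  shows "filter P (rotate_blocks P xs) = filter P xs"
    and "filter (\<lambda>x. \<not> P x) (rotate_blocks P xs) = filter (\<lambda>x. \<not> P x) xs"
  using assms by (induction rule: last_block_induct) (auto simp: rotate_blocks_block)

lemma hd_rotate_blocks:
  assumes "xs \<noteq> [] \<longrightarrow> P (last xs)"
  shows "rotate_blocks P xs \<noteq> [] \<longrightarrow> P (hd (rotate_blocks P xs))"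
  using assms by (induction rule: last_block_induct) (auto simp: rotate_blocks_block)

text \<open>The pieces of the image start with their P element, so cutting before each element in P
  recovers them.\<close>

lemma rotate_blocks_inject:
  assumes "xs \<noteq> [] \<longrightarrow> P (last xs)" and "ys \<noteq> [] \<longrightarrow> P (last ys)"
    and "rotate_blocks P xs = rotate_blocks P ys"
  shows "xs = ys"
  using assms
proof (induction arbitrary: ys rule: last_block_induct)
  case Nil
  then show ?case by (metis mset_rotate_blocks mset_zero_iff rotate_blocks_Nil)
next
  case (block bs p xs)
  then have "ys \<noteq> []"
    by (metis append_is_Nil_conv list.distinct(1) rotate_blocks_Nil rotate_blocks_block)
  then have "\<exists>y\<in>set ys. P y" using block last_in_set by blast
  then obtain cs q zs where ys: "ys = cs @ q # zs" "P q" "\<forall>b\<in>set cs. \<not> P b"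
    by (metis split_list_first_prop)
  have zs: "zs \<noteq> [] \<longrightarrow> P (last zs)" using block.prems ys by auto
  have eq: "p = q" "bs @ rotate_blocks P xs = cs @ rotate_blocks P zs"
    using block.prems block.hyps ys by (simp_all add: rotate_blocks_block)
  \<comment> \<open>The rotated rest begins with an element in P, so the first block is the longest
    prefix outside P.\<close>
  have split: "takeWhile (\<lambda>x. \<not> P x) (es @ rotate_blocks P us) = es \<and>
      dropWhile (\<lambda>x. \<not> P x) (es @ rotate_blocks P us) = rotate_blocks P us"
    if "\<forall>b\<in>set es. \<not> P b" "us \<noteq> [] \<longrightarrow> P (last us)" for es us
    using hd_rotate_blocks[of us P, OF that(2)] that(1) by (cases "rotate_blocks P us") auto
  have "bs = cs" "rotate_blocks P xs = rotate_blocks P zs"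
    using split[OF block.hyps(1,3)] split[OF ys(3) zs] eq(2) by metis+
  then show ?case using block.IH[OF zs] eq ys by simp
qed

section \<open>Inversions of words and their change under rotation\<close>

primrec inv_list :: "'a::linorder list \<Rightarrow> nat" where
  "inv_list [] = 0"
| "inv_list (x # xs) = length (filter (\<lambda>y. y < x) xs) + inv_list xs"

text \<open>Inversions between two adjacent segments. Taking multisets makes it visible that a
  rearrangement inside either segment leaves this number unchanged.\<close>

definition cross_inv :: "'a::linorder multiset \<Rightarrow> 'a multiset \<Rightarrow> nat" where
  "cross_inv A B = (\<Sum>x\<in>#A. size (filter_mset (\<lambda>y. y < x) B))"

lemma cross_inv_add_left [simp]: "cross_inv (add_mset x A) B = size (filter_mset (\<lambda>y. y < x) B) + cross_inv A B"
  by (simp add: cross_inv_def)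

lemma cross_inv_empty [simp]: "cross_inv {#} B = 0"
  by (simp add: cross_inv_def)

lemma cross_inv_add_right:
  "cross_inv A (add_mset y B) = size (filter_mset (\<lambda>x. y < x) A) + cross_inv A B"
  by (induction A) auto

lemma size_filter_mset_mset: "size (filter_mset P (mset xs)) = length (filter P xs)"
  by (metis mset_filter size_mset)

lemma inv_list_append:
  "inv_list (xs @ ys) = inv_list xs + inv_list ys + cross_inv (mset xs) (mset ys)"
  by (induction xs) (auto simp: size_filter_mset_mset)

lemma inv_list_snoc: "inv_list (xs @ [x]) = inv_list xs + length (filter (\<lambda>y. x < y) xs)"
  by (induction xs) auto

text \<open>In each piece the larger p moves in front of the smaller block, which creates one
  inversion per element of the block; every element outside P lies in exactly one block.\<close>

lemma inv_list_rotate_above: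
  assumes "xs \<noteq> [] \<longrightarrow> P (last xs)" and "\<And>x y. P x \<Longrightarrow> \<not> P y \<Longrightarrow> y < x"
  shows "inv_list (rotate_blocks P xs) = inv_list xs + length (filter (\<lambda>x. \<not> P x) xs)"
  using assms(1)
proof (induction rule: last_block_induct)
  case (block bs p ys)
  have "filter (\<lambda>y. y < p) bs = bs" "filter (\<lambda>x. p < x) bs = []"
    using block.hyps assms(2) by (auto simp: filter_id_conv filter_empty_conv dest: less_asym)
  moreover have "filter (\<lambda>x. \<not> P x) bs = bs" using block.hyps by (auto simp: filter_id_conv)
  moreover have "length (filter (\<lambda>y. y < p) (rotate_blocks P ys)) = length (filter (\<lambda>y. y < p) ys)"
    using mset_rotate_blocks[of ys P, OF block.hyps(3)] by (metis size_filter_mset_mset)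
  ultimately show ?case using block mset_rotate_blocks[of ys P, OF block.hyps(3)]
    by (simp add: rotate_blocks_block inv_list_append cross_inv_add_right size_filter_mset_mset)
qed simp

text \<open>The mirror image: p starts out behind larger letters, and every jump removes an
  inversion. The additive form avoids truncated subtraction.\<close>

lemma inv_list_rotate_below:
  assumes "xs \<noteq> [] \<longrightarrow> P (last xs)" and "\<And>x y. P x \<Longrightarrow> \<not> P y \<Longrightarrow> x < y"
  shows "inv_list (rotate_blocks P xs) + length (filter (\<lambda>x. \<not> P x) xs) = inv_list xs"
  using assms(1)
proof (induction rule: last_block_induct)
  case (block bs p ys)
  have "filter (\<lambda>y. y < p) bs = []" "filter (\<lambda>x. p < x) bs = bs"
    using block.hyps assms(2) by (auto simp: filter_id_conv filter_empty_conv dest: less_asym)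
  moreover have "filter (\<lambda>x. \<not> P x) bs = bs" using block.hyps by (auto simp: filter_id_conv)
  moreover have "length (filter (\<lambda>y. y < p) (rotate_blocks P ys)) = length (filter (\<lambda>y. y < p) ys)"
    using mset_rotate_blocks[of ys P, OF block.hyps(3)] by (metis size_filter_mset_mset)
  ultimately show ?case using block mset_rotate_blocks[of ys P, OF block.hyps(3)]
    by (simp add: rotate_blocks_block inv_list_append cross_inv_add_right size_filter_mset_mset)
qed simp

section \<open>The major index and Foata's map on words\<close>

definition maj_list :: "'a::linorder list \<Rightarrow> nat" where
  "maj_list xs = \<Sum> {i. 1 \<le> i \<and> i < length xs \<and> xs ! i < xs ! (i - 1)}"

text \<open>Appending x can only add the descent between the last letter and x, and its position,
  counted from 1, is \<open>length xs\<close>.\<close>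

lemma maj_list_snoc:
  "maj_list (xs @ [x]) = maj_list xs + (if xs \<noteq> [] \<and> x < last xs then length xs else 0)"
proof -
  have "{i. 1 \<le> i \<and> i < length (xs @ [x]) \<and> (xs @ [x]) ! i < (xs @ [x]) ! (i - 1)} =
        {i. 1 \<le> i \<and> i < length xs \<and> xs ! i < xs ! (i - 1)} \<union>
        (if xs \<noteq> [] \<and> x < last xs then {length xs} else {})"
    by (cases "xs = []") (auto simp: nth_append last_conv_nth less_Suc_eq split: if_splits)
  then show ?thesis by (auto simp: maj_list_def sum.union_disjoint)
qed

text \<open>P is chosen as the side of x on which the last letter lies, so that the last piece is
  always closed.\<close>

definition foata_step :: "'a::linorder \<Rightarrow> 'a list \<Rightarrow> 'a list" where
  "foata_step x xs = rotate_blocks (if xs \<noteq> [] \<and> x < last xs then (\<lambda>y. x < y) else (\<lambda>y. \<not> x < y)) xs"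

definition foata :: "'a::linorder list \<Rightarrow> 'a list" where
  "foata = foldl (\<lambda>xs x. foata_step x xs @ [x]) []"

lemma foata_Nil [simp]: "foata [] = []"
  by (simp add: foata_def)

lemma foata_snoc [simp]: "foata (xs @ [x]) = foata_step x (foata xs) @ [x]"
  by (simp add: foata_def)

lemma mset_foata_step [simp]: "mset (foata_step x xs) = mset xs"
  unfolding foata_step_def by (rule mset_rotate_blocks) simp

lemma filter_foata_step:
  "filter (\<lambda>y. x < y) (foata_step x xs) = filter (\<lambda>y. x < y) xs"
  "filter (\<lambda>y. \<not> x < y) (foata_step x xs) = filter (\<lambda>y. \<not> x < y) xs"
  using filter_rotate_blocks[of xs "\<lambda>y. x < y"] filter_rotate_blocks[of xs "\<lambda>y. \<not> x < y"]
  by (auto simp: foata_step_def)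

text \<open>The image starts with a letter on the chosen side, so the choice of P can be read off
  the image, and injectivity of the rotation applies.\<close>

lemma foata_step_inject:
  assumes "foata_step x xs = foata_step x ys"
  shows "xs = ys"
proof -
  have hd: "us \<noteq> [] \<Longrightarrow> x < hd (foata_step x us) \<longleftrightarrow> x < last us" for us
    using hd_rotate_blocks[of us "\<lambda>y. x < y"] hd_rotate_blocks[of us "\<lambda>y. \<not> x < y"]
      mset_foata_step[of x us]
    by (auto simp: foata_step_def)
  have ne: "xs = [] \<longleftrightarrow> ys = []" by (metis assms mset_foata_step mset_zero_iff)
  show ?thesis
  proof (cases "xs = []")
    case False
    with ne hd assms have "x < last xs \<longleftrightarrow> x < last ys" by metis
    then show ?thesis using assms ne False rotate_blocks_inject[of xs "\<lambda>y. x < y" ys]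
        rotate_blocks_inject[of xs "\<lambda>y. \<not> x < y" ys]
      by (auto simp: foata_step_def split: if_splits)
  qed (use ne in simp)
qed

lemma mset_foata [simp]: "mset (foata xs) = mset xs"
  by (induction xs rule: rev_induct) auto

lemma inj_foata: "inj foata"
proof (rule injI)
  fix xs ys :: "'a list"
  assume "foata xs = foata ys"
  then show "xs = ys"
  proof (induction xs arbitrary: ys rule: rev_induct)
    case Nil
    then show ?case by (metis foata_Nil mset_foata mset_zero_iff)
  next
    case (snoc x xs)
    then show ?case by (cases ys rule: rev_cases) (auto dest: foata_step_inject)
  qed
qed

lemma last_foata: "last (foata xs) = last xs"
  by (cases xs rule: rev_cases) auto

text \<open>Appending x adds as many inversions as there are letters above x. If the last letter is
  above x, the rotation adds the number of the other letters, in total \<open>length xs\<close>, as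
  for the major index; otherwise the rotation removes exactly what appending adds.\<close>

lemma inv_list_foata: "inv_list (foata xs) = maj_list xs"
proof (induction xs rule: rev_induct)
  case Nil
  then show ?case by (simp add: maj_list_def)
next
  case (snoc x xs)
  let ?ys = "foata xs"
  have ne: "?ys = [] \<longleftrightarrow> xs = []" by (metis mset_foata mset_zero_iff)
  have len: "length (filter (\<lambda>y. x < y) ?ys) + length (filter (\<lambda>y. \<not> x < y) ?ys) = length xs"
    by (metis mset_foata size_mset sum_length_filter_compl)
  have app: "inv_list (foata (xs @ [x])) = inv_list (foata_step x ?ys) + length (filter (\<lambda>y. x < y) ?ys)"
    by (simp add: inv_list_snoc filter_foata_step(1))
  show ?case
  proof (cases "xs \<noteq> [] \<and> x < last xs")
    case True
    then have "inv_list (foata_step x ?ys) = inv_list ?ys + length (filter (\<lambda>y. \<not> x < y) ?ys)"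
      using inv_list_rotate_above[of ?ys "\<lambda>y. x < y"] ne by (auto simp: foata_step_def last_foata)
    with app len True snoc show ?thesis by (simp add: maj_list_snoc)
  next
    case False
    then have "foata_step x ?ys = rotate_blocks (\<lambda>y. \<not> x < y) ?ys"
      using ne by (auto simp: foata_step_def last_foata)
    moreover have "?ys \<noteq> [] \<longrightarrow> \<not> x < last ?ys" using False ne by (auto simp: last_foata)
    then have "inv_list (rotate_blocks (\<lambda>y. \<not> x < y) ?ys) +
        length (filter (\<lambda>y. \<not> \<not> x < y) ?ys) = inv_list ?ys"
      by (rule inv_list_rotate_below) (meson le_less_trans not_less)
    ultimately have "inv_list (foata_step x ?ys) + length (filter (\<lambda>y. x < y) ?ys) = inv_list ?ys"
      by simp
    with app False snoc show ?thesis by (auto simp: maj_list_snoc)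
  qed
qed

lemma filter_eq_replicate: "filter (\<lambda>z. z = x) xs = replicate (count (mset xs) x) x"
  by (induction xs) auto

text \<open>Both neighbours lie on the same side of every other letter, so no step separates them.\<close>

lemma foata_preserves_inverse_descents:
  assumes "distinct xs" and "x < y" and "\<And>z. z \<in> set xs \<Longrightarrow> \<not> (x < z \<and> z < y)"
  shows "filter (\<lambda>z. z = x \<or> z = y) (foata xs) = filter (\<lambda>z. z = x \<or> z = y) xs"
  using assms(1,3)
proof (induction xs rule: rev_induct)
  case (snoc z xs)
  let ?ys = "foata xs" and ?Q = "\<lambda>z. z = x \<or> z = y"
  have IH: "filter ?Q ?ys = filter ?Q xs" using snoc by simp
  have z: "z \<notin> set xs" "z \<notin> set ?ys" "z \<notin> set (foata_step z ?ys)"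
    using snoc.prems by (auto simp flip: set_mset_mset)
  consider "z = x" | "z = y" | "z < x" | "y < z"
    using snoc.prems by fastforce
  then have "filter ?Q (foata_step z ?ys) = filter ?Q xs"
  proof cases
    case 1
    then have "filter ?Q us = filter (\<lambda>z. z = y) us" if "z \<notin> set us" for us
      using that by (intro filter_cong) auto
    with z show ?thesis by (simp add: filter_eq_replicate)
  next
    case 2
    then have "filter ?Q us = filter (\<lambda>z. z = x) us" if "z \<notin> set us" for us
      using that by (intro filter_cong) auto
    with z show ?thesis by (simp add: filter_eq_replicate)
  next
    case 3
    then have "filter ?Q us = filter ?Q (filter (\<lambda>y. z < y) us)" for us
      using \<open>x < y\<close> by (auto intro!: filter_cong)
    then show ?thesis using filter_foata_step(1) IH by metis
  next
    case 4
    then have "filter ?Q us = filter ?Q (filter (\<lambda>y. \<not> z < y) us)" for us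
      using \<open>x < y\<close> by (auto intro!: filter_cong)
    then show ?thesis using filter_foata_step(2) IH by metis
  qed
  then show ?case by simp
qed simp

subsection \<open>Signed permutations and their windows\<close>

lemma signed_permsD:
  assumes "w \<in> signed_perms n"
  shows "w permutes ({- int n..int n} - {0})" and "w (- i) = - w i" and "bij w" and "w 0 = 0"
proof -
  show *: "w permutes ({- int n..int n} - {0})" and "w (- i) = - w i"
    using assms by (simp_all add: signed_perms_def)
  show "bij w" "w 0 = 0" using permutes_bij[OF *] permutes_not_in[OF *] by simp_all
qed

lemma finite_signed_perms [simp]: "finite (signed_perms n)"
proof -
  have "signed_perms n \<subseteq> {w. w permutes ({- int n..int n} - {0})}" by (auto simp: signed_perms_def)
  then show ?thesis using finite_permutations[of "{- int n..int n} - {0}"] finite_subset by blast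
qed

lemma signed_perm_abs_range:
  assumes "w \<in> signed_perms n" and "i \<in> {1..n}"
  shows "w (int i) \<noteq> 0" and "nat \<bar>w (int i)\<bar> \<in> {1..n}"
proof -
  have "int i \<in> {- int n..int n} - {0}" using assms(2) by auto
  then have "w (int i) \<in> {- int n..int n} - {0}"
    using permutes_in_image[OF signed_permsD(1)[OF assms(1)]] by blast
  then show "w (int i) \<noteq> 0" "nat \<bar>w (int i)\<bar> \<in> {1..n}" by auto
qed

lemma signed_perm_outside:
  assumes "w \<in> signed_perms n" and "i \<notin> {1..n}"
  shows "w (int i) = int i"
  using signed_permsD(1)[OF assms(1)] assms(2) by (intro permutes_not_in) auto

lemma signed_perm_eqI:
  assumes "v \<in> signed_perms n" "w \<in> signed_perms n" and "\<And>i. i \<in> {1..n} \<Longrightarrow> v (int i) = w (int i)"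
  shows "v = w"
proof
  fix x :: int
  have nat: "v (int i) = w (int i)" for i
    using assms signed_perm_outside by (cases "i \<in> {1..n}") metis+
  show "v x = w x"
  proof (cases "0 \<le> x")
    case True
    then show ?thesis using nat[of "nat x"] by simp
  next
    case False
    then show ?thesis using nat[of "nat (- x)"] signed_permsD(2)[OF assms(1), of "- x"]
        signed_permsD(2)[OF assms(2), of "- x"] by simp
  qed
qed

lemma inv_signed_perm:
  assumes "w \<in> signed_perms n"
  shows "inv w \<in> signed_perms n"
proof -
  have "inv w (- i) = - inv w i" for i using signed_permsD(2,3)[OF assms] by (metis bij_inv_eq_iff)
  then show ?thesis
    using permutes_inv[OF signed_permsD(1)[OF assms]] by (simp add: signed_perms_def)
qed

lemma inv_inv_signed_perm: "w \<in> signed_perms n \<Longrightarrow> inv (inv w) = w"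
  using signed_permsD(3) inv_inv_eq by blast

lemma signed_perm_inv_apply [simp]:
  assumes "w \<in> signed_perms n"
  shows "w (inv w x) = x" "inv w (w x) = x"
  using signed_permsD(3)[OF assms] by (simp_all add: bij_is_inj bij_is_surj surj_f_inv_f)

lemma signed_perm_abs:
  assumes "w \<in> signed_perms n"
  shows "\<bar>w \<bar>x\<bar>\<bar> = \<bar>w x\<bar>"
  using signed_permsD(2)[OF assms, of x] by (cases "0 \<le> x") auto

lemma abs_inv_signed_perm:
  assumes "w \<in> signed_perms n"
  shows "\<bar>inv w \<bar>w x\<bar>\<bar> = \<bar>x\<bar>" and "\<bar>w \<bar>inv w x\<bar>\<bar> = \<bar>x\<bar>"
  using signed_perm_abs[OF inv_signed_perm[OF assms]] signed_perm_abs[OF assms] assms by simp_all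

lemma abs_signed_perm_permutes:
  assumes "w \<in> signed_perms n"
  shows "(\<lambda>i. nat \<bar>w (int i)\<bar>) permutes {1..n}"
proof (rule bij_imp_permutes)
  show "bij_betw (\<lambda>i. nat \<bar>w (int i)\<bar>) {1..n} {1..n}"
  proof (rule bij_betw_byWitness[where f' = "\<lambda>i. nat \<bar>inv w (int i)\<bar>"])
    show "\<forall>a\<in>{1..n}. nat \<bar>inv w (int (nat \<bar>w (int a)\<bar>))\<bar> = a"
      "\<forall>a\<in>{1..n}. nat \<bar>w (int (nat \<bar>inv w (int a)\<bar>))\<bar> = a"
      by (simp_all add: abs_inv_signed_perm[OF assms])
    show "(\<lambda>i. nat \<bar>w (int i)\<bar>) ` {1..n} \<subseteq> {1..n}" using signed_perm_abs_range(2)[OF assms] by blast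
    show "(\<lambda>i. nat \<bar>inv w (int i)\<bar>) ` {1..n} \<subseteq> {1..n}"
      using signed_perm_abs_range(2)[OF inv_signed_perm[OF assms]] by blast
  qed
  show "nat \<bar>w (int i)\<bar> = i" if "i \<notin> {1..n}" for i using signed_perm_outside[OF assms that] by simp
qed

definition signed_ext :: "nat \<Rightarrow> (nat \<Rightarrow> int) \<Rightarrow> signed_perm" where
  "signed_ext n g x =
    (if x \<in> {1..int n} then g (nat x) else if - x \<in> {1..int n} then - g (nat (- x)) else x)"

lemma signed_ext_nat [simp]: "i \<in> {1..n} \<Longrightarrow> signed_ext n g (int i) = g i"
  by (simp add: signed_ext_def)

text \<open>It is enough that absolute values are permuted: two letters with the same absolute value
  are equal or opposite, and an odd map with nonzero values separates opposite letters.\<close>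

lemma signed_ext_signed_perm:
  assumes "bij_betw (\<lambda>i. nat \<bar>g i\<bar>) {1..n} {1..n}"
  shows "signed_ext n g \<in> signed_perms n"
proof -
  let ?A = "{- int n..int n} - {0}" and ?w = "signed_ext n g"
  have odd: "?w (- x) = - ?w x" for x by (auto simp: signed_ext_def)
  have abs: "\<bar>?w x\<bar> = \<bar>g (nat \<bar>x\<bar>)\<bar> \<and> nat \<bar>x\<bar> \<in> {1..n}" if "x \<in> ?A" for x
    using that by (auto simp: signed_ext_def)
  have rng: "nat \<bar>g i\<bar> \<in> {1..n}" if "i \<in> {1..n}" for i using assms that bij_betwE by fast
  have A_iff: "nat \<bar>y\<bar> \<in> {1..n} \<Longrightarrow> y \<in> ?A" for y by auto
  have "?w x \<in> ?A" if "x \<in> ?A" for x using abs[OF that] rng[of "nat \<bar>x\<bar>"] by (intro A_iff) simp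
  moreover have "inj_on ?w ?A"
  proof (rule inj_onI)
    fix x y assume x: "x \<in> ?A" and y: "y \<in> ?A" and eq: "?w x = ?w y"
    have "nat \<bar>x\<bar> = nat \<bar>y\<bar>" using abs[OF x] abs[OF y] eq bij_betw_imp_inj_on[OF assms]
      by (metis (no_types, lifting) inj_onD)
    then have "x = y \<or> x = - y" by auto
    moreover have "?w y \<noteq> 0" using abs[OF y] rng[of "nat \<bar>y\<bar>"] by auto
    ultimately show "x = y" using eq odd[of y] by auto
  qed
  ultimately have "bij_betw ?w ?A ?A"
    unfolding bij_betw_def using endo_inj_surj[of ?A ?w] image_subsetI[of ?A ?w ?A] by blast
  moreover have "?w x = x" if "x \<notin> ?A" for x using that by (auto simp: signed_ext_def)
  ultimately have "?w permutes ?A" by (rule bij_imp_permutes)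
  with odd show ?thesis by (simp add: signed_perms_def)
qed

text \<open>Maps the order of barred and unbarred letters to the order of the integers.\<close>

definition r_embed :: "nat \<Rightarrow> int \<Rightarrow> int" where
  "r_embed n a = (if a < 0 then - a - (int n + 1) else a)"

lemma less_r_iff_r_embed:
  assumes "a \<noteq> 0" "b \<noteq> 0" "\<bar>a\<bar> \<le> int n" "\<bar>b\<bar> \<le> int n"
  shows "a <\<^sub>r b \<longleftrightarrow> r_embed n a < r_embed n b"
  using assms by (auto simp: less_r_def r_embed_def)

lemma r_embed_invol: "\<bar>a\<bar> \<le> int n \<Longrightarrow> r_embed n (r_embed n a) = a"
  by (auto simp: r_embed_def)

lemma r_embed_neg_iff: "\<bar>a\<bar> \<le> int n \<Longrightarrow> r_embed n a < 0 \<longleftrightarrow> a < 0"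
  by (auto simp: r_embed_def)

section \<open>Windows as words over the integers\<close>

definition window :: "nat \<Rightarrow> signed_perm \<Rightarrow> int list" where
  "window n u = map (\<lambda>i. r_embed n (u (int i))) [1..<Suc n]"

lemma length_window [simp]: "length (window n u) = n"
  by (simp add: window_def)

lemma nth_window: "i < n \<Longrightarrow> window n u ! i = r_embed n (u (int (Suc i)))"
  by (simp add: window_def del: upt_Suc)

lemma nth_window_pred: "i \<in> {1..n} \<Longrightarrow> window n u ! (i - 1) = r_embed n (u (int i))"
  by (subst nth_window) auto

lemma set_window: "set (window n u) = (\<lambda>i. r_embed n (u (int i))) ` {1..n}"
  by (auto simp: window_def simp del: upt_Suc)

lemma signed_perm_abs_le:
  assumes "w \<in> signed_perms n" and "i \<in> {1..n}"
  shows "\<bar>w (int i)\<bar> \<le> int n"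
  using signed_perm_abs_range(2)[OF assms] by auto

lemma distinct_window:
  assumes "u \<in> signed_perms n"
  shows "distinct (window n u)"
proof -
  have "inj_on (\<lambda>i. r_embed n (u (int i))) {1..n}"
  proof (rule inj_onI)
    fix i j assume ij: "i \<in> {1..n}" "j \<in> {1..n}" "r_embed n (u (int i)) = r_embed n (u (int j))"
    then have "u (int i) = u (int j)" by (metis assms r_embed_invol signed_perm_abs_le)
    then show "i = j" using signed_permsD(3)[OF assms] by (metis bij_pointE of_nat_eq_iff)
  qed
  moreover have "set [1..<Suc n] = {1..n}" by auto
  ultimately show ?thesis unfolding window_def distinct_map by (metis distinct_upt)
qed

lemma inv_list_card: "inv_list xs = card {(i, j). i < j \<and> j < length xs \<and> xs ! j < xs ! i}"
proof (induction xs rule: rev_induct)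
  case (snoc x xs)
  let ?A = "{(i, j). i < j \<and> j < length xs \<and> xs ! j < xs ! i}"
  let ?B = "(\<lambda>i. (i, length xs)) ` {i. i < length xs \<and> x < xs ! i}"
  have "{(i, j). i < j \<and> j < length (xs @ [x]) \<and> (xs @ [x]) ! j < (xs @ [x]) ! i} = ?A \<union> ?B"
    by (auto simp: nth_append less_Suc_eq)
  moreover have "finite ?A" by (rule finite_subset[of _ "{..<length xs} \<times> {..<length xs}"]) auto
  moreover have "finite ?B" "?A \<inter> ?B = {}" by auto
  moreover have "card ?B = length (filter (\<lambda>y. x < y) xs)"
    by (subst card_image) (auto simp: inj_on_def length_filter_conv_card)
  ultimately show ?case using snoc by (simp add: card_Un_disjoint inv_list_snoc)
qed simp

lemma inv_num_window:
  assumes "u \<in> signed_perms n"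
  shows "inv_num n u = inv_list (window n u)"
proof -
  have less: "u (int j) <\<^sub>r u (int i) \<longleftrightarrow> window n u ! (j - 1) < window n u ! (i - 1)"
    if "i \<in> {1..n}" "j \<in> {1..n}" for i j
    using that signed_perm_abs_range(1)[OF assms] signed_perm_abs_le[OF assms]
    by (simp only: nth_window_pred) (intro less_r_iff_r_embed)
  let ?B = "{(i, j). i < j \<and> j < n \<and> window n u ! j < window n u ! i}"
  have "{(i, j). 1 \<le> i \<and> i < j \<and> j \<le> n \<and> u (int j) <\<^sub>r u (int i)} = map_prod Suc Suc ` ?B"
  proof (intro equalityI subsetI)
    fix p assume p: "p \<in> {(i, j). 1 \<le> i \<and> i < j \<and> j \<le> n \<and> u (int j) <\<^sub>r u (int i)}"
    then obtain i j where ij: "p = (i, j)" "1 \<le> i" "i < j" "j \<le> n" "u (int j) <\<^sub>r u (int i)" by auto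
    then have "(i - 1, j - 1) \<in> ?B" using less[of i j] by auto
    then show "p \<in> map_prod Suc Suc ` ?B"
      using ij by (auto intro!: image_eqI[of _ _ "(i - 1, j - 1)"])
  next
    fix p assume "p \<in> map_prod Suc Suc ` ?B"
    then obtain i j where "p = (Suc i, Suc j)" "i < j" "j < n" "window n u ! j < window n u ! i"
      by auto
    then show "p \<in> {(i, j). 1 \<le> i \<and> i < j \<and> j \<le> n \<and> u (int j) <\<^sub>r u (int i)}"
      using less[of "Suc i" "Suc j"] by auto
  qed
  moreover have "inj_on (map_prod Suc Suc) ?B" by (auto simp: inj_on_def)
  ultimately show ?thesis by (simp add: inv_num_def inv_list_card card_image)
qed

lemma maj_window:
  assumes "u \<in> signed_perms n"
  shows "maj n u = maj_list (window n u)"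
proof -
  have "u (int (i + 1)) <\<^sub>r u (int i) \<longleftrightarrow> window n u ! i < window n u ! (i - 1)"
    if "1 \<le> i" "i < n" for i
    using that less_r_iff_r_embed[of "u (int (i + 1))" "u (int i)" n]
      signed_perm_abs_range(1)[OF assms] signed_perm_abs_le[OF assms, of "i + 1"]
      signed_perm_abs_le[OF assms, of i] signed_perm_abs_range(1)[OF assms, of "i + 1"]
    by (simp add: nth_window)
  then show ?thesis unfolding maj_def Des_def maj_list_def by (intro arg_cong[of _ _ Sum]) auto
qed

lemma bar_num_window:
  assumes "u \<in> signed_perms n"
  shows "bar_num n u = size (filter_mset (\<lambda>a. a < 0) (mset (window n u)))"
proof -
  have "filter (\<lambda>a. a < 0) (window n u) =
      map (\<lambda>i. r_embed n (u (int i))) (filter (\<lambda>i. u (int i) < 0) [1..<Suc n])"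
    unfolding window_def filter_map o_def
    by (intro arg_cong[of _ _ "map _"] filter_cong refl r_embed_neg_iff signed_perm_abs_le[OF assms]) auto
  then have "length (filter (\<lambda>a. a < 0) (window n u)) =
      card (set (filter (\<lambda>i. u (int i) < 0) [1..<Suc n]))"
    by (metis distinct_card distinct_filter distinct_upt length_map)
  also have "set (filter (\<lambda>i. u (int i) < 0) [1..<Suc n]) = {i \<in> {1..n}. u (int i) < 0}" by auto
  finally show ?thesis by (simp add: bar_num_def size_filter_mset_mset)
qed

text \<open>Turns the order of two letters in a word into an equation between filtered words, the
  form in which Foata's map is known to preserve it.\<close>

lemma filter_pair_iff:
  assumes "distinct xs" "i < length xs" "j < length xs" "i \<noteq> j"
  shows "filter (\<lambda>z. z = xs ! i \<or> z = xs ! j) xs = [xs ! i, xs ! j] \<longleftrightarrow> i < j"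
proof -
  have *: "filter (\<lambda>z. z = xs ! i \<or> z = xs ! j) xs = [xs ! i, xs ! j]"
    if "distinct xs" "i < j" "j < length xs" for xs :: "'a list" and i j
    using that
  proof (induction xs arbitrary: i j)
    case (Cons a xs)
    obtain j' where j: "j = Suc j'" using Cons.prems by (cases j) auto
    show ?case
    proof (cases i)
      case 0
      have "filter (\<lambda>z. z = a \<or> z = xs ! j') xs = filter (\<lambda>z. z = xs ! j') xs"
        using Cons.prems by (intro filter_cong) auto
      also have "count (mset xs) (xs ! j') = 1"
        using Cons.prems j by (simp add: distinct_count_atmost_1[THEN iffD1, rule_format])
      then have "filter (\<lambda>z. z = xs ! j') xs = [xs ! j']" by (simp add: filter_eq_replicate)
      finally show ?thesis using 0 j by simp
    next
      case (Suc i')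
      then have "a \<noteq> xs ! i'" "a \<noteq> xs ! j'" using Cons.prems j by (auto simp: nth_mem)
      then show ?thesis using Cons.IH[of i' j'] Cons.prems Suc j by simp
    qed
  qed simp
  show ?thesis
  proof (cases "i < j")
    case True
    then show ?thesis using * assms by blast
  next
    case False
    then have "filter (\<lambda>z. z = xs ! j \<or> z = xs ! i) xs = [xs ! j, xs ! i]"
      using * assms by (metis linorder_less_linear)
    moreover have "(\<lambda>z. z = xs ! j \<or> z = xs ! i) = (\<lambda>z. z = xs ! i \<or> z = xs ! j)" by auto
    moreover have "xs ! i \<noteq> xs ! j" using assms by (simp add: nth_eq_iff_index_eq)
    ultimately show ?thesis using False by simp
  qed
qed

text \<open>The sign of \<open>inv u s\<close> tells which of s and barred s occurs in the window.
  If the signs at s and s + 1 differ, s lies in the signed descent set whichever sign comes first.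
  If they agree, the two letters are consecutive integers after \<open>r_embed\<close>, and only
  their order in the window decides.\<close>

lemma sDes_inv_eq:
  assumes u: "u \<in> signed_perms n" and v: "v \<in> signed_perms n"
    and set_eq: "set (window n u) = set (window n v)"
    and order_eq: "\<And>x. filter (\<lambda>z. z = x \<or> z = x + 1) (window n u) =
      filter (\<lambda>z. z = x \<or> z = x + 1) (window n v)"
  shows "sDes n (inv u) = sDes n (inv v)"
proof -
  \<comment> \<open>The one of s and barred s that occurs in the window of w; its place there is the
    absolute value of \<open>inv w s\<close>.\<close>
  define letter where "letter w s = r_embed n (if inv (w :: signed_perm) (int s) < 0 then - int s else int s)" for w s
  have pos: "window n w ! (nat \<bar>inv w (int s)\<bar> - 1) = letter w s \<and> nat \<bar>inv w (int s)\<bar> \<in> {1..n}"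
    if w: "w \<in> signed_perms n" and s: "s \<in> {1..n}" for w s
  proof -
    let ?p = "nat \<bar>inv w (int s)\<bar>"
    have p: "?p \<in> {1..n}" by (rule signed_perm_abs_range(2)[OF inv_signed_perm[OF w] s])
    have "w (int ?p) = (if inv w (int s) < 0 then - int s else int s)"
      using signed_permsD(2)[OF w, of "inv w (int s)"] w by auto
    moreover have "window n w ! (?p - 1) = r_embed n (w (int ?p))"
      using p by (subst nth_window) auto
    ultimately show ?thesis using p by (simp add: letter_def)
  qed
  have neg_iff: "inv w (int s) < 0 \<longleftrightarrow> r_embed n (- int s) \<in> set (window n w)"
    if w: "w \<in> signed_perms n" and s: "s \<in> {1..n}" for w s
  proof
    assume "inv w (int s) < 0"
    then have "letter w s = r_embed n (- int s)" by (simp add: letter_def)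
    then show "r_embed n (- int s) \<in> set (window n w)"
      using pos[OF w s] by (metis Suc_diff_1 atLeastAtMost_iff le_simps(2) length_window
          less_le_trans less_one linorder_not_less nth_mem)
  next
    assume "r_embed n (- int s) \<in> set (window n w)"
    then obtain i where i: "i \<in> {1..n}" "r_embed n (w (int i)) = r_embed n (- int s)"
      by (auto simp: set_window)
    then have "w (int i) = - int s"
      using r_embed_invol[of "w (int i)" n] r_embed_invol[of "- int s" n]
        signed_perm_abs_le[OF w i(1)] s by auto
    then have "int i = - inv w (int s)" using signed_perm_inv_apply(2)[OF w, of "int i"]
        signed_permsD(2)[OF inv_signed_perm[OF w], of "int s"] by simp
    then show "inv w (int s) < 0" using i by auto
  qed
  have neg_eq: "inv u (int s) < 0 \<longleftrightarrow> inv v (int s) < 0" for s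
  proof (cases "s \<in> {1..n}")
    case True
    then show ?thesis using neg_iff[OF u True] neg_iff[OF v True] set_eq by simp
  next
    case False
    then show ?thesis
      using signed_perm_outside[OF inv_signed_perm[OF u]] signed_perm_outside[OF inv_signed_perm[OF v]]
      by simp
  qed
  have cond: "inv w (int (s + 1)) <\<^sub>r inv w (int s) \<or> (inv w (int s) < 0 \<and> 0 < inv w (int (s + 1))) \<longleftrightarrow>
      (inv w (int s) < 0) \<noteq> (inv w (int (s + 1)) < 0) \<or>
      filter (\<lambda>z. z = letter w s \<or> z = letter w s + 1) (window n w) \<noteq> [letter w s, letter w s + 1]"
    if w: "w \<in> signed_perms n" and s: "1 \<le> s" "s < n" for w s
  proof -
    have s': "s \<in> {1..n}" "s + 1 \<in> {1..n}" using s by auto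
    let ?a = "inv w (int s)" and ?b = "inv w (int (s + 1))"
    let ?p = "nat \<bar>?a\<bar> - 1" and ?q = "nat \<bar>?b\<bar> - 1"
    have nz: "?a \<noteq> 0" "?b \<noteq> 0" using signed_perm_abs_range(1)[OF inv_signed_perm[OF w]] s' by blast+
    show ?thesis
    proof (cases "(?a < 0) = (?b < 0)")
      case True
      then have "letter w (s + 1) = letter w s + 1" using s by (auto simp: letter_def r_embed_def)
      moreover have "?a \<noteq> ?b"
        using signed_perm_inv_apply(1)[OF w] by (metis add_cancel_right_right of_nat_eq_iff zero_neq_one)
      have "m - 1 < n" if "m \<in> {1..n}" for m using that by auto
      then have pq: "?p < n" "?q < n" using pos[OF w s'(1)] pos[OF w s'(2)] by blast+
      have "?p \<noteq> ?q" using True nz \<open>?a \<noteq> ?b\<close> by (auto simp: abs_if split: if_splits)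
      ultimately have "filter (\<lambda>z. z = letter w s \<or> z = letter w s + 1) (window n w) =
          [letter w s, letter w s + 1] \<longleftrightarrow> ?p < ?q"
        using pos[OF w s'(1), THEN conjunct1] pos[OF w s'(2), THEN conjunct1] pq
          filter_pair_iff[OF distinct_window[OF w], of ?p ?q]
        by (simp only: length_window simp_thms)
      moreover have "?b <\<^sub>r ?a \<longleftrightarrow> \<not> ?p < ?q" using True nz \<open>?p \<noteq> ?q\<close> by (auto simp: less_r_def)
      ultimately show ?thesis using True nz by auto
    next
      case False
      then show ?thesis using nz by (auto simp: less_r_def)
    qed
  qed
  have "letter u s = letter v s" for s by (simp add: letter_def neg_eq)
  then have "inv u (int (s + 1)) <\<^sub>r inv u (int s) \<or> (inv u (int s) < 0 \<and> 0 < inv u (int (s + 1))) \<longleftrightarrow>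
      inv v (int (s + 1)) <\<^sub>r inv v (int s) \<or> (inv v (int s) < 0 \<and> 0 < inv v (int (s + 1)))"
    if "1 \<le> s" "s < n" for s
    unfolding cond[OF u that] cond[OF v that] by (simp only: neg_eq order_eq)
  then show ?thesis unfolding sDes_def by (auto simp: neg_eq)
qed

section \<open>Foata's bijection on signed permutations\<close>

definition foata_signed :: "nat \<Rightarrow> signed_perm \<Rightarrow> signed_perm" where
  "foata_signed n u = signed_ext n (\<lambda>i. r_embed n (foata (window n u) ! (i - 1)))"

lemma foata_signed_props:
  assumes u: "u \<in> signed_perms n"
  shows "foata_signed n u \<in> signed_perms n" and "window n (foata_signed n u) = foata (window n u)"
proof -
  let ?F = "foata (window n u)"
  have len: "length ?F = n" by (metis length_window mset_foata size_mset)
  have set_F: "set ?F = (\<lambda>i. r_embed n (u (int i))) ` {1..n}"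
    by (metis mset_foata set_mset_mset set_window)
  have idx: "(\<lambda>i. ?F ! (i - 1)) ` {1..n} = set ?F"
  proof -
    have "(\<lambda>i. i - 1) ` {1..n} = {..<n}" by (force simp: image_iff Bex_def intro: exI[of _ "Suc _"])
    then have "(\<lambda>i. ?F ! (i - 1)) ` {1..n} = (!) ?F ` {..<n}" by (metis image_image)
    then show ?thesis by (auto simp: set_conv_nth len)
  qed
  have "(\<lambda>i. nat \<bar>r_embed n (?F ! (i - 1))\<bar>) ` {1..n} = (\<lambda>x. nat \<bar>r_embed n x\<bar>) ` set ?F"
    unfolding idx[symmetric] image_image ..
  also have "\<dots> = (\<lambda>i. nat \<bar>u (int i)\<bar>) ` {1..n}"
    unfolding set_F image_image using signed_perm_abs_le[OF u]
    by (intro image_cong refl) (simp add: r_embed_invol)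
  also have "\<dots> = {1..n}" using permutes_image[OF abs_signed_perm_permutes[OF u]] .
  finally have "bij_betw (\<lambda>i. nat \<bar>r_embed n (?F ! (i - 1))\<bar>) {1..n} {1..n}"
    by (simp add: bij_betw_def eq_card_imp_inj_on)
  then show "foata_signed n u \<in> signed_perms n"
    unfolding foata_signed_def by (rule signed_ext_signed_perm)
  show "window n (foata_signed n u) = ?F"
  proof (rule nth_equalityI)
    fix i assume "i < length (window n (foata_signed n u))"
    then have i: "i < n" by simp
    then have "?F ! i \<in> set ?F" by (simp add: len)
    then obtain j where "j \<in> {1..n}" "?F ! i = r_embed n (u (int j))" unfolding set_F by blast
    then have "r_embed n (r_embed n (?F ! i)) = ?F ! i"
      using signed_perm_abs_le[OF u] by (simp add: r_embed_invol)
    moreover have "Suc i \<in> {1..n}" using i by simp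
    ultimately show "window n (foata_signed n u) ! i = ?F ! i"
      using i by (simp only: nth_window foata_signed_def signed_ext_nat diff_Suc_1)
  qed (simp add: len)
qed

lemma bij_betw_foata_signed: "bij_betw (foata_signed n) (signed_perms n) (signed_perms n)"
proof -
  have "inj_on (foata_signed n) (signed_perms n)"
  proof (rule inj_onI)
    fix u v assume u: "u \<in> signed_perms n" and v: "v \<in> signed_perms n"
      and eq: "foata_signed n u = foata_signed n v"
    have "window n u = window n v" by (metis eq foata_signed_props(2) inj_foata injD u v)
    show "u = v"
    proof (rule signed_perm_eqI[OF u v])
      fix i assume i: "i \<in> {1..n}"
      then have "r_embed n (u (int i)) = r_embed n (v (int i))"
        using nth_window[of "i - 1" n] \<open>window n u = window n v\<close>
        by (metis Suc_diff_1 atLeastAtMost_iff less_eq_Suc_le One_nat_def)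
      then show "u (int i) = v (int i)" by (metis i r_embed_invol signed_perm_abs_le u v)
    qed
  qed
  then show ?thesis by (simp add: bij_betw_def endo_inj_surj foata_signed_props(1) image_subsetI)
qed

lemma finv_foata_signed:
  assumes "u \<in> signed_perms n"
  shows "finv n (foata_signed n u) = fmaj n u"
  using assms foata_signed_props[OF assms]
  by (simp add: finv_def fmaj_def inv_num_window maj_window bar_num_window inv_list_foata)

lemma sDes_inv_foata_signed:
  assumes u: "u \<in> signed_perms n"
  shows "sDes n (inv (foata_signed n u)) = sDes n (inv u)"
proof (rule sDes_inv_eq[OF foata_signed_props(1)[OF u] u])
  show "set (window n (foata_signed n u)) = set (window n u)"
    unfolding foata_signed_props(2)[OF u] by (metis mset_foata set_mset_mset)
  show "filter (\<lambda>z. z = x \<or> z = x + 1) (window n (foata_signed n u)) =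
      filter (\<lambda>z. z = x \<or> z = x + 1) (window n u)" for x
    unfolding foata_signed_props(2)[OF u]
    \<comment> \<open>No integer lies strictly between x and x + 1.\<close>
    by (rule foata_preserves_inverse_descents[OF distinct_window[OF u]]) auto
qed

text \<open>Both sums are rewritten over u = \<open>inv w\<close>, because the statistics and
  Foata's map concern the window of the inverse, while \<open>sDes\<close> is taken of w
  itself.\<close>

lemma sum_finv_eq_sum_fmaj:
  "(\<Sum>w | w \<in> signed_perms n \<and> finv n (inv w) = k. f (sDes n w)) =
   (\<Sum>w | w \<in> signed_perms n \<and> fmaj n (inv w) = k. f (sDes n w))"
proof -
  have reindex: "(\<Sum>w | w \<in> signed_perms n \<and> P (inv w). f (sDes n w)) =
      (\<Sum>u | u \<in> signed_perms n \<and> P u. f (sDes n (inv u)))" for P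
    by (rule sum.reindex_bij_witness[where i = inv and j = inv])
       (auto simp: inv_signed_perm inv_inv_signed_perm)
  have "bij_betw (foata_signed n) {u \<in> signed_perms n. fmaj n u = k} {u \<in> signed_perms n. finv n u = k}"
  proof (rule bij_betw_subset[OF bij_betw_foata_signed])
    show "foata_signed n ` {u \<in> signed_perms n. fmaj n u = k} = {u \<in> signed_perms n. finv n u = k}"
    proof (intro equalityI subsetI)
      fix v assume "v \<in> {u \<in> signed_perms n. finv n u = k}"
      moreover from this obtain u where "u \<in> signed_perms n" "v = foata_signed n u"
        using bij_betw_imp_surj_on[OF bij_betw_foata_signed] by blast
      ultimately show "v \<in> foata_signed n ` {u \<in> signed_perms n. fmaj n u = k}"
        by (simp add: finv_foata_signed)
    qed (auto simp: finv_foata_signed foata_signed_props(1))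
  qed auto
  then have "(\<Sum>u | u \<in> signed_perms n \<and> finv n u = k. f (sDes n (inv u))) =
      (\<Sum>u | u \<in> signed_perms n \<and> fmaj n u = k. f (sDes n (inv (foata_signed n u))))"
    by (rule sum.reindex_bij_betw[symmetric])
  also have "\<dots> = (\<Sum>u | u \<in> signed_perms n \<and> fmaj n u = k. f (sDes n (inv u)))"
    by (intro sum.cong) (auto simp: sDes_inv_foata_signed)
  finally show ?thesis using reindex[of "\<lambda>u. finv n u = k"] reindex[of "\<lambda>u. fmaj n u = k"] by simp
qed

subsection \<open>Block weights of words\<close>

text \<open>On a word that rises strictly p times and then falls weakly the value is (-1)^p, on
  every other nonempty word it is 0. This is the part of the weight of a block that concerns
  S.\<close>

fun hook_sign :: "nat list \<Rightarrow> int" where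
  "hook_sign (y # z # zs) =
    (if y < z then - hook_sign (z # zs) else if sorted_wrt (\<ge>) (z # zs) then 1 else 0)"
| "hook_sign _ = 1"

lemma weakly_decreasing_snoc:
  assumes "ys \<noteq> []" and "(y :: nat) \<le> last ys"
  shows "sorted_wrt (\<ge>) (ys @ [y]) \<longleftrightarrow> sorted_wrt (\<ge>) ys"
  using assms by (cases ys rule: rev_cases) (auto simp: sorted_wrt_append)

lemma hook_sign_snoc:
  assumes "ys \<noteq> []" and "y \<le> last ys"
  shows "hook_sign (ys @ [y]) = hook_sign ys"
  using assms
proof (induction ys rule: hook_sign.induct)
  case (1 x z zs)
  then show ?case using weakly_decreasing_snoc[of "z # zs" y] by simp
qed auto

lemma hook_sign_weakly_decreasing:
  assumes "sorted_wrt (\<ge>) ys"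
  shows "hook_sign ys = 1"
  using assms by (cases ys rule: hook_sign.cases) auto

text \<open>A nonzero sign forbids a rise after a weak fall, so a word that ends with a rise is
  strictly increasing.\<close>

lemma hook_sign_last_ascent:
  assumes "hook_sign (ys @ [y]) \<noteq> 0" and "ys \<noteq> []" and "last ys < y"
  shows "hd ys < y"
  using assms
proof (induction ys rule: hook_sign.induct)
  case (1 x z zs)
  have "last (z # zs) < y" using 1 by simp
  then have "\<not> sorted_wrt (\<ge>) (z # zs @ [y])"
    by (auto simp: sorted_wrt_append) (metis last_in_set leD)
  then show ?case using 1 by (auto split: if_splits)
qed auto

lemma weakly_decreasing_hd_le_last:
  assumes "sorted_wrt (\<ge>) (ys :: nat list)" and "ys \<noteq> []" and "hd ys \<le> last ys"
  shows "ys = replicate (length ys) (hd ys)"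
proof -
  have "y = hd ys" if "y \<in> set ys" for y
  proof -
    have "y \<le> hd ys" using assms that by (cases ys) auto
    moreover have "last ys \<le> y" using assms(1,2) that by (induction ys) (auto split: if_splits)
    ultimately show ?thesis using assms by simp
  qed
  then show ?thesis by (intro replicate_eqI) auto
qed

definition words :: "nat \<Rightarrow> nat \<Rightarrow> nat list set" where
  "words n k = {xs. length xs = n \<and> sum_list xs = k}"

lemma finite_words [simp]: "finite (words n k)"
proof (rule finite_subset)
  show "words n k \<subseteq> {xs. set xs \<subseteq> {..k} \<and> length xs = n}"
    using member_le_sum_list by (auto simp: words_def)
qed (rule finite_lists_length_eq, simp)

definition const_parity :: "nat set \<Rightarrow> bool" where
  "const_parity A \<longleftrightarrow> (\<forall>y\<in>A. \<forall>z\<in>A. odd y = odd z)"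

text \<open>The factor that a block with part c contributes to \<open>wt\<close>: the parity of the
  exponents plays the role of the sign, and \<open>hd ys\<close> represents the common
  parity.\<close>

definition block_weight :: "int \<Rightarrow> nat list \<Rightarrow> int" where
  "block_weight c ys =
    (if const_parity (set ys)
     then hook_sign ys * (if c < 0 \<and> odd (hd ys) then - 1 else 1) else 0)"

text \<open>
  Moving the smallest letter of a non-constant unimodal word from the front to the back reverses the
  sign, so only constant words contribute.
\<close>

lemma sum_block_weight:
  assumes "1 \<le> m"
  shows "(\<Sum>ys\<in>words m k. block_weight c ys) =
    (if m dvd k then (if c < 0 then - 1 else 1) ^ (k div m) else 0)"
proof -
  let ?C = "{ys \<in> words m k. ys = replicate m (hd ys)}"
  \<comment> \<open>A non-constant unimodal word has its minimum at an end. Words with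
    \<open>hd ys = last ys\<close> go to \<open>?A\<close>: such a word begins with a rise, so
    moving its first letter to the back makes the last letter strictly smaller than the
    first.\<close>
  let ?A = "{ys \<in> words m k - ?C. block_weight c ys \<noteq> 0 \<and> hd ys \<le> last ys}"
  let ?B = "{ys \<in> words m k - ?C. block_weight c ys \<noteq> 0 \<and> last ys < hd ys}"
  have A: "rotate1 ys \<in> ?B \<and> block_weight c (rotate1 ys) = - block_weight c ys" if ys: "ys \<in> ?A" for ys
  proof -
    obtain y zs where yz: "ys = y # zs" using ys assms by (cases ys) (auto simp: words_def)
    have "zs \<noteq> []"
    proof
      assume "zs = []"
      with yz ys have "ys = replicate m (hd ys)" by (auto simp: words_def)
      with ys show False by blast
    qed
    have "y < hd zs"
    proof (rule ccontr)
      assume "\<not> y < hd zs"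
      moreover have "hook_sign ys \<noteq> 0" using ys by (auto simp: block_weight_def split: if_splits)
      \<comment> \<open>Without an initial rise a nonzero sign forces a weak fall throughout, and
        with \<open>hd ys\<close> at most \<open>last ys\<close> the word would be constant.\<close>
      ultimately have "sorted_wrt (\<ge>) ys" using yz \<open>zs \<noteq> []\<close> by (cases zs) (auto split: if_splits)
      then have "ys = replicate m (hd ys)"
        using weakly_decreasing_hd_le_last[of ys] ys yz by (auto simp: words_def)
      with ys show False by blast
    qed
    have "y \<le> last zs" using ys yz \<open>zs \<noteq> []\<close> by simp
    then have "hook_sign (rotate1 ys) = - hook_sign ys"
      using hook_sign_snoc[OF \<open>zs \<noteq> []\<close>] yz \<open>y < hd zs\<close> \<open>zs \<noteq> []\<close> by (cases zs) auto
    moreover have "odd (hd (rotate1 ys)) = odd (hd ys)" if "const_parity (set ys)"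
      using that yz \<open>zs \<noteq> []\<close> unfolding const_parity_def
      by (metis hd_append2 hd_in_set list.sel(1) list.distinct(1) rotate1.simps(2) set_rotate1
          rotate1_is_Nil_conv)
    ultimately have bw: "block_weight c (rotate1 ys) = - block_weight c ys"
      by (auto simp: block_weight_def)
    have "rotate1 ys \<in> words m k" using ys by (auto simp: words_def yz)
    moreover have "last (rotate1 ys) < hd (rotate1 ys)" using yz \<open>y < hd zs\<close> \<open>zs \<noteq> []\<close> by simp
    moreover from this have "rotate1 ys \<noteq> replicate m (hd (rotate1 ys))"
      by (metis Nitpick.size_list_simp(2) append_Nil2 hd_append2 last_replicate less_irrefl
          length_rotate1 not_one_le_zero replicate_0 assms)
    ultimately show ?thesis using bw ys by auto
  qed
  have B: "\<exists>zs\<in>?A. ys = rotate1 zs" if ys: "ys \<in> ?B" for ys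
  proof -
    have "ys \<noteq> []" using ys assms by (auto simp: words_def)
    then obtain zs y where yz: "ys = zs @ [y]" by (metis append_butlast_last_id)
    have "zs \<noteq> []" using ys yz by auto
    have hs: "hook_sign ys \<noteq> 0" using ys by (auto simp: block_weight_def split: if_splits)
    have "y < hd zs" using ys yz \<open>zs \<noteq> []\<close> by simp
    moreover have "y \<le> last zs"
      using hook_sign_last_ascent[of zs y] hs yz \<open>zs \<noteq> []\<close> \<open>y < hd zs\<close> by force
    ultimately have "hook_sign (y # zs) = - hook_sign ys"
      using hook_sign_snoc[OF \<open>zs \<noteq> []\<close>] yz \<open>zs \<noteq> []\<close> by (cases zs) auto
    then have "block_weight c (y # zs) \<noteq> 0"
      using ys hs yz by (auto simp: block_weight_def split: if_splits)
    moreover have "y # zs \<in> words m k" using ys by (auto simp: words_def yz)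
    moreover have "y # zs \<noteq> replicate m (hd (y # zs))"
    proof
      assume "y # zs = replicate m (hd (y # zs))"
      then have "set (y # zs) \<subseteq> {y}"
        by (metis list.sel(1) set_replicate_conv_if subset_singletonD empty_subsetI order_refl)
      then have "hd zs = y" using \<open>zs \<noteq> []\<close> by (cases zs) auto
      then show False
        using \<open>y < hd zs\<close> by simp
    qed
    ultimately have "y # zs \<in> ?A" using \<open>y \<le> last zs\<close> \<open>zs \<noteq> []\<close> by simp
    moreover have "ys = rotate1 (y # zs)" by (simp add: yz)
    ultimately show ?thesis by blast
  qed
  have img: "rotate1 ` ?A = ?B" using A B by blast
  have "inj_on rotate1 ?A" using inj_rotate1 inj_on_subset by blast
  then have "sum (block_weight c) ?B = (\<Sum>ys\<in>?A. block_weight c (rotate1 ys))"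
    unfolding img[symmetric] by (rule sum.reindex_cong) auto
  also have "\<dots> = - sum (block_weight c) ?A" using A by (simp add: sum_negf)
  finally have "sum (block_weight c) ?B = - sum (block_weight c) ?A" .
  then have "sum (block_weight c) (?A \<union> ?B) = 0" by (subst sum.union_disjoint) auto
  moreover have "sum (block_weight c) (words m k - ?C) = sum (block_weight c) (?A \<union> ?B)"
    by (rule sum.mono_neutral_right) auto
  ultimately have "sum (block_weight c) (words m k) = sum (block_weight c) ?C"
    using sum.subset_diff[of ?C "words m k" "block_weight c"] by auto
  also have "?C = (if m dvd k then {replicate m (k div m)} else {})"
  proof -
    have "ys \<in> ?C \<longleftrightarrow> m dvd k \<and> ys = replicate m (k div m)" for ys
    proof
      assume "ys \<in> ?C"
      then have r: "ys = replicate m (hd ys)" and "sum_list ys = k" by (simp_all add: words_def)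
      then have "k = m * hd ys" by (metis sum_list_replicate mult.commute of_nat_id)
      then show "m dvd k \<and> ys = replicate m (k div m)" using r assms by auto
    next
      assume "m dvd k \<and> ys = replicate m (k div m)"
      then show "ys \<in> ?C" using assms by (auto simp: words_def sum_list_replicate)
    qed
    then show ?thesis by auto
  qed
  also have "sum (block_weight c) \<dots> = (if m dvd k then block_weight c (replicate m (k div m)) else 0)"
    by simp
  also have "\<dots> = (if m dvd k then (if c < 0 then - 1 else 1) ^ (k div m) else 0)"
  proof -
    have "sorted_wrt (\<ge>) (replicate l t)" for l t :: nat
      by (induction l) auto
    then have "block_weight c (replicate m t) = (if c < 0 then - 1 else 1) ^ t" for t
      using assms hook_sign_weakly_decreasing[of "replicate m t"]
      by (auto simp: block_weight_def const_parity_def)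
    then show ?thesis by simp
  qed
  finally show ?thesis .
qed

text \<open>The series 1/(1 - s t^m). It is what a cycle of length m and sign s contributes to the
  graded trace on polynomials, and also what a part of \<open>\<gamma>\<close> contributes to the
  weights of words.\<close>

definition geo_fps :: "nat \<Rightarrow> int \<Rightarrow> int fps" where
  "geo_fps m s = Abs_fps (\<lambda>k. if m dvd k then s ^ (k div m) else 0)"

primrec list_weight :: "int list \<Rightarrow> nat list \<Rightarrow> int" where
  "list_weight [] xs = 1"
| "list_weight (c # \<gamma>) xs =
    block_weight c (take (nat \<bar>c\<bar>) xs) * list_weight \<gamma> (drop (nat \<bar>c\<bar>) xs)"

lemma sum_words_append:
  "(\<Sum>xs\<in>words (m + n) k. f (take m xs) (drop m xs)) =
    (\<Sum>j=0..k. \<Sum>ys\<in>words m j. \<Sum>zs\<in>words n (k - j). f ys zs)"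
proof -
  have "(\<Sum>j=0..k. \<Sum>ys\<in>words m j. \<Sum>zs\<in>words n (k - j). f ys zs) =
      (\<Sum>(j, ys, zs)\<in>(SIGMA j:{0..k}. words m j \<times> words n (k - j)). f ys zs)"
    by (simp add: sum.Sigma sum.cartesian_product)
  also have "\<dots> = (\<Sum>xs\<in>words (m + n) k. f (take m xs) (drop m xs))"
    by (rule sum.reindex_bij_witness[where i = "\<lambda>xs. (sum_list (take m xs), take m xs, drop m xs)"
          and j = "\<lambda>(j, ys, zs). ys @ zs"])
       (auto simp: words_def, (metis append_take_drop_id le_add1 sum_list_append diff_add_inverse)+)
  finally show ?thesis ..
qed

lemma sum_list_weight:
  assumes "signed_composition n \<gamma>"
  shows "(\<Sum>xs\<in>words n k. list_weight \<gamma> xs) =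
    fps_nth (prod_list (map (\<lambda>c. geo_fps (nat \<bar>c\<bar>) (if c < 0 then - 1 else 1)) \<gamma>)) k"
  using assms
proof (induction \<gamma> arbitrary: n k)
  case Nil
  then have "words n k = (if k = 0 then {[]} else {})"
    by (auto simp: signed_composition_def words_def)
  then show ?case by simp
next
  case (Cons c \<gamma>)
  define m where "m = nat \<bar>c\<bar>"
  have "1 \<le> m" using Cons.prems by (auto simp: signed_composition_def m_def)
  obtain n' where n: "n = m + n'" and \<gamma>: "signed_composition n' \<gamma>"
    using Cons.prems by (auto simp: signed_composition_def m_def)
  have "(\<Sum>xs\<in>words n k. list_weight (c # \<gamma>) xs) =
      (\<Sum>xs\<in>words (m + n') k. block_weight c (take m xs) * list_weight \<gamma> (drop m xs))"
    by (simp add: n m_def)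
  also have "\<dots> = (\<Sum>j=0..k. (\<Sum>ys\<in>words m j. block_weight c ys) * (\<Sum>zs\<in>words n' (k - j). list_weight \<gamma> zs))"
    by (subst sum_words_append) (simp add: sum_product)
  also have "\<dots> = (\<Sum>j=0..k. fps_nth (geo_fps m (if c < 0 then - 1 else 1)) j *
      fps_nth (prod_list (map (\<lambda>c. geo_fps (nat \<bar>c\<bar>) (if c < 0 then - 1 else 1)) \<gamma>)) (k - j))"
    by (simp add: sum_block_weight[OF \<open>1 \<le> m\<close>] Cons.IH[OF \<gamma>] geo_fps_def)
  finally show ?case by (simp add: fps_mult_nth m_def)
qed

subsection \<open>Weights of signed descent sets of words\<close>

text \<open>The counterpart of \<open>sDes\<close> on exponent vectors. Rises replace descents
  because |w(j)| is the rank of position j in decreasing order, and parities replace bars.\<close>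

definition word_sDes :: "nat \<Rightarrow> (nat \<Rightarrow> nat) \<Rightarrow> signed_set" where
  "word_sDes n a =
    (insert n {s. 1 \<le> s \<and> s < n \<and> (a s < a (s + 1) \<or> odd (a s) \<noteq> odd (a (s + 1)))}, \<lambda>s. odd (a s))"

text \<open>A change of parity after s puts s into S, so the parity is constant from j up to the
  next element of S, where the sign vector reads it off.\<close>

lemma sign_vector_word_sDes:
  assumes "j \<in> {1..n}"
  shows "sign_vector (word_sDes n a) j = odd (a j)"
proof -
  let ?S = "fst (word_sDes n a)"
  define s where "s = (LEAST s. s \<in> ?S \<and> j \<le> s)"
  have ex: "n \<in> ?S \<and> j \<le> n" using assms by (simp add: word_sDes_def)
  have s: "s \<in> ?S" "j \<le> s" "s \<le> n" unfolding s_def using LeastI[of "\<lambda>s. s \<in> ?S \<and> j \<le> s", OF ex]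
      Least_le[of "\<lambda>s. s \<in> ?S \<and> j \<le> s", OF ex] by auto
  have "t \<le> s \<longrightarrow> odd (a t) = odd (a j)" if "j \<le> t" for t using that
  proof (induction t rule: dec_induct)
    case (step t)
    show ?case
    proof
      assume "Suc t \<le> s"
      then have "t \<notin> ?S"
        using not_less_Least[of t "\<lambda>s. s \<in> ?S \<and> j \<le> s"] step.hyps by (auto simp: s_def)
      then have "odd (a t) = odd (a (t + 1))"
        using \<open>Suc t \<le> s\<close> s assms step.hyps by (auto simp: word_sDes_def)
      then show "odd (a (Suc t)) = odd (a j)" using step.IH \<open>Suc t \<le> s\<close> by simp
    qed
  qed simp
  then have "odd (a s) = odd (a j)" using s by blast
  then show ?thesis by (simp add: sign_vector_def s_def[symmetric]) (simp add: word_sDes_def)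
qed

definition ascents :: "nat list \<Rightarrow> nat set" where
  "ascents ys = {p. p + 1 < length ys \<and> ys ! p < ys ! (p + 1)}"

lemma ascents_Cons:
  "ascents (y # z # zs) = (if y < z then {0} else {}) \<union> Suc ` ascents (z # zs)"
proof -
  have "p \<in> ascents (y # z # zs) \<longleftrightarrow> p \<in> (if y < z then {0} else {}) \<union> Suc ` ascents (z # zs)" for p
    by (cases p) (auto simp: ascents_def)
  then show ?thesis by blast
qed

lemma finite_ascents [simp]: "finite (ascents ys)"
  by (rule finite_subset[of _ "{..<length ys}"]) (auto simp: ascents_def)

lemma ascents_empty_iff: "ascents ys = {} \<longleftrightarrow> sorted_wrt (\<ge>) ys"
proof (induction ys rule: induct_list012)
  case (3 y z zs)
  have "ascents (y # z # zs) = {} \<longleftrightarrow> z \<le> y \<and> ascents (z # zs) = {}" by (auto simp: ascents_Cons)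
  also have "\<dots> \<longleftrightarrow> z \<le> y \<and> sorted_wrt (\<ge>) (z # zs)" unfolding 3 ..
  also have "\<dots> \<longleftrightarrow> sorted_wrt (\<ge>) (y # z # zs)" by auto
  finally show ?case .
qed (auto simp: ascents_def)

text \<open>Rising strictly and then falling weakly means that the rises occupy the first positions.
  This connects the recursive \<open>hook_sign\<close> with the initial segments in
  \<open>wt\<close>.\<close>

lemma hook_sign_ascents:
  "hook_sign ys =
    (if initial_segment (ascents ys) {..<length ys - 1} then (- 1) ^ card (ascents ys) else 0)"
proof (induction ys rule: hook_sign.induct)
  case (1 y z zs)
  let ?A = "ascents (z # zs)"
  show ?case
  proof (cases "y < z")
    case True
    then have eq: "ascents (y # z # zs) = insert 0 (Suc ` ?A)" by (simp add: ascents_Cons)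
    have "initial_segment (insert 0 (Suc ` ?A)) {..<length (y # z # zs) - 1} \<longleftrightarrow>
        initial_segment ?A {..<length (z # zs) - 1}"
      unfolding initial_segment_def by (auto simp: ascents_def less_Suc_eq_0_disj image_iff)
    moreover have "card (insert 0 (Suc ` ?A)) = Suc (card ?A)"
      by (subst card_insert_disjoint) (auto simp: card_image)
    moreover have "initial_segment ?A {..<length (z # zs) - 1} \<Longrightarrow> hook_sign (z # zs) = (- 1) ^ card ?A"
      "\<not> initial_segment ?A {..<length (z # zs) - 1} \<Longrightarrow> hook_sign (z # zs) = 0"
      using 1(1)[OF True] by auto
    ultimately show ?thesis using True eq by simp
  next
    case False
    then have eq: "ascents (y # z # zs) = Suc ` ?A" by (simp add: ascents_Cons)
    have "initial_segment (Suc ` ?A) {..<length (y # z # zs) - 1} \<longleftrightarrow> ?A = {}"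
      unfolding initial_segment_def by (auto simp: ascents_def)
    then show ?thesis using False eq ascents_empty_iff[of "z # zs"] by (cases "?A = {}") auto
  qed
qed (auto simp: ascents_def initial_segment_def)

lemma initial_segment_image:
  assumes "strict_mono (f :: nat \<Rightarrow> nat)"
  shows "initial_segment (f ` A) (f ` B) \<longleftrightarrow> initial_segment A B"
  using assms unfolding initial_segment_def
  by (auto simp: strict_mono_less inj_image_mem_iff strict_mono_imp_inj_on inj_image_subset_iff)

lemma partial_sum_Suc:
  "i < length \<gamma> \<Longrightarrow> partial_sum \<gamma> (Suc i) = partial_sum \<gamma> i + nat \<bar>\<gamma> ! i\<bar>"
  by (simp add: partial_sum_def take_Suc_conv_app_nth)

lemma partial_sum_0 [simp]: "partial_sum \<gamma> 0 = 0"
  by (simp add: partial_sum_def)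

lemma partial_sum_mono: "i \<le> j \<Longrightarrow> partial_sum \<gamma> i \<le> partial_sum \<gamma> j"
proof (induction j rule: dec_induct)
  case (step j)
  have "partial_sum \<gamma> j \<le> partial_sum \<gamma> (Suc j)"
    by (cases "j < length \<gamma>") (auto simp: partial_sum_Suc, simp add: partial_sum_def)
  with step show ?case by simp
qed simp

lemma partial_sum_length: "signed_composition n \<gamma> \<Longrightarrow> partial_sum \<gamma> (length \<gamma>) = n"
  by (simp add: partial_sum_def signed_composition_def)

lemma partial_sum_Cons_Suc: "partial_sum (c # \<gamma>) (Suc i) = nat \<bar>c\<bar> + partial_sum \<gamma> i"
  by (simp add: partial_sum_def)

definition block_word :: "int list \<Rightarrow> (nat \<Rightarrow> nat) \<Rightarrow> nat \<Rightarrow> nat list" where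
  "block_word \<gamma> a i = map a [partial_sum \<gamma> i + 1..<partial_sum \<gamma> (i + 1) + 1]"

lemma list_weight_eq_prod:
  "list_weight \<gamma> (map a [1..<partial_sum \<gamma> (length \<gamma>) + 1]) =
    (\<Prod>i<length \<gamma>. block_weight (\<gamma> ! i) (block_word \<gamma> a i))"
proof (induction \<gamma> arbitrary: a)
  case (Cons c \<gamma>)
  let ?m = "nat \<bar>c\<bar>" and ?n = "partial_sum \<gamma> (length \<gamma>)"
  have split: "map a [1..<?m + ?n + 1] = map a [1..<?m + 1] @ map (\<lambda>i. a (i + ?m)) [1..<?n + 1]"
  proof -
    have "[1..<?m + ?n + 1] = [1..<?m + 1] @ [?m + 1..<?m + 1 + ?n]"
      by (metis add.commute add.left_commute le_add2 upt_add_eq_append)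
    moreover have "[?m + 1..<?m + 1 + ?n] = map (\<lambda>i. i + ?m) [1..<?n + 1]"
      by (rule nth_equalityI) (auto simp del: upt_Suc)
    ultimately show ?thesis by (simp del: upt_Suc add: o_def)
  qed
  have "list_weight (c # \<gamma>) (map a [1..<partial_sum (c # \<gamma>) (length (c # \<gamma>)) + 1]) =
      block_weight c (map a [1..<?m + 1]) * list_weight \<gamma> (map (\<lambda>i. a (i + ?m)) [1..<?n + 1])"
    by (simp only: length_Cons partial_sum_Cons_Suc split list_weight.simps) simp
  also have "\<dots> = block_weight c (map a [1..<?m + 1]) *
      (\<Prod>i<length \<gamma>. block_weight (\<gamma> ! i) (block_word \<gamma> (\<lambda>i. a (i + ?m)) i))"
    unfolding Cons.IH ..
  also have "\<dots> = block_weight c (block_word (c # \<gamma>) a 0) *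
      (\<Prod>i<length \<gamma>. block_weight (\<gamma> ! i) (block_word (c # \<gamma>) a (Suc i)))"
  proof -
    have "[?m + x + 1..<?m + y + 1] = map (\<lambda>i. i + ?m) [x + 1..<y + 1]" for x y
      by (rule nth_equalityI) (auto simp del: upt_Suc)
    then have "block_word \<gamma> (\<lambda>i. a (i + ?m)) i = block_word (c # \<gamma>) a (Suc i)" for i
      unfolding block_word_def by (simp add: partial_sum_Cons_Suc o_def del: upt_Suc)
    moreover have "map a [1..<?m + 1] = block_word (c # \<gamma>) a 0"
      by (simp add: block_word_def partial_sum_Cons_Suc del: upt_Suc)
    ultimately show ?thesis by simp
  qed
  finally show ?case by (simp add: prod.lessThan_Suc_shift del: prod.lessThan_Suc)
qed simp

text \<open>On a block of constant parity the elements of S before the last position are exactly the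
  rises there, and S outside the partial sums is the disjoint union of these sets over all blocks.
  Hence the vanishing condition and the exponent of -1 both split over the blocks.\<close>

lemma wt_word_sDes:
  assumes \<gamma>: "signed_composition n \<gamma>" and "1 \<le> n"
  shows "wt \<gamma> (word_sDes n a) = list_weight \<gamma> (map a [1..<n + 1])"
proof -
  let ?S = "fst (word_sDes n a)" and ?r = "partial_sum \<gamma>" and ?k = "length \<gamma>"
  define good_sign where "good_sign i \<longleftrightarrow> (\<forall>j\<in>block \<gamma> i. \<forall>j'\<in>block \<gamma> i. odd (a j) = odd (a j'))" for i
  define inner where "inner i = block \<gamma> i - {?r (i + 1)}" for i
  have r_n: "?r ?k = n" by (rule partial_sum_length[OF \<gamma>])
  have r_le: "?r (i + 1) \<le> n" if "i < ?k" for i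
    using partial_sum_mono[of "i + 1" ?k \<gamma>] that r_n by simp
  have r_less: "?r i < ?r (i + 1)" if "i < ?k" for i
  proof -
    have "\<gamma> ! i \<noteq> 0" using \<gamma> that by (metis nth_mem signed_composition_def)
    then show ?thesis using that by (simp add: partial_sum_Suc)
  qed
  have block_sub: "block \<gamma> i \<subseteq> {1..n}" if "i < ?k" for i
    using r_le[OF that] by (auto simp: block_def)
  have sign: "sign_vector (word_sDes n a) j = odd (a j)" if "i < ?k" "j \<in> block \<gamma> i" for i j
    using block_sub[OF that(1)] that(2) by (intro sign_vector_word_sDes) auto
  have set_bw: "set (block_word \<gamma> a i) = a ` block \<gamma> i" for i
    by (auto simp: block_word_def block_def simp del: upt_Suc)
  have good_iff: "good_sign i \<longleftrightarrow> const_parity (set (block_word \<gamma> a i))" for i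
    by (auto simp: good_sign_def set_bw const_parity_def)
  \<comment> \<open>Positions of a block count from \<open>?r i + 1\<close>, list indices from 0,
    and the last position of the block is left out.\<close>
  have inner_eq: "inner i = (\<lambda>p. p + (?r i + 1)) ` {..<length (block_word \<gamma> a i) - 1}" if "i < ?k" for i
  proof -
    have "s \<in> inner i \<longleftrightarrow> s - (?r i + 1) < ?r (i + 1) - ?r i - 1 \<and> ?r i + 1 \<le> s" for s
      using r_less[OF that] by (auto simp: inner_def block_def)
    moreover have "s \<in> (\<lambda>p. p + c) ` {..<l} \<longleftrightarrow> s - c < l \<and> c \<le> s" for s c l :: nat
      by (auto simp: image_iff intro: bexI[of _ "s - c"])
    moreover have "length (block_word \<gamma> a i) = ?r (i + 1) - ?r i"
      by (simp add: block_word_def del: upt_Suc)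
    ultimately show ?thesis by (simp only: set_eq_iff) blast
  qed
  have S_inner: "?S \<inter> inner i = (\<lambda>p. p + (?r i + 1)) ` ascents (block_word \<gamma> a i)"
    if i: "i < ?k" and "good_sign i" for i
  proof -
    have "p + (?r i + 1) \<in> ?S \<longleftrightarrow> p \<in> ascents (block_word \<gamma> a i)"
      if p: "p < length (block_word \<gamma> a i) - 1" for p
    proof -
      have lt: "p + (?r i + 1) + 1 \<le> ?r (i + 1)" using p by (simp add: block_word_def del: upt_Suc)
      then have "p + (?r i + 1) \<in> block \<gamma> i" "p + (?r i + 1) + 1 \<in> block \<gamma> i"
        by (auto simp: block_def)
      then have "odd (a (p + (?r i + 1))) = odd (a (p + (?r i + 1) + 1))"
        using \<open>good_sign i\<close> unfolding good_sign_def by blast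
      moreover have "p + (?r i + 1) < n" using lt r_le[OF i] by linarith
      ultimately have "p + (?r i + 1) \<in> ?S \<longleftrightarrow> a (p + (?r i + 1)) < a (p + (?r i + 1) + 1)"
        by (auto simp: word_sDes_def)
      moreover have "block_word \<gamma> a i ! p = a (p + (?r i + 1))"
        "block_word \<gamma> a i ! (p + 1) = a (p + (?r i + 1) + 1)"
        using p by (simp_all add: block_word_def add.commute del: upt_Suc)
      ultimately show ?thesis using p by (auto simp: ascents_def)
    qed
    then show ?thesis unfolding inner_eq[OF i] by (auto simp: ascents_def)
  qed
  have shift: "strict_mono (\<lambda>p. p + c)" for c :: nat
    by (simp add: strict_mono_def)
  have seg: "initial_segment (?S \<inter> inner i) (inner i) \<longleftrightarrow>
      initial_segment (ascents (block_word \<gamma> a i)) {..<length (block_word \<gamma> a i) - 1}"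
    if "i < ?k" "good_sign i" for i
    unfolding S_inner[OF that] unfolding inner_eq[OF that(1)] by (rule initial_segment_image[OF shift])
  have bw: "block_weight (\<gamma> ! i) (block_word \<gamma> a i) =
      (if initial_segment (?S \<inter> inner i) (inner i) \<and> good_sign i
       then (- 1) ^ card (?S \<inter> inner i) * (- 1) ^ of_bool ((\<forall>j\<in>block \<gamma> i. odd (a j)) \<and> \<gamma> ! i < 0)
       else 0)" if i: "i < ?k" for i
  proof (cases "good_sign i")
    case True
    have "card (?S \<inter> inner i) = card (ascents (block_word \<gamma> a i))"
      unfolding S_inner[OF i True] by (rule card_image) (simp add: inj_on_def)
    moreover have "odd (hd (block_word \<gamma> a i)) \<longleftrightarrow> (\<forall>j\<in>block \<gamma> i. odd (a j))"
    proof -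
      have "block_word \<gamma> a i \<noteq> []" using r_less[OF i] by (simp add: block_word_def del: upt_Suc)
      then obtain j where j: "j \<in> block \<gamma> i" "hd (block_word \<gamma> a i) = a j"
        using hd_in_set[of "block_word \<gamma> a i"] unfolding set_bw by blast
      then have "odd (a j') = odd (a j)" if "j' \<in> block \<gamma> i" for j'
        using True that unfolding good_sign_def by blast
      then show ?thesis unfolding j(2) using j(1) by blast
    qed
    ultimately show ?thesis
      using True seg[OF i True] good_iff[of i] by (simp add: block_weight_def hook_sign_ascents)
  next
    case False
    then show ?thesis using good_iff[of i] by (simp add: block_weight_def)
  qed
  have wt_eq: "wt \<gamma> (word_sDes n a) =
    (if \<forall>i<?k. initial_segment (?S \<inter> inner i) (inner i) \<and> good_sign i
     then (- 1) ^ (card (?S - partial_sums \<gamma>) +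
        card {i. i < ?k \<and> (\<forall>j\<in>block \<gamma> i. odd (a j)) \<and> \<gamma> ! i < 0}) else 0)"
  proof -
    have "(\<forall>j\<in>block \<gamma> i. \<forall>j'\<in>block \<gamma> i. sign_vector (word_sDes n a) j = sign_vector (word_sDes n a) j') \<longleftrightarrow>
        good_sign i" if "i < ?k" for i
      using sign[OF that] by (simp add: good_sign_def)
    moreover have "{i. i < ?k \<and> (\<forall>j\<in>block \<gamma> i. sign_vector (word_sDes n a) j) \<and> \<gamma> ! i < 0} =
        {i. i < ?k \<and> (\<forall>j\<in>block \<gamma> i. odd (a j)) \<and> \<gamma> ! i < 0}"
      using sign by blast
    ultimately show ?thesis unfolding wt_def inner_def[symmetric] by auto
  qed
  have card_S: "card (?S - partial_sums \<gamma>) = (\<Sum>i<?k. card (?S \<inter> inner i))"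
  proof -
    have fin: "finite ?S" by (simp add: word_sDes_def)
    have disj: "inner i \<inter> inner j = {}" if "i < j" "j < ?k" for i j
      using partial_sum_mono[of "i + 1" j \<gamma>] that by (auto simp: inner_def block_def)
    have "?S - partial_sums \<gamma> = (\<Union>i<?k. ?S \<inter> inner i)"
    proof (intro equalityI subsetI)
      fix s assume s: "s \<in> ?S - partial_sums \<gamma>"
      \<comment> \<open>Here \<open>1 \<le> n\<close> enters: for n = 0 the set S is {0}, and 0 is
        not a partial sum.\<close>
      then have "1 \<le> s" "s \<le> n" using \<open>1 \<le> n\<close> by (auto simp: word_sDes_def)
      define i where "i = (LEAST i. s \<le> ?r i)"
      have "s \<le> ?r ?k" using \<open>s \<le> n\<close> r_n by simp
      then have i: "s \<le> ?r i" "i \<le> ?k" unfolding i_def by (auto intro: LeastI Least_le)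
      then have "i \<noteq> 0" using \<open>1 \<le> s\<close> by (intro notI) simp
      then obtain i' where i': "i = Suc i'" by (cases i) auto
      then have "\<not> s \<le> ?r i'" using not_less_Least[of i' "\<lambda>i. s \<le> ?r i"] by (simp add: i_def)
      moreover have "s \<noteq> ?r i" using s i \<open>i \<noteq> 0\<close> by (auto simp: partial_sums_def)
      ultimately show "s \<in> (\<Union>i<?k. ?S \<inter> inner i)"
        using s i i' by (auto simp: inner_def block_def intro!: bexI[of _ i'])
    next
      fix s assume "s \<in> (\<Union>i<?k. ?S \<inter> inner i)"
      then obtain i where i: "i < ?k" "s \<in> ?S" "?r i < s" "s < ?r (i + 1)"
        by (fastforce simp: inner_def block_def)
      have "s \<noteq> ?r j" for j
      proof (cases "j \<le> i")
        case True
        then show ?thesis using partial_sum_mono[of j i \<gamma>] i by auto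
      next
        case False
        then show ?thesis using partial_sum_mono[of "i + 1" j \<gamma>] i by auto
      qed
      then show "s \<in> ?S - partial_sums \<gamma>" using i by (auto simp: partial_sums_def)
    qed
    moreover have "card (\<Union>i<?k. ?S \<inter> inner i) = (\<Sum>i<?k. card (?S \<inter> inner i))"
    proof (rule card_UN_disjoint)
      show "\<forall>i\<in>{..<?k}. \<forall>j\<in>{..<?k}. i \<noteq> j \<longrightarrow> ?S \<inter> inner i \<inter> (?S \<inter> inner j) = {}"
      proof (intro ballI impI)
        fix i j assume "i \<in> {..<?k}" "j \<in> {..<?k}" "i \<noteq> j"
        then have "inner i \<inter> inner j = {}" using disj[of i j] disj[of j i] by (cases "i < j") auto
        then show "?S \<inter> inner i \<inter> (?S \<inter> inner j) = {}" by blast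
      qed
    qed (use fin in auto)
    ultimately show ?thesis by simp
  qed
  have "list_weight \<gamma> (map a [1..<n + 1]) = (\<Prod>i<?k. block_weight (\<gamma> ! i) (block_word \<gamma> a i))"
    using list_weight_eq_prod[of \<gamma> a] r_n by simp
  also have "\<dots> = wt \<gamma> (word_sDes n a)"
  proof (cases "\<forall>i<?k. initial_segment (?S \<inter> inner i) (inner i) \<and> good_sign i")
    case True
    let ?N = "{i. i < ?k \<and> (\<forall>j\<in>block \<gamma> i. odd (a j)) \<and> \<gamma> ! i < 0}"
    have "(\<Prod>i<?k. block_weight (\<gamma> ! i) (block_word \<gamma> a i)) =
        (\<Prod>i<?k. (- 1) ^ card (?S \<inter> inner i) * (- 1) ^ of_bool (i \<in> ?N))"
      using True bw by (intro prod.cong) auto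
    also have "\<dots> = (- 1) ^ (\<Sum>i<?k. card (?S \<inter> inner i)) * (- 1) ^ (\<Sum>i<?k. of_bool (i \<in> ?N))"
      by (simp only: prod.distrib power_sum)
    also have "(\<Sum>i<?k. of_bool (i \<in> ?N)) = card ?N"
      by (subst sum_of_bool_eq) (auto intro!: arg_cong[of _ _ card])
    finally show ?thesis using True wt_eq card_S by (simp add: power_add)
  next
    case False
    then obtain i where i: "i < ?k" "\<not> (initial_segment (?S \<inter> inner i) (inner i) \<and> good_sign i)"
      by blast
    have "block_weight (\<gamma> ! i) (block_word \<gamma> a i) = 0"
      unfolding bw[OF i(1)] using i(2) by (rule if_not_P)
    then have "(\<Prod>i<?k. block_weight (\<gamma> ! i) (block_word \<gamma> a i)) = 0"
      using i(1) by (intro prod_zero) auto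
    then show ?thesis unfolding wt_eq if_not_P[OF False] .
  qed
  finally show ?thesis ..
qed

subsection \<open>Exponent vectors as pairs of a signed permutation and a partition\<close>

definition wabs :: "signed_perm \<Rightarrow> nat \<Rightarrow> nat" where
  "wabs w i = nat \<bar>w (int i)\<bar>"

lemma wabs_permutes: "w \<in> signed_perms n \<Longrightarrow> wabs w permutes {1..n}"
  unfolding wabs_def by (rule abs_signed_perm_permutes)

lemma wabs_mem: "w \<in> signed_perms n \<Longrightarrow> i \<in> {1..n} \<Longrightarrow> wabs w i \<in> {1..n}"
  unfolding wabs_def by (rule signed_perm_abs_range(2))

lemma wabs_outside: "w \<in> signed_perms n \<Longrightarrow> i \<notin> {1..n} \<Longrightarrow> wabs w i = i"
  unfolding wabs_def by (subst signed_perm_outside) auto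

lemma wabs_inv:
  assumes "w \<in> signed_perms n"
  shows "wabs (inv w) (wabs w i) = i" and "wabs w (wabs (inv w) i) = i"
  unfolding wabs_def using abs_inv_signed_perm[OF assms, of "int i"] by simp_all

text \<open>At position \<open>wabs (inv w) i\<close> the window of w has the letter i, possibly
  barred, and w and its inverse agree on the bar.\<close>

lemma neg_wabs_inv:
  assumes "w \<in> signed_perms n" and "i \<in> {1..n}"
  shows "w (int (wabs (inv w) i)) < 0 \<longleftrightarrow> inv w (int i) < 0"
proof -
  have "w (int (wabs (inv w) i)) = (if inv w (int i) < 0 then - int i else int i)"
    using signed_permsD(2)[OF assms(1), of "inv w (int i)"] assms(1) by (auto simp: wabs_def)
  then show ?thesis using assms(2) by auto
qed

definition expo :: "nat \<Rightarrow> (nat \<Rightarrow> nat) set" where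
  "expo n = {a. \<forall>i. i \<notin> {1..n} \<longrightarrow> a i = 0}"

definition decreasing_on :: "nat \<Rightarrow> (nat \<Rightarrow> nat) \<Rightarrow> bool" where
  "decreasing_on n l \<longleftrightarrow> (\<forall>i j. 1 \<le> i \<and> i \<le> j \<and> j \<le> n \<longrightarrow> l j \<le> l i)"

definition even_partitions :: "nat \<Rightarrow> (nat \<Rightarrow> nat) set" where
  "even_partitions n = {l \<in> expo n. (\<forall>i. even (l i)) \<and> decreasing_on n l}"

text \<open>The exponent vector of the Garsia-Stanton descent monomial of \<open>inv w\<close>, type B version.\<close>

definition descent_expo :: "nat \<Rightarrow> signed_perm \<Rightarrow> nat \<Rightarrow> nat" where
  "descent_expo n w j =
    (if j \<in> {1..n} then 2 * card {t \<in> Des n (inv w). wabs w j \<le> t} + of_bool (w (int j) < 0) else 0)"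

text \<open>The position of rank r = \<open>wabs w j\<close> receives the r-th part of l on top of
  its descent exponent. The parts will be even, so that bars remain visible as parities.\<close>

definition combine :: "nat \<Rightarrow> signed_perm \<Rightarrow> (nat \<Rightarrow> nat) \<Rightarrow> nat \<Rightarrow> nat" where
  "combine n w l j = descent_expo n w j + l (wabs w j)"

text \<open>Decreasing in this key means: larger entries first, ties broken by increasing position.\<close>

definition key :: "nat \<Rightarrow> (nat \<Rightarrow> nat) \<Rightarrow> nat \<Rightarrow> int" where
  "key n a i = 2 * int n * int (a i) - int i"

text \<open>A step of one in the exponent changes the key by 2n, more than the difference of two
  positions between 1 and n can compensate.\<close>

lemma key_less_iff:
  assumes "i \<in> {1..n}" "j \<in> {1..n}"
  shows "key n a j < key n a i \<longleftrightarrow> a j < a i \<or> (a i = a j \<and> i < j)"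
proof -
  have *: "key n a j < key n a i" if "a j < a i" "i \<in> {1..n}" "j \<in> {1..n}" for i j
  proof -
    have "int (a j) + 1 \<le> int (a i)" using that by simp
    then have "2 * int n * (int (a j) + 1) \<le> 2 * int n * int (a i)" by (intro mult_left_mono) auto
    then show ?thesis using that by (simp add: key_def algebra_simps)
  qed
  show ?thesis using *[of i j] *[of j i] assms
    by (cases "a i" "a j" rule: linorder_cases) (auto simp: key_def)
qed

lemma finite_Des [simp]: "finite (Des n w)"
  by (rule finite_subset[of _ "{..n}"]) (auto simp: Des_def)

lemma card_Des_ge:
  "card {t \<in> Des n u. i \<le> t} = card {t \<in> Des n u. Suc i \<le> t} + of_bool (i \<in> Des n u)"
proof -
  have "{t \<in> Des n u. i \<le> t} = {t \<in> Des n u. Suc i \<le> t} \<union> (if i \<in> Des n u then {i} else {})"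
    by (auto simp: Suc_le_eq dest: le_neq_implies_less)
  then show ?thesis by (simp add: card_insert_if)
qed

text \<open>Reads the exponent vector in the order of ranks, where comparing neighbours becomes a
  question about descents of \<open>inv w\<close>.\<close>

lemma combine_wabs_inv:
  assumes w: "w \<in> signed_perms n" and i: "i \<in> {1..n}"
  shows "combine n w l (wabs (inv w) i) =
    2 * card {t \<in> Des n (inv w). i \<le> t} + of_bool (inv w (int i) < 0) + l i"
  using wabs_mem[OF inv_signed_perm[OF w] i] neg_wabs_inv[OF w i]
  by (simp add: combine_def descent_expo_def wabs_inv[OF w] del: atLeastAtMost_iff)

lemma less_r_cases:
  assumes "a \<noteq> 0" "b \<noteq> 0" "\<bar>a\<bar> \<noteq> \<bar>b\<bar>"
  shows "b <\<^sub>r a \<longleftrightarrow> (if (a < 0) = (b < 0) then nat \<bar>b\<bar> < nat \<bar>a\<bar> else b < 0)"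
  using assms by (auto simp: less_r_def)

lemma wabs_inv_Suc_neq:
  assumes w: "w \<in> signed_perms n"
  shows "wabs w i \<noteq> wabs w (Suc i)"
  by (metis assms n_not_Suc_n wabs_inv(1))

lemma Suc_Des_iff:
  assumes u: "u \<in> signed_perms n" and i: "1 \<le> i" "i < n"
  shows "i \<in> Des n u \<longleftrightarrow>
    (if (u (int i) < 0) = (u (int (Suc i)) < 0) then wabs u (Suc i) < wabs u i else u (int (Suc i)) < 0)"
proof -
  have "u (int i) \<noteq> 0" "u (int (Suc i)) \<noteq> 0"
    by (rule signed_perm_abs_range(1)[OF u], use i in simp)+
  moreover have "\<bar>u (int i)\<bar> \<noteq> \<bar>u (int (Suc i))\<bar>"
    using wabs_inv_Suc_neq[OF u, of i] by (simp add: wabs_def)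
  ultimately show ?thesis
    using i less_r_cases[of "u (int i)" "u (int (Suc i))"] by (simp add: Des_def wabs_def)
qed

text \<open>Compare ranks i and i + 1. At a descent of \<open>inv w\<close> the doubled count drops
  by 2, more than a bar can add. At a non-descent with equal signs the exponents may tie, but then
  the positions increase; with different signs the first is barred, and the bar drops from 1 to
  0.\<close>

lemma key_combine_step:
  assumes w: "w \<in> signed_perms n" and l: "decreasing_on n l" and i: "1 \<le> i" "i < n"
  shows "key n (combine n w l) (wabs (inv w) (Suc i)) < key n (combine n w l) (wabs (inv w) i)"
proof -
  let ?u = "inv w" and ?a = "combine n w l"
  have u: "?u \<in> signed_perms n" by (rule inv_signed_perm[OF w])
  have mem: "i \<in> {1..n}" "Suc i \<in> {1..n}" using i by auto
  have "l (Suc i) \<le> l i" using l i by (simp add: decreasing_on_def)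
  then have "?a (wabs ?u (Suc i)) < ?a (wabs ?u i) \<or>
      (?a (wabs ?u i) = ?a (wabs ?u (Suc i)) \<and> wabs ?u i < wabs ?u (Suc i))"
    using Suc_Des_iff[OF u i] wabs_inv_Suc_neq[OF u, of i]
    unfolding combine_wabs_inv[OF w mem(1)] combine_wabs_inv[OF w mem(2)] card_Des_ge[of n ?u i]
    by (auto split: if_splits)
  then show ?thesis using key_less_iff wabs_mem[OF u] mem by blast
qed

lemma strictly_decreasing_chain:
  fixes f :: "nat \<Rightarrow> 'a::preorder"
  assumes step: "\<And>i. 1 \<le> i \<Longrightarrow> i < n \<Longrightarrow> f (Suc i) < f i" and i: "1 \<le> i" and "i < j" "j \<le> n"
  shows "f j < f i"
  using assms(3,4)
proof (induction j)
  case (Suc j)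
  show ?case
  proof (cases "i = j")
    case True
    then show ?thesis using step[of j] Suc.prems i by simp
  next
    case False
    then have "f j < f i" using Suc by simp
    then show ?thesis using step[of j] Suc.prems i less_trans by fastforce
  qed
qed simp

lemma key_combine_mono:
  assumes w: "w \<in> signed_perms n" and l: "decreasing_on n l" and pq: "p \<in> {1..n}" "q \<in> {1..n}"
  shows "key n (combine n w l) q < key n (combine n w l) p \<longleftrightarrow> wabs w p < wabs w q"
proof -
  have *: "key n (combine n w l) q < key n (combine n w l) p"
    if "wabs w p < wabs w q" "p \<in> {1..n}" "q \<in> {1..n}" for p q
  proof -
    have "key n (combine n w l) (wabs (inv w) (wabs w q)) < key n (combine n w l) (wabs (inv w) (wabs w p))"
    proof (rule strictly_decreasing_chain[where f = "\<lambda>i. key n (combine n w l) (wabs (inv w) i)" and n = n])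
      show "1 \<le> wabs w p" "wabs w q \<le> n"
        using wabs_mem[OF w that(2)] wabs_mem[OF w that(3)] by simp_all
    qed (rule key_combine_step[OF w l], assumption+, rule that)
    then show ?thesis by (simp add: wabs_inv[OF w])
  qed
  have "wabs w p = wabs w q \<Longrightarrow> p = q" by (metis w wabs_inv(1))
  then show ?thesis
    using *[of p q] *[of q p] pq by (cases "wabs w p" "wabs w q" rule: linorder_cases) auto
qed

definition key_rank :: "nat \<Rightarrow> (nat \<Rightarrow> nat) \<Rightarrow> nat \<Rightarrow> nat" where
  "key_rank n a p = card {q \<in> {1..n}. key n a p \<le> key n a q}"

lemma wabs_eq_key_rank:
  assumes w: "w \<in> signed_perms n" and l: "decreasing_on n l" and p: "p \<in> {1..n}"
  shows "wabs w p = key_rank n (combine n w l) p"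
proof -
  have "{q \<in> {1..n}. key n (combine n w l) p \<le> key n (combine n w l) q} = wabs (inv w) ` {1..wabs w p}"
  proof (intro equalityI subsetI)
    fix q assume "q \<in> {q \<in> {1..n}. key n (combine n w l) p \<le> key n (combine n w l) q}"
    then have "wabs w q \<le> wabs w p" "q \<in> {1..n}"
      using key_combine_mono[OF w l _ p, of q] key_combine_mono[OF w l p, of q] by auto
    then show "q \<in> wabs (inv w) ` {1..wabs w p}"
      using wabs_mem[OF w, of q] wabs_inv(1)[OF w, of q] by (intro image_eqI[of _ _ "wabs w q"]) auto
  next
    fix q assume "q \<in> wabs (inv w) ` {1..wabs w p}"
    then obtain i where i: "q = wabs (inv w) i" "1 \<le> i" "i \<le> wabs w p" by auto
    then have "i \<in> {1..n}" using wabs_mem[OF w p] by auto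
    then have "q \<in> {1..n}" using i wabs_mem[OF inv_signed_perm[OF w]] by blast
    moreover have "\<not> wabs w p < wabs w q" using i by (simp add: wabs_inv[OF w])
    ultimately show "q \<in> {q \<in> {1..n}. key n (combine n w l) p \<le> key n (combine n w l) q}"
      using key_combine_mono[OF w l p, of q] by auto
  qed
  moreover have "inj_on (wabs (inv w)) {1..wabs w p}" by (metis inj_onI w wabs_inv(2))
  ultimately show ?thesis by (simp add: key_rank_def card_image)
qed

lemma odd_combine_iff:
  assumes "w \<in> signed_perms n" "l \<in> even_partitions n"
  shows "odd (combine n w l j) \<longleftrightarrow> w (int j) < 0"
  using assms signed_perm_outside[OF assms(1), of j]
  by (auto simp: combine_def descent_expo_def even_partitions_def)

lemma combine_expo:
  assumes "w \<in> signed_perms n" "l \<in> expo n"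
  shows "combine n w l \<in> expo n"
  using assms by (simp add: expo_def combine_def descent_expo_def wabs_outside[OF assms(1)] del: atLeastAtMost_iff)

lemma even_partitionsD:
  assumes "l \<in> even_partitions n"
  shows "l \<in> expo n" "even (l i)" "decreasing_on n l"
  using assms by (auto simp: even_partitions_def)

text \<open>The ranks give |w|, the parities give the bars, and the excess over the descent
  exponents gives l.\<close>

lemma combine_inject:
  assumes w: "w \<in> signed_perms n" and l: "l \<in> even_partitions n"
    and w': "w' \<in> signed_perms n" and l': "l' \<in> even_partitions n"
    and eq: "combine n w l = combine n w' l'"
  shows "w = w'" and "l = l'"
proof -
  show ww: "w = w'"
  proof (rule signed_perm_eqI[OF w w'])
    fix i assume i: "i \<in> {1..n}"
    have "wabs w i = wabs w' i" using wabs_eq_key_rank[OF w even_partitionsD(3)[OF l] i]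
        wabs_eq_key_rank[OF w' even_partitionsD(3)[OF l'] i] eq by simp
    moreover have "w (int i) < 0 \<longleftrightarrow> w' (int i) < 0"
      using odd_combine_iff[OF w l, of i] odd_combine_iff[OF w' l', of i] eq by simp
    ultimately show "w (int i) = w' (int i)" by (auto simp: wabs_def)
  qed
  have "l (wabs w j) = l' (wabs w j)" for j
    using fun_cong[OF eq, of j] by (simp add: combine_def ww)
  then show "l = l'" by (metis ext w wabs_inv(2))
qed

text \<open>Let w record the ranks and parities of a. In sorted order the descent exponents have the
  smallest drops compatible with these parities and this order of ties, so subtracting them from the
  sorted a leaves a decreasing vector. It is nonnegative because at rank n only the bar is
  subtracted.\<close>

lemma combine_surj:
  assumes a: "a \<in> expo n"
  obtains w l where "w \<in> signed_perms n" "l \<in> even_partitions n" "a = combine n w l"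
proof -
  have rank_less: "key_rank n a p < key_rank n a q" if "key n a q < key n a p" "p \<in> {1..n}" "q \<in> {1..n}" for p q
  proof -
    have "q \<in> {r \<in> {1..n}. key n a q \<le> key n a r}" "q \<notin> {r \<in> {1..n}. key n a p \<le> key n a r}"
      using that by auto
    moreover have "{r \<in> {1..n}. key n a p \<le> key n a r} \<subseteq> {r \<in> {1..n}. key n a q \<le> key n a r}"
      using that by auto
    ultimately show ?thesis unfolding key_rank_def by (intro psubset_card_mono) auto
  qed
  have inj: "inj_on (key_rank n a) {1..n}"
  proof (rule inj_onI)
    fix p q assume "p \<in> {1..n}" "q \<in> {1..n}" "key_rank n a p = key_rank n a q"
    then have "\<not> key n a q < key n a p" "\<not> key n a p < key n a q"
      using rank_less[of p q] rank_less[of q p] by auto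
    then show "p = q" using key_less_iff \<open>p \<in> {1..n}\<close> \<open>q \<in> {1..n}\<close> by (metis linorder_neqE_nat)
  qed
  have rng: "key_rank n a p \<in> {1..n}" if "p \<in> {1..n}" for p
  proof -
    let ?S = "{q \<in> {1..n}. key n a p \<le> key n a q}"
    have "finite ?S" "p \<in> ?S" "?S \<subseteq> {1..n}" using that by auto
    then have "0 < card ?S" "card ?S \<le> card {1..n}"
      by (blast intro: card_gt_0_iff[THEN iffD2], blast intro: card_mono finite_atLeastAtMost)
    then show ?thesis by (simp only: key_rank_def atLeastAtMost_iff card_atLeastAtMost) linarith
  qed
  have bij: "bij_betw (key_rank n a) {1..n} {1..n}"
    unfolding bij_betw_def using inj rng endo_inj_surj[of "{1..n}" "key_rank n a"] by blast
  define w where "w = signed_ext n (\<lambda>i. if odd (a i) then - int (key_rank n a i) else int (key_rank n a i))"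
  have w: "w \<in> signed_perms n" unfolding w_def
    by (rule signed_ext_signed_perm, rule bij_betw_cong[THEN iffD1, OF _ bij]) simp
  have wabs: "wabs w i = key_rank n a i" and neg: "w (int i) < 0 \<longleftrightarrow> odd (a i)" if "i \<in> {1..n}" for i
  proof -
    have "w (int i) = (if odd (a i) then - int (key_rank n a i) else int (key_rank n a i))"
      unfolding w_def using that by (rule signed_ext_nat)
    moreover have "1 \<le> key_rank n a i" using rng[OF that] by simp
    ultimately show "wabs w i = key_rank n a i" "w (int i) < 0 \<longleftrightarrow> odd (a i)" by (auto simp: wabs_def)
  qed
  have u: "inv w \<in> signed_perms n" by (rule inv_signed_perm[OF w])
  let ?u = "inv w"
  define d where "d i = 2 * card {t \<in> Des n ?u. i \<le> t} + of_bool (?u (int i) < 0)" for i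
  define b where "b i = a (wabs ?u i)" for i
  have b_odd: "odd (b i) \<longleftrightarrow> ?u (int i) < 0" if "i \<in> {1..n}" for i
    using neg_wabs_inv[OF w that] neg[of "wabs ?u i"] wabs_mem[OF u that] by (simp add: b_def)
  have parity: "odd (b i) = odd (d i)" if "i \<in> {1..n}" for i
    using b_odd[OF that] by (simp add: d_def)
  have order: "b (Suc i) < b i \<or> (b i = b (Suc i) \<and> wabs ?u i < wabs ?u (Suc i))" if i: "1 \<le> i" "i < n" for i
  proof -
    have mem: "wabs ?u i \<in> {1..n}" "wabs ?u (Suc i) \<in> {1..n}" using wabs_mem[OF u] i by auto
    have "key_rank n a (wabs ?u i) < key_rank n a (wabs ?u (Suc i))"
      using wabs[OF mem(1)] wabs[OF mem(2)] by (simp add: wabs_inv[OF w])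
    then have "\<not> key n a (wabs ?u i) < key n a (wabs ?u (Suc i))"
      using rank_less[of "wabs ?u i" "wabs ?u (Suc i)"] mem by auto
    then have "\<not> (b i < b (Suc i) \<or> (b (Suc i) = b i \<and> wabs ?u (Suc i) < wabs ?u i))"
      unfolding b_def key_less_iff[OF mem(2) mem(1), of a] .
    then show ?thesis using wabs_inv_Suc_neq[OF u, of i] by linarith
  qed
  have step: "int (b (Suc i)) - int (d (Suc i)) \<le> int (b i) - int (d i)" if i: "1 \<le> i" "i < n" for i
  proof -
    have mem: "i \<in> {1..n}" "Suc i \<in> {1..n}" using i by auto
    have d: "d i = 2 * card {t \<in> Des n ?u. Suc i \<le> t} + 2 * of_bool (i \<in> Des n ?u) + of_bool (?u (int i) < 0)"
      unfolding d_def card_Des_ge[of n ?u i] by simp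
    \<comment> \<open>Equal parities turn a strict drop into a drop by at least 2, and different
      parities exclude a tie.\<close>
    have two: "b i \<noteq> b (Suc i) + 1" if "odd (b i) = odd (b (Suc i))" using that by auto
    have one: "b i \<noteq> b (Suc i)" if "odd (b i) \<noteq> odd (b (Suc i))" using that by auto
    show ?thesis
      using order[OF i] Suc_Des_iff[OF u i] wabs_inv_Suc_neq[OF u, of i] b_odd[OF mem(1)] b_odd[OF mem(2)] two one
      unfolding d by (auto simp: d_def split: if_splits)
  qed
  have chain: "int (b j) - int (d j) \<le> int (b i) - int (d i)" if "1 \<le> i" "i \<le> j" "j \<le> n" for i j
    using that(2,3)
  proof (induction j rule: dec_induct)
    case (step j)
    then show ?case
      using that(1) \<open>\<And>i. 1 \<le> i \<Longrightarrow> i < n \<Longrightarrow> int (b (Suc i)) - int (d (Suc i)) \<le> int (b i) - int (d i)\<close>[of j]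
      by simp
  qed simp
  have "int (b n) - int (d n) \<ge> 0" if "1 \<le> n"
  proof -
    have "{t \<in> Des n ?u. n \<le> t} = {}" by (auto simp: Des_def)
    then have "d n = of_bool (?u (int n) < 0)" by (simp only: d_def) simp
    then show ?thesis using b_odd[of n] that by (cases "?u (int n) < 0") (auto dest: odd_pos)
  qed
  then have ge: "d i \<le> b i" if "i \<in> {1..n}" for i using chain[of i n] that by auto
  define l where "l i = (if i \<in> {1..n} then b i - d i else 0)" for i
  have "l \<in> even_partitions n" unfolding even_partitions_def decreasing_on_def expo_def
  proof (intro CollectI conjI allI impI)
    show "even (l i)" for i using parity[of i] ge[of i] by (auto simp: l_def)
    show "l j \<le> l i" if "1 \<le> i \<and> i \<le> j \<and> j \<le> n" for i j
      using chain[of i j] ge[of i] ge[of j] that by (auto simp: l_def)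
  qed (auto simp: l_def)
  moreover have "a j = combine n w l j" for j
  proof (cases "j \<in> {1..n}")
    case True
    then have mem: "wabs w j \<in> {1..n}" by (rule wabs_mem[OF w])
    have "combine n w l j = combine n w l (wabs ?u (wabs w j))" by (simp add: wabs_inv[OF w])
    also have "\<dots> = d (wabs w j) + l (wabs w j)" unfolding combine_wabs_inv[OF w mem] d_def ..
    also have "\<dots> = b (wabs w j)" using ge[OF mem] mem by (simp add: l_def)
    also have "\<dots> = a j" by (simp add: b_def wabs_inv[OF w])
    finally show ?thesis ..
  next
    case False
    then show ?thesis
      using a combine_expo[OF w, of l] \<open>l \<in> even_partitions n\<close> by (auto simp: expo_def even_partitions_def)
  qed
  ultimately show ?thesis using that w by blast
qed

text \<open>Position s + 1 has a smaller rank than s exactly if its exponent is strictly larger,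
  since ties favour s. If the parities at s and s + 1 differ, s belongs to both sets.\<close>

lemma sDes_combine:
  assumes w: "w \<in> signed_perms n" and l: "l \<in> even_partitions n"
  shows "sDes n w = word_sDes n (combine n w l)"
proof -
  let ?a = "combine n w l"
  have neg: "odd (?a j) \<longleftrightarrow> w (int j) < 0" for j by (rule odd_combine_iff[OF w l])
  have "(w (int (s + 1)) <\<^sub>r w (int s) \<or> w (int s) < 0 \<and> 0 < w (int (s + 1))) \<longleftrightarrow>
      (?a s < ?a (s + 1) \<or> odd (?a s) \<noteq> odd (?a (s + 1)))" if s: "1 \<le> s" "s < n" for s
  proof -
    have mem: "s \<in> {1..n}" "s + 1 \<in> {1..n}" using s by auto
    have nz: "w (int s) \<noteq> 0" "w (int (s + 1)) \<noteq> 0"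
      using signed_perm_abs_range(1)[OF w] mem by blast+
    have "\<bar>w (int s)\<bar> \<noteq> \<bar>w (int (s + 1))\<bar>"
      using wabs_inv_Suc_neq[OF w, of s] by (simp add: wabs_def)
    then have desc: "w (int (s + 1)) <\<^sub>r w (int s) \<longleftrightarrow>
        (if (w (int s) < 0) = (w (int (s + 1)) < 0) then wabs w (s + 1) < wabs w s else w (int (s + 1)) < 0)"
      using less_r_cases[of "w (int s)" "w (int (s + 1))"] nz unfolding wabs_def by blast
    have "wabs w (s + 1) < wabs w s \<longleftrightarrow> ?a s < ?a (s + 1)"
      using key_combine_mono[OF w even_partitionsD(3)[OF l] mem(2) mem(1)]
        key_less_iff[OF mem(2) mem(1), of ?a] by simp
    then show ?thesis unfolding desc neg using nz by auto
  qed
  then show ?thesis unfolding sDes_def word_sDes_def by (auto simp: neg)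
qed

text \<open>A descent t is counted at the ranks 1, ..., t and so contributes 2t; the parities
  contribute the number of bars.\<close>

lemma sum_descent_expo:
  assumes w: "w \<in> signed_perms n"
  shows "(\<Sum>j=1..n. descent_expo n w j) = fmaj n (inv w)"
proof -
  let ?u = "inv w"
  have u: "?u \<in> signed_perms n" by (rule inv_signed_perm[OF w])
  have "(\<Sum>j=1..n. descent_expo n w j) = (\<Sum>i=1..n. descent_expo n w (wabs ?u i))"
    using sum.permute[OF wabs_permutes[OF u], of "descent_expo n w"] by (simp add: o_def)
  also have "\<dots> = (\<Sum>i=1..n. 2 * card {t \<in> Des n ?u. i \<le> t} + of_bool (?u (int i) < 0))"
    using combine_wabs_inv[OF w, of _ "\<lambda>_. 0"] by (intro sum.cong) (auto simp: combine_def)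
  also have "\<dots> = 2 * (\<Sum>i=1..n. card {t \<in> Des n ?u. i \<le> t}) + (\<Sum>i=1..n. of_bool (?u (int i) < 0))"
    by (simp add: sum.distrib sum_distrib_left)
  also have "(\<Sum>i=1..n. of_bool (?u (int i) < 0)) = bar_num n ?u"
    unfolding bar_num_def by (subst sum_of_bool_eq) (auto intro!: arg_cong[of _ _ card])
  also have "(\<Sum>i=1..n. card {t \<in> Des n ?u. i \<le> t}) = (\<Sum>i=1..n. \<Sum>t\<in>Des n ?u. of_bool (i \<le> t))"
    by (intro sum.cong refl, subst sum_of_bool_eq) (auto intro!: arg_cong[of _ _ card])
  also have "\<dots> = (\<Sum>t\<in>Des n ?u. \<Sum>i=1..n. of_bool (i \<le> t))" by (rule sum.swap)
  also have "\<dots> = (\<Sum>t\<in>Des n ?u. t)"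
  proof (intro sum.cong refl)
    fix t assume "t \<in> Des n ?u"
    then have "{1..n} \<inter> {i. i \<le> t} = {1..t}" by (auto simp: Des_def)
    then show "(\<Sum>i=1..n. of_bool (i \<le> t)) = t" by (subst sum_of_bool_eq) auto
  qed
  finally show ?thesis by (simp add: fmaj_def maj_def)
qed

subsection \<open>Triangularity\<close>

text \<open>A set of vectors and not a family indexed by permutations, so that the orbit sum has
  coefficients 1 even if parts of l coincide.\<close>

definition orbit_of :: "nat \<Rightarrow> (nat \<Rightarrow> nat) \<Rightarrow> (nat \<Rightarrow> nat) set" where
  "orbit_of n l = {l \<circ> \<pi> | \<pi>. \<pi> permutes {1..n}}"

lemma finite_orbit_of [simp]: "finite (orbit_of n l)"
proof -
  have "orbit_of n l = (\<lambda>\<pi>. l \<circ> \<pi>) ` {\<pi>. \<pi> permutes {1..n}}" by (auto simp: orbit_of_def)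
  then show ?thesis by (simp add: finite_permutations)
qed

text \<open>A decreasing vector is determined by the numbers of entries that are at least t, for all
  t, and a rearrangement does not change these.\<close>

lemma decreasing_rearrangement_unique:
  assumes l: "decreasing_on n l" and l': "decreasing_on n (l \<circ> \<pi>)" and \<pi>: "\<pi> permutes {1..n}"
  shows "l \<circ> \<pi> = l"
proof
  fix i
  show "(l \<circ> \<pi>) i = l i"
  proof (cases "i \<in> {1..n}")
    case True
    have ge_iff: "t \<le> b i \<longleftrightarrow> i \<le> card {j \<in> {1..n}. t \<le> b j}" if b: "decreasing_on n b" for b t
    proof
      assume "t \<le> b i"
      then have "{1..i} \<subseteq> {j \<in> {1..n}. t \<le> b j}" using b True by (force simp: decreasing_on_def)
      then have "card {1..i} \<le> card {j \<in> {1..n}. t \<le> b j}" by (intro card_mono) auto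
      then show "i \<le> card {j \<in> {1..n}. t \<le> b j}" by simp
    next
      assume *: "i \<le> card {j \<in> {1..n}. t \<le> b j}"
      show "t \<le> b i"
      proof (rule ccontr)
        assume "\<not> t \<le> b i"
        then have "{j \<in> {1..n}. t \<le> b j} \<subseteq> {1..<i}"
        proof (intro subsetI)
          fix j assume j: "j \<in> {j \<in> {1..n}. t \<le> b j}"
          have "\<not> i \<le> j"
          proof
            assume "i \<le> j"
            then have "b j \<le> b i" using b True j by (simp add: decreasing_on_def)
            with j \<open>\<not> t \<le> b i\<close> show False
              by simp
          qed
          with j show "j \<in> {1..<i}" by simp
        qed
        then have "card {j \<in> {1..n}. t \<le> b j} \<le> card {1..<i}" by (intro card_mono) auto
        with * True show False
          by auto
      qed
    qed
    have "card {j \<in> {1..n}. t \<le> (l \<circ> \<pi>) j} = card {j \<in> {1..n}. t \<le> l j}" for t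
    proof (rule bij_betw_same_card[of \<pi>])
      have "\<pi> ` {j \<in> {1..n}. t \<le> (l \<circ> \<pi>) j} = {j \<in> {1..n}. t \<le> l j}"
      proof (intro equalityI subsetI)
        fix j assume j: "j \<in> {j \<in> {1..n}. t \<le> l j}"
        moreover obtain j' where "j' \<in> {1..n}" "j = \<pi> j'" using j permutes_image[OF \<pi>] by blast
        ultimately show "j \<in> \<pi> ` {j \<in> {1..n}. t \<le> (l \<circ> \<pi>) j}" by auto
      qed (use permutes_in_image[OF \<pi>] in auto)
      then show "bij_betw \<pi> {j \<in> {1..n}. t \<le> (l \<circ> \<pi>) j} {j \<in> {1..n}. t \<le> l j}"
        using permutes_inj_on[OF \<pi>] by (simp add: bij_betw_def)
    qed
    then have "t \<le> (l \<circ> \<pi>) i \<longleftrightarrow> t \<le> l i" for t using ge_iff[OF l] ge_iff[OF l'] by simp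
    then show ?thesis by (meson order_antisym order_refl)
  next
    case False
    then show ?thesis using permutes_not_in[OF \<pi>] by simp
  qed
qed

lemma orbit_of_compose:
  assumes "b \<in> orbit_of n l" and "\<pi> permutes {1..n}"
  shows "b \<circ> \<pi> \<in> orbit_of n l"
proof -
  obtain \<rho> where "b = l \<circ> \<rho>" "\<rho> permutes {1..n}" using assms by (auto simp: orbit_of_def)
  moreover have "\<rho> \<circ> \<pi> permutes {1..n}" using assms calculation by (intro permutes_compose)
  ultimately show ?thesis unfolding orbit_of_def by (auto simp: comp_assoc)
qed

text \<open>A rearrangement that maximises the sum has no inversion, as swapping one would increase it.\<close>

lemma rearrangement_strict:
  fixes V :: "nat \<Rightarrow> int"
  assumes V: "\<And>i j. 1 \<le> i \<Longrightarrow> i < j \<Longrightarrow> j \<le> n \<Longrightarrow> V j < V i"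
    and l: "decreasing_on n l" and b: "b \<in> orbit_of n l" "b \<noteq> l"
  shows "(\<Sum>i=1..n. V i * int (b i)) < (\<Sum>i=1..n. V i * int (l i))"
proof -
  define f where "f b = (\<Sum>i=1..n. V i * int (b i))" for b
  have better: "\<exists>b'\<in>orbit_of n l. f b < f b'" if b: "b \<in> orbit_of n l" "b \<noteq> l" for b
  proof -
    have "\<not> decreasing_on n b"
      using b decreasing_rearrangement_unique[OF l] by (auto simp: orbit_of_def)
    then obtain i j where ij: "1 \<le> i" "i \<le> j" "j \<le> n" "b i < b j"
      by (auto simp: decreasing_on_def not_le)
    then have "i < j" by (cases "i = j") auto
    let ?b = "b \<circ> transpose i j"
    have t: "transpose i j permutes {1..n}" using ij by (intro permutes_swap_id) auto
    have split: "f c = V i * int (c i) + V j * int (c j) + (\<Sum>k\<in>{1..n} - {i, j}. V k * int (c k))" for c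
    proof -
      have "{1..n} = insert i (insert j ({1..n} - {i, j}))" using ij by auto
      then have "f c = sum (\<lambda>k. V k * int (c k)) (insert i (insert j ({1..n} - {i, j})))"
        by (simp add: f_def)
      then show ?thesis using \<open>i < j\<close> by simp
    qed
    have "(\<Sum>k\<in>{1..n} - {i, j}. V k * int (?b k)) = (\<Sum>k\<in>{1..n} - {i, j}. V k * int (b k))"
      by (intro sum.cong) (auto simp: transpose_def)
    then have "f ?b - f b = (V i - V j) * (int (b j) - int (b i))"
      unfolding split[of ?b] split[of b] by (simp add: algebra_simps)
    moreover have "0 < (V i - V j) * (int (b j) - int (b i))"
      using V[of i j] ij \<open>i < j\<close> by (intro mult_pos_pos) auto
    ultimately have "f b < f ?b" by simp
    then show ?thesis using orbit_of_compose[OF b(1) t] by blast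
  qed
  have ne: "orbit_of n l \<noteq> {}" using b by blast
  define M where "M = Max (f ` orbit_of n l)"
  have "M \<in> f ` orbit_of n l" unfolding M_def using ne by (intro Max_in) auto
  then obtain b' where b': "b' \<in> orbit_of n l" "f b' = M" by auto
  have le: "f c \<le> M" if "c \<in> orbit_of n l" for c unfolding M_def using that by (intro Max_ge) auto
  have "b' = l" using better[of b'] b' le by force
  then have "f b < f l" using better[OF b] le b' by force
  then show ?thesis by (simp add: f_def)
qed

text \<open>The square supplies the cross term 2n d_i b_i for a sum d + b; together with - i b_i
  this is \<open>key n d i\<close> times b_i, which explains the factors n here and 2n in
  \<open>key\<close>. The other part that depends on b, n times the sum of the b_i^2, is constant on
  orbits.\<close>

definition psi :: "nat \<Rightarrow> (nat \<Rightarrow> nat) \<Rightarrow> int" where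
  "psi n a = (\<Sum>i=1..n. int n * (int (a i))\<^sup>2 - int i * int (a i))"

text \<open>Allows induction on \<open>nat (psi n a)\<close>.\<close>

lemma psi_nonneg: "0 \<le> psi n a"
proof -
  have "int i * int (a i) \<le> int n * (int (a i))\<^sup>2" if "i \<in> {1..n}" for i
  proof (cases "a i = 0")
    case False
    then have "int i * int (a i) \<le> int n * int (a i) * 1" using that by (simp add: mult_right_mono)
    also have "\<dots> \<le> int n * int (a i) * int (a i)" using False by (intro mult_left_mono) auto
    finally show ?thesis by (simp add: power2_eq_square mult.assoc)
  qed simp
  then show ?thesis unfolding psi_def by (intro sum_nonneg) auto
qed

lemma sum_orbit_of:
  fixes h :: "nat \<Rightarrow> 'a::comm_monoid_add"
  assumes "b \<in> orbit_of n l"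
  shows "(\<Sum>i=1..n. h (b i)) = (\<Sum>i=1..n. h (l i))"
proof -
  obtain \<pi> where "b = l \<circ> \<pi>" "\<pi> permutes {1..n}" using assms by (auto simp: orbit_of_def)
  then show ?thesis using sum.permute[of \<pi> "{1..n}" "\<lambda>i. h (l i)"] by (simp add: o_def)
qed

text \<open>Over the orbit only the linear form in b varies whose coefficients are the keys of the
  descent exponents. These keys decrease strictly along the ranks, so the form is maximal only when
  the parts of l are assigned by rank, and that vector is \<open>combine n w l\<close>.\<close>

lemma psi_descent_orbit_less:
  assumes w: "w \<in> signed_perms n" and l: "decreasing_on n l"
    and b: "b \<in> orbit_of n l" "b \<noteq> l \<circ> wabs w"
  shows "psi n (\<lambda>j. descent_expo n w j + b j) < psi n (combine n w l)"
proof -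
  let ?d = "descent_expo n w" and ?u = "wabs (inv w)" and ?c = "l \<circ> wabs w"
  let ?V = "\<lambda>i. key n ?d (?u i)"
  have u: "?u permutes {1..n}" by (rule wabs_permutes[OF inv_signed_perm[OF w]])
  \<comment> \<open>With l = 0 the descent exponents are themselves a combined vector, so their keys
    are ordered too.\<close>
  have "combine n w (\<lambda>_. 0) = ?d" by (auto simp: combine_def)
  then have step: "?V (Suc i) < ?V i" if "1 \<le> i" "i < n" for i
    using key_combine_step[OF w _ that, of "\<lambda>_. 0"] by (simp add: decreasing_on_def)
  then have V: "?V j < ?V i" if "1 \<le> i" "i < j" "j \<le> n" for i j
    using strictly_decreasing_chain[of n ?V, OF _ that] by blast
  have bu: "b \<circ> ?u \<in> orbit_of n l" by (rule orbit_of_compose[OF b(1) u])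
  have "b \<circ> ?u \<noteq> l"
  proof
    assume "b \<circ> ?u = l"
    then have "b (?u (wabs w i)) = l (wabs w i)" for i by (metis comp_apply)
    then have "b = l \<circ> wabs w" by (auto simp: wabs_inv[OF w])
    with b show False
      by simp
  qed
  then have less: "(\<Sum>i=1..n. ?V i * int ((b \<circ> ?u) i)) < (\<Sum>i=1..n. ?V i * int (l i))"
    using rearrangement_strict[of n ?V l "b \<circ> ?u"] V l bu by blast
  have "(\<Sum>i=1..n. ?V i * int (f (?u i))) = (\<Sum>j=1..n. key n ?d j * int (f j))" for f
    using sum.permute[OF u, of "\<lambda>j. key n ?d j * int (f j)"] by (simp add: o_def)
  from this[of b] this[of ?c] less
  have "(\<Sum>j=1..n. key n ?d j * int (b j)) < (\<Sum>j=1..n. key n ?d j * int (?c j))"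
    by (simp add: wabs_inv[OF w])
  moreover have c: "?c \<in> orbit_of n l" using wabs_permutes[OF w] by (auto simp: orbit_of_def)
  have "(\<Sum>i=1..n. (int (b i))\<^sup>2) = (\<Sum>i=1..n. (int (?c i))\<^sup>2)"
    using sum_orbit_of[OF b(1), of "\<lambda>x. (int x)\<^sup>2"] sum_orbit_of[OF c, of "\<lambda>x. (int x)\<^sup>2"] by simp
  moreover have "psi n (\<lambda>j. ?d j + f j) = (\<Sum>i=1..n. int n * (int (?d i))\<^sup>2 - int i * int (?d i)) +
      int n * (\<Sum>i=1..n. (int (f i))\<^sup>2) + (\<Sum>j=1..n. key n ?d j * int (f j))" for f
    unfolding psi_def sum_distrib_left sum.distrib[symmetric]
    by (intro sum.cong) (auto simp: key_def algebra_simps power2_eq_square)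
  ultimately have "psi n (\<lambda>j. ?d j + b j) < psi n (\<lambda>j. ?d j + ?c j)" by simp
  moreover have "(\<lambda>j. ?d j + ?c j) = combine n w l" by (auto simp: combine_def)
  ultimately show ?thesis by simp
qed

subsection \<open>Monomials and the action\<close>

abbreviation lookup where "lookup \<equiv> Poly_Mapping.lookup"

abbreviation keys where "keys \<equiv> Poly_Mapping.keys"

lemma finite_expo_support: "a \<in> expo n \<Longrightarrow> finite {i. a i \<noteq> 0}"
  by (rule finite_subset[of _ "{1..n}"]) (auto simp: expo_def)

definition mon :: "(nat \<Rightarrow> nat) \<Rightarrow> (nat \<Rightarrow>\<^sub>0 nat)" where
  "mon a = Abs_poly_mapping a"

lemma lookup_mon [simp]: "a \<in> expo n \<Longrightarrow> lookup (mon a) = a"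
  unfolding mon_def using finite_expo_support by simp

lemma mon_lookup [simp]: "mon (lookup m) = m"
  by (simp add: mon_def)

lemma mon_inject: "a \<in> expo n \<Longrightarrow> b \<in> expo n \<Longrightarrow> mon a = mon b \<longleftrightarrow> a = b"
  using lookup_mon by metis

lemma keys_mon: "a \<in> expo n \<Longrightarrow> keys (mon a) \<subseteq> {1..n}"
  by (rule subsetI, rule ccontr) (simp add: in_keys_iff expo_def del: atLeastAtMost_iff)

lemma lookup_in_expo: "keys m \<subseteq> {1..n} \<Longrightarrow> lookup m \<in> expo n"
  by (auto simp: expo_def in_keys_iff subset_iff)

lemma expo_add: "a \<in> expo n \<Longrightarrow> b \<in> expo n \<Longrightarrow> (\<lambda>i. a i + b i) \<in> expo n"
  by (simp add: expo_def)

lemma mon_add: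
  assumes "a \<in> expo n" "b \<in> expo n"
  shows "mon a + mon b = mon (\<lambda>i. a i + b i)"
  by (rule poly_mapping_eqI) (simp add: lookup_add lookup_mon[OF assms(1)] lookup_mon[OF assms(2)]
      lookup_mon[OF expo_add[OF assms]])

definition expo_deg :: "nat \<Rightarrow> nat \<Rightarrow> (nat \<Rightarrow> nat) set" where
  "expo_deg n k = {a \<in> expo n. (\<Sum>i=1..n. a i) = k}"

lemma bij_betw_expo_deg_words: "bij_betw (\<lambda>a. map a [1..<n + 1]) (expo_deg n k) (words n k)"
proof (rule bij_betw_byWitness[where f' = "\<lambda>xs i. if i \<in> {1..n} then xs ! (i - 1) else 0"])
  have sum: "sum_list (map a [1..<n + 1]) = (\<Sum>i=1..n. a i)" for a :: "nat \<Rightarrow> nat"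
    by (simp add: sum_list_distinct_conv_sum_set atLeastLessThanSuc_atLeastAtMost del: upt_Suc)
  have inv: "map (\<lambda>i. if i \<in> {1..n} then xs ! (i - 1) else 0) [1..<n + 1] = xs" if "length xs = n" for xs :: "nat list"
    using that by (intro nth_equalityI) (auto simp del: upt_Suc)
  show "\<forall>a\<in>expo_deg n k. (\<lambda>i. if i \<in> {1..n} then map a [1..<n + 1] ! (i - 1) else 0) = a"
    by (auto simp: expo_deg_def expo_def fun_eq_iff simp del: upt_Suc)
  show "\<forall>xs\<in>words n k. map (\<lambda>i. if i \<in> {1..n} then xs ! (i - 1) else 0) [1..<n + 1] = xs"
    using inv by (simp add: words_def del: upt_Suc)
  show "(\<lambda>a. map a [1..<n + 1]) ` expo_deg n k \<subseteq> words n k"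
    using sum by (auto simp: expo_deg_def words_def simp del: upt_Suc)
  show "(\<lambda>xs i. if i \<in> {1..n} then xs ! (i - 1) else 0) ` words n k \<subseteq> expo_deg n k"
  proof (intro subsetI, elim imageE)
    fix f xs assume "xs \<in> words n k" and f: "f = (\<lambda>i. if i \<in> {1..n} then xs ! (i - 1) else 0)"
    then have "map f [1..<n + 1] = xs" "sum_list xs = k"
      using inv by (auto simp: words_def simp del: upt_Suc)
    then show "f \<in> expo_deg n k"
      using sum[of f] f by (auto simp: expo_deg_def expo_def simp del: upt_Suc)
  qed
qed

lemma finite_expo_deg [simp]: "finite (expo_deg n k)"
  using bij_betw_finite[OF bij_betw_expo_deg_words] by simp

lemma lookup_Const_mult [simp]: "lookup (Const c * p) m = c * lookup p m"
  unfolding Const_def mult_map_scale_conv_mult[symmetric]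
  by (simp add: Poly_Mapping.map.rep_eq when_def)

lemma Const_simps [simp]: "Const 0 = 0" "Const 1 = 1"
  by (simp_all add: Const_def)

lemma Const_mult: "Const c * Const d = Const (c * d)"
  by (simp add: Const_def mult_single)

lemma Const_add: "Const (c + d) = Const c + Const d"
  by (simp add: Const_def single_add)

text \<open>Provides spans, independence and coordinates over the field, which acts through
  \<open>Const\<close>.\<close>

interpretation mp: vector_space "\<lambda>c (p :: 'a::field_char_0 mpoly). Const c * p"
  by standard (simp_all add: Const_mult Const_add distrib_left distrib_right flip: mult.assoc)

definition X :: "(nat \<Rightarrow> nat) \<Rightarrow> 'a::field_char_0 mpoly" where
  "X a = Poly_Mapping.single (mon a) 1"

lemma X_mult: "a \<in> expo n \<Longrightarrow> b \<in> expo n \<Longrightarrow> X a * X b = X (\<lambda>i. a i + b i)"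
  by (simp add: X_def mult_single mon_add)

lemma lookup_X:
  assumes "a \<in> expo n" "b \<in> expo n"
  shows "lookup (X a) (mon b) = of_bool (a = b)"
  using mon_inject[OF assms] by (simp add: X_def lookup_single when_def)

lemma keys_X [simp]: "keys (X a :: 'a::field_char_0 mpoly) = {mon a}"
  by (simp add: X_def)

lemma mpoly_expand: "p = (\<Sum>m\<in>keys p. Const (lookup p m) * X (lookup m))"
proof (rule poly_mapping_eqI)
  fix m
  have "lookup (\<Sum>m\<in>keys p. Const (lookup p m) * X (lookup m)) m =
      (\<Sum>m'\<in>keys p. if m' = m then lookup p m else 0)"
    unfolding lookup_sum by (intro sum.cong) (auto simp: X_def lookup_single when_def)
  also have "\<dots> = lookup p m" by (simp add: in_keys_iff)
  finally show "lookup p m = lookup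
      (\<Sum>m\<in>keys p. Const (lookup p m) * X (lookup m)) m" ..
qed

lemma keys_Const_mult: "keys (Const c * p) \<subseteq> keys p"
  by (auto simp: in_keys_iff)

lemma span_monomials:
  "mp.span (X ` A) = {p :: 'a::field_char_0 mpoly. keys p \<subseteq> mon ` A}"
proof (rule mp.span_unique)
  show "mp.subspace {p :: 'a mpoly. keys p \<subseteq> mon ` A}"
  proof (rule mp.subspaceI)
    fix p q :: "'a mpoly" assume pq: "p \<in> {p. keys p \<subseteq> mon ` A}" "q \<in> {p. keys p \<subseteq> mon ` A}"
    show "p + q \<in> {p. keys p \<subseteq> mon ` A}" using pq keys_add[of p q] by blast
  next
    fix p :: "'a mpoly" and c assume "p \<in> {p. keys p \<subseteq> mon ` A}"
    then show "Const c * p \<in> {p. keys p \<subseteq> mon ` A}" using keys_Const_mult[of c p] by blast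
  qed simp
next
  fix T :: "'a mpoly set" assume T: "X ` A \<subseteq> T" "mp.subspace T"
  show "{p. keys p \<subseteq> mon ` A} \<subseteq> T"
  proof
    fix p :: "'a mpoly" assume p: "p \<in> {p. keys p \<subseteq> mon ` A}"
    have "X (lookup m) \<in> T" if m: "m \<in> keys p" for m
    proof -
      obtain a where "a \<in> A" "m = mon a" using p m by auto
      moreover have "X (lookup m) = X a" unfolding X_def mon_lookup using \<open>m = mon a\<close> by simp
      ultimately show ?thesis using T(1) by auto
    qed
    then have "(\<Sum>m\<in>keys p. Const (lookup p m) * X (lookup m)) \<in> T"
      by (intro mp.subspace_sum[OF T(2)] mp.subspace_scale[OF T(2)])
    then show "p \<in> T" using mpoly_expand[of p] by simp
  qed
qed (auto simp: image_iff)

lemma polys_eq_span: "polys n = mp.span (X ` expo n)"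
proof -
  have "keys m \<subseteq> {1..n} \<longleftrightarrow> m \<in> mon ` expo n" for m
    using keys_mon lookup_in_expo[of m n] mon_lookup[of m] by (metis imageE image_eqI)
  then show ?thesis unfolding span_monomials polys_def by auto
qed

lemma homogeneous_polys_eq_span: "homogeneous_polys n k = mp.span (X ` expo_deg n k)"
proof -
  have "keys m \<subseteq> {1..n} \<and> (\<Sum>i\<in>keys m. lookup m i) = k \<longleftrightarrow>
      m \<in> mon ` expo_deg n k" for m
  proof -
    have deg: "(\<Sum>i\<in>keys m. lookup m i) = (\<Sum>i=1..n. lookup m i)"
      if "keys m \<subseteq> {1..n}" for m :: "nat \<Rightarrow>\<^sub>0 nat"
      using that by (intro sum.mono_neutral_left) (auto simp: in_keys_iff)
    show ?thesis
    proof
      assume "keys m \<subseteq> {1..n} \<and> (\<Sum>i\<in>keys m. lookup m i) = k"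
      then have "lookup m \<in> expo_deg n k"
        using deg[of m] lookup_in_expo[of m n] by (simp add: expo_deg_def)
      then show "m \<in> mon ` expo_deg n k" by (metis image_eqI mon_lookup)
    next
      assume "m \<in> mon ` expo_deg n k"
      then obtain a where a: "a \<in> expo n" "(\<Sum>i=1..n. a i) = k" "m = mon a"
        by (auto simp: expo_deg_def)
      then show "keys m \<subseteq> {1..n} \<and> (\<Sum>i\<in>keys m. lookup m i) = k"
        using deg[of m] keys_mon[OF a(1)] by simp
    qed
  qed
  then show ?thesis unfolding span_monomials homogeneous_polys_def polys_def by blast
qed

lemma polys_subspace: "mp.subspace (polys n)"
  unfolding polys_eq_span by (rule mp.subspace_span)

lemma X_in_polys: "a \<in> expo n \<Longrightarrow> X a \<in> polys n"
  unfolding polys_eq_span by (intro mp.span_base imageI)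

lemma polys_mult:
  assumes "p \<in> polys n" "q \<in> polys n"
  shows "p * q \<in> polys n"
  unfolding polys_def
proof (intro CollectI ballI)
  fix m assume "m \<in> keys (p * q)"
  then obtain a b where "m = a + b" "a \<in> keys p" "b \<in> keys q" using keys_mult[of p q] by blast
  then show "keys m \<subseteq> {1..n}" using assms keys_add[of a b] unfolding polys_def by blast
qed

section \<open>The action on monomials\<close>

definition act_sign :: "nat \<Rightarrow> signed_perm \<Rightarrow> (nat \<Rightarrow> nat) \<Rightarrow> int" where
  "act_sign n w a = (\<Prod>i=1..n. sgn (w (int i)) ^ a i)"

text \<open>The variable x_i goes to plus or minus the variable with index |w(i)|, so the new
  exponent at j is the old one at the preimage of j; hence the inverse.\<close>

lemma act_X:
  assumes w: "w \<in> signed_perms n" and a: "a \<in> expo n"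
  shows "act w (X a :: 'a::field_char_0 mpoly) = Const (of_int (act_sign n w a)) * X (a \<circ> wabs (inv w))"
proof -
  have Var_pow: "(Var j :: 'a mpoly) ^ e =
      Const (of_int (sgn j ^ e)) * Poly_Mapping.single (Poly_Mapping.single (nat \<bar>j\<bar>) e) 1" for j e
  proof (induction e)
    case (Suc e)
    then have "(Var j :: 'a mpoly) ^ Suc e = Poly_Mapping.single (Poly_Mapping.single (nat \<bar>j\<bar>) 1 +
        Poly_Mapping.single (nat \<bar>j\<bar>) e) (of_int (sgn j) * of_int (sgn j ^ e))"
      by (simp add: Var_def Const_def mult_single del: single_of_int)
    then show ?case by (simp add: Const_def mult_single del: single_of_int flip: single_add)
  qed (simp add: Const_def)
  let ?S = "\<lambda>i. Poly_Mapping.single (wabs w i) (a i)"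
  have "act w (X a :: 'a mpoly) = (\<Prod>i\<in>keys (mon a). Var (w (int i)) ^ lookup (mon a) i)"
    by (simp add: act_def X_def)
  also have "\<dots> = (\<Prod>i=1..n. Var (w (int i)) ^ a i)"
    using keys_mon[OF a] a by (intro prod.mono_neutral_cong_left) (auto simp: in_keys_iff)
  also have "\<dots> = (\<Prod>i=1..n. Poly_Mapping.single (?S i) (of_int (sgn (w (int i)) ^ a i)))"
    by (intro prod.cong) (simp_all add: Var_pow Const_def mult_single wabs_def del: single_of_int of_int_power)
  also have "\<dots> = Poly_Mapping.single (\<Sum>i=1..n. ?S i) (\<Prod>i=1..n. of_int (sgn (w (int i)) ^ a i))"
  proof -
    have "(\<Prod>i\<in>A. Poly_Mapping.single (?S i) (c i)) = Poly_Mapping.single (\<Sum>i\<in>A. ?S i) (\<Prod>i\<in>A. c i)"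
      if "finite A" for A and c :: "nat \<Rightarrow> 'a"
      using that by (induction A) (simp_all add: mult_single)
    then show ?thesis by simp
  qed
  also have "(\<Sum>i=1..n. ?S i) = mon (a \<circ> wabs (inv w))"
  proof (rule poly_mapping_eqI)
    fix j
    have au: "a \<circ> wabs (inv w) \<in> expo n"
      using a wabs_outside[OF inv_signed_perm[OF w]] by (simp add: expo_def del: atLeastAtMost_iff)
    have "lookup (\<Sum>i=1..n. ?S i) j = (\<Sum>i=1..n. if i = wabs (inv w) j then a i else 0)"
      unfolding lookup_sum
    proof (intro sum.cong refl)
      fix i
      have "wabs w i = j \<longleftrightarrow> i = wabs (inv w) j" using wabs_inv[OF w] by metis
      then show "lookup (?S i) j = (if i = wabs (inv w) j then a i else 0)"
        by (simp add: lookup_single when_def)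
    qed
    also have "\<dots> = a (wabs (inv w) j)" using a by (auto simp: expo_def)
    finally show "lookup (\<Sum>i=1..n. ?S i) j = lookup (mon (a \<circ> wabs (inv w))) j" using au by simp
  qed
  finally show ?thesis by (simp add: act_sign_def X_def Const_def mult_single del: single_of_int)
qed

lemma act_superset:
  assumes "finite A" "keys p \<subseteq> A"
  shows "act w p = (\<Sum>m\<in>A. Const (lookup p m) *
     (\<Prod>i\<in>keys m. Var (w (int i)) ^ lookup m i))"
  unfolding act_def using assms by (intro sum.mono_neutral_left) (auto simp: in_keys_iff)

lemma act_add: "act w (p + q) = act w p + act w q"
proof -
  let ?A = "keys p \<union> keys q"
  have "keys (p + q) \<subseteq> ?A" by (rule keys_add)
  then show ?thesis
    using act_superset[of ?A "p + q" w] act_superset[of ?A p w] act_superset[of ?A q w]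
    by (simp add: lookup_add Const_add distrib_right sum.distrib)
qed

lemma act_scale: "act w (Const c * p) = Const c * act w p"
  using act_superset[OF finite_keys keys_Const_mult, of w c p]
  by (simp add: act_def sum_distrib_left Const_mult flip: mult.assoc)

lemma act_zero [simp]: "act w 0 = 0"
  by (simp add: act_def)

lemma act_sum: "act w (sum f A) = (\<Sum>x\<in>A. act w (f x))"
  by (induction A rule: infinite_finite_induct) (simp_all add: act_add)

lemma act_diff: "act w (p - q) = act w p - act w q"
  using act_add[of w "p - q" q] by (simp add: algebra_simps)

lemma wabs_inv_permutes: "w \<in> signed_perms n \<Longrightarrow> wabs (inv w) permutes {1..n}"
  by (rule wabs_permutes[OF inv_signed_perm])

lemma expo_permute: "a \<in> expo n \<Longrightarrow> \<pi> permutes {1..n} \<Longrightarrow> a \<circ> \<pi> \<in> expo n"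
  by (simp add: expo_def permutes_def)

lemma expo_deg_permute: "a \<in> expo_deg n k \<Longrightarrow> \<pi> permutes {1..n} \<Longrightarrow> a \<circ> \<pi> \<in> expo_deg n k"
  using sum.permute[of \<pi> "{1..n}" a] expo_permute by (auto simp: expo_deg_def)

lemma act_span_monomials:
  assumes w: "w \<in> signed_perms n" and A: "A \<subseteq> expo n"
    and closed: "\<And>a. a \<in> A \<Longrightarrow> a \<circ> wabs (inv w) \<in> A"
    and p: "(p :: 'a::field_char_0 mpoly) \<in> mp.span (X ` A)"
  shows "act w p \<in> mp.span (X ` A)"
  using p
proof (induction rule: mp.span_induct_alt)
  case (step c x y)
  then obtain a where a: "a \<in> A" "x = X a" by auto
  then have "act w x \<in> mp.span (X ` A)"
    unfolding a(2) act_X[OF w subsetD[OF A a(1)]] using closed[OF a(1)]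
    by (intro mp.span_scale mp.span_base imageI)
  then show ?case using step by (simp add: act_add act_scale mp.span_add mp.span_scale)
qed (simp add: mp.span_zero)

lemma act_polys: "w \<in> signed_perms n \<Longrightarrow> p \<in> polys n \<Longrightarrow> act w p \<in> polys n"
  unfolding polys_eq_span by (rule act_span_monomials) (auto intro: expo_permute wabs_inv_permutes)

lemma act_homogeneous:
  assumes w: "w \<in> signed_perms n" and p: "p \<in> homogeneous_polys n k"
  shows "act w p \<in> homogeneous_polys n k"
  using p unfolding homogeneous_polys_eq_span
proof (rule act_span_monomials[OF w, rotated 2])
  show "expo_deg n k \<subseteq> expo n" by (auto simp: expo_deg_def)
qed (rule expo_deg_permute[OF _ wabs_inv_permutes[OF w]])

lemma lookup_act:
  assumes w: "w \<in> signed_perms n" and p: "(p :: 'a::field_char_0 mpoly) \<in> polys n" and a: "a \<in> expo n"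
  shows "lookup (act w p) (mon (a \<circ> wabs (inv w))) =
    of_int (act_sign n w a) * lookup p (mon a)"
  using p unfolding polys_eq_span
proof (induction rule: mp.span_induct_alt)
  case (step c x y)
  then obtain b where b: "b \<in> expo n" "x = X b" by auto
  have perm: "a \<circ> wabs (inv w) \<in> expo n" "b \<circ> wabs (inv w) \<in> expo n"
    using a b expo_permute wabs_inv_permutes[OF w] by auto
  have "b \<circ> wabs (inv w) = a \<circ> wabs (inv w) \<longleftrightarrow> b = a"
    by (metis comp_assoc comp_id permutes_inv_o(1) wabs_inv_permutes[OF w])
  then have "lookup (act w x) (mon (a \<circ> wabs (inv w))) =
      of_int (act_sign n w a) * lookup x (mon a)"
    unfolding b(2) act_X[OF w b(1)] by (simp add: lookup_X[OF perm(2) perm(1)] lookup_X[OF b(1) a])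
  then show ?case
    using step by (simp add: act_add act_scale lookup_add distrib_left mult.left_commute comp_def)
qed simp

subsection \<open>The basis of products of orbit sums and descent monomials\<close>

text \<open>For even l this is a monomial symmetric polynomial in the squares of the variables,
  hence an invariant.\<close>

definition orbit_sum :: "nat \<Rightarrow> (nat \<Rightarrow> nat) \<Rightarrow> 'a::field_char_0 mpoly" where
  "orbit_sum n l = (\<Sum>b\<in>orbit_of n l. X b)"

definition basis_elem :: "nat \<Rightarrow> signed_perm \<times> (nat \<Rightarrow> nat) \<Rightarrow> 'a::field_char_0 mpoly" where
  "basis_elem n = (\<lambda>(w, l). orbit_sum n l * X (descent_expo n w))"

definition basis_index :: "nat \<Rightarrow> (signed_perm \<times> (nat \<Rightarrow> nat)) set" where
  "basis_index n = signed_perms n \<times> even_partitions n"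

definition lead :: "nat \<Rightarrow> signed_perm \<times> (nat \<Rightarrow> nat) \<Rightarrow> nat \<Rightarrow> nat" where
  "lead n = (\<lambda>(w, l). combine n w l)"

lemma orbit_of_expo: "l \<in> expo n \<Longrightarrow> b \<in> orbit_of n l \<Longrightarrow> b \<in> expo n"
  using expo_permute by (auto simp: orbit_of_def)

lemma orbit_of_refl: "l \<in> orbit_of n l"
  unfolding orbit_of_def using permutes_id[of "{1..n}"] by (intro CollectI exI[of _ id]) simp

lemma orbit_of_sym:
  assumes "b \<in> orbit_of n l"
  shows "l \<in> orbit_of n b"
proof -
  obtain \<pi> where \<pi>: "b = l \<circ> \<pi>" "\<pi> permutes {1..n}" using assms by (auto simp: orbit_of_def)
  then have "b \<circ> inv \<pi> = l" by (simp add: comp_assoc permutes_inv_o(1))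
  then show ?thesis using permutes_inv[OF \<pi>(2)] by (auto simp: orbit_of_def)
qed

lemma descent_expo_expo: "descent_expo n w \<in> expo n"
  by (simp add: expo_def descent_expo_def)

lemma basis_elem_eq_sum:
  assumes "l \<in> expo n"
  shows "basis_elem n (w, l) = (\<Sum>b\<in>orbit_of n l. X (\<lambda>j. descent_expo n w j + b j))"
  unfolding basis_elem_def orbit_sum_def sum_distrib_right prod.case
  by (intro sum.cong refl) (simp add: X_mult[OF orbit_of_expo[OF assms] descent_expo_expo] add.commute)

lemma lead_expo: "t \<in> basis_index n \<Longrightarrow> lead n t \<in> expo n"
  using combine_expo even_partitionsD(1) by (auto simp: basis_index_def lead_def)

lemma inj_on_lead: "inj_on (lead n) (basis_index n)"
proof (rule inj_onI)
  fix s t assume "s \<in> basis_index n" "t \<in> basis_index n" "lead n s = lead n t"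
  then show "s = t" unfolding basis_index_def lead_def
    by (cases s, cases t) (simp, metis combine_inject)
qed

lemma lead_surj:
  assumes "a \<in> expo n"
  shows "\<exists>t\<in>basis_index n. lead n t = a"
proof -
  obtain w l where "w \<in> signed_perms n" "l \<in> even_partitions n" "a = combine n w l"
    by (rule combine_surj[OF assms])
  then show ?thesis by (intro bexI[of _ "(w, l)"]) (auto simp: basis_index_def lead_def)
qed

text \<open>By \<open>psi_descent_orbit_less\<close> the orbit member
  \<open>l \<circ> wabs w\<close> gives the leading term; A holds the exponent vectors that come
  from the other members.\<close>

lemma basis_elem_lead:
  assumes t: "t \<in> basis_index n"
  obtains A where "finite A" "A \<subseteq> expo n" "\<And>a. a \<in> A \<Longrightarrow> psi n a < psi n (lead n t)"
    "\<And>a. a \<in> A \<Longrightarrow> (\<Sum>i=1..n. a i) = (\<Sum>i=1..n. lead n t i)"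
    "basis_elem n t = X (lead n t) + (\<Sum>a\<in>A. X a)"
proof -
  obtain w l where wl: "t = (w, l)" and w: "w \<in> signed_perms n" and l: "l \<in> even_partitions n"
    using t by (auto simp: basis_index_def)
  note l' = even_partitionsD[OF l]
  let ?c = "l \<circ> wabs w" and ?f = "\<lambda>b j. descent_expo n w j + b j"
  define A where "A = ?f ` (orbit_of n l - {?c})"
  have c: "?c \<in> orbit_of n l" using wabs_permutes[OF w] by (auto simp: orbit_of_def)
  have fc: "?f ?c = lead n t" by (auto simp: wl lead_def combine_def)
  have inj: "inj_on ?f S" for S by (auto simp: inj_on_def fun_eq_iff)
  show ?thesis
  proof
    show "finite A" by (simp add: A_def)
    show "A \<subseteq> expo n"
      using orbit_of_expo[OF l'(1)] expo_add[OF descent_expo_expo] by (auto simp: A_def)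
    show "psi n a < psi n (lead n t)" if "a \<in> A" for a
      using that psi_descent_orbit_less[OF w l'(3)] by (auto simp: A_def wl lead_def)
    show "(\<Sum>i=1..n. a i) = (\<Sum>i=1..n. lead n t i)" if aA: "a \<in> A" for a
    proof -
      obtain b where b: "b \<in> orbit_of n l" "a = ?f b" using aA unfolding A_def by blast
      then show ?thesis using sum_orbit_of[OF b(1), of "\<lambda>x. x"] sum_orbit_of[OF c, of "\<lambda>x. x"]
        by (simp add: sum.distrib flip: fc)
    qed
    have "basis_elem n t = X (?f ?c) + (\<Sum>b\<in>orbit_of n l - {?c}. X (?f b))"
      unfolding wl basis_elem_eq_sum[OF l'(1)] by (rule sum.remove[OF finite_orbit_of c])
    also have "(\<Sum>b\<in>orbit_of n l - {?c}. X (?f b)) = (\<Sum>a\<in>A. X a)"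
      unfolding A_def by (rule sum.reindex[OF inj, unfolded o_def, symmetric])
    finally show "basis_elem n t = X (lead n t) + (\<Sum>a\<in>A. X a)" unfolding fc .
  qed
qed

lemma lookup_basis_elem_lead:
  assumes t: "t \<in> basis_index n"
  shows "lookup (basis_elem n t :: 'a::field_char_0 mpoly) (mon (lead n t)) = 1"
proof -
  obtain A where A: "finite A" "A \<subseteq> expo n" "\<And>a. a \<in> A \<Longrightarrow> psi n a < psi n (lead n t)"
    "basis_elem n t = X (lead n t) + (\<Sum>a\<in>A. X a :: 'a mpoly)"
    using basis_elem_lead[OF t] by metis
  have "lookup (X a :: 'a mpoly) (mon (lead n t)) = 0" if "a \<in> A" for a
    using A(3)[OF that] subsetD[OF A(2) that] by (auto simp: lookup_X[OF _ lead_expo[OF t]])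
  then show ?thesis
    unfolding A(4) by (simp add: lookup_add lookup_sum lookup_X[OF lead_expo[OF t] lead_expo[OF t]])
qed

lemma lookup_basis_elem_nonzero:
  assumes t: "t \<in> basis_index n" and a: "a \<in> expo n"
    and nz: "lookup (basis_elem n t :: 'a::field_char_0 mpoly) (mon a) \<noteq> 0"
  shows "a = lead n t \<or> psi n a < psi n (lead n t)"
proof -
  obtain A where A: "finite A" "A \<subseteq> expo n" "\<And>a. a \<in> A \<Longrightarrow> psi n a < psi n (lead n t)"
    "basis_elem n t = X (lead n t) + (\<Sum>a\<in>A. X a :: 'a mpoly)"
    using basis_elem_lead[OF t] by metis
  show ?thesis
  proof (rule ccontr)
    assume *: "\<not> ?thesis"
    have "lookup (X b :: 'a mpoly) (mon a) = 0" if "b \<in> A" for b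
      using A(3)[OF that] subsetD[OF A(2) that] * by (auto simp: lookup_X[OF _ a])
    moreover have "lookup (X (lead n t) :: 'a mpoly) (mon a) = 0"
      using * by (auto simp: lookup_X[OF lead_expo[OF t] a])
    ultimately show False
      using nz unfolding A(4) by (simp add: lookup_add lookup_sum)
  qed
qed

lemma inj_on_basis_elem: "inj_on (basis_elem n :: _ \<Rightarrow> 'a::field_char_0 mpoly) (basis_index n)"
proof (rule inj_onI)
  fix s t assume s: "s \<in> basis_index n" and t: "t \<in> basis_index n"
    and eq: "(basis_elem n s :: 'a mpoly) = basis_elem n t"
  have "lead n s = lead n t \<or> psi n (lead n s) < psi n (lead n t)"
    using lookup_basis_elem_nonzero[OF t lead_expo[OF s], where ?'a = 'a] lookup_basis_elem_lead[OF s, where ?'a = 'a] eq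
    by simp
  moreover have "lead n t = lead n s \<or> psi n (lead n t) < psi n (lead n s)"
    using lookup_basis_elem_nonzero[OF s lead_expo[OF t], where ?'a = 'a] lookup_basis_elem_lead[OF t, where ?'a = 'a] eq
    by simp
  ultimately have "lead n s = lead n t" by auto
  then show "s = t" using inj_onD[OF inj_on_lead] s t by metis
qed

text \<open>Among the indices with nonzero coefficient take one whose leading exponent has maximal
  \<open>psi\<close>. Its leading monomial occurs in another basis element only if that element has
  a leading exponent of larger \<open>psi\<close>, so nothing can cancel it.\<close>

lemma independent_basis: "mp.independent (basis_elem n ` basis_index n :: 'a::field_char_0 mpoly set)"
proof
  assume "mp.dependent (basis_elem n ` basis_index n :: 'a mpoly set)"
  then obtain S u v where S: "finite S" "S \<subseteq> basis_elem n ` basis_index n"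
    "(\<Sum>v\<in>S. Const (u v) * v) = (0 :: 'a mpoly)" "v \<in> S" "u v \<noteq> 0"
    unfolding mp.dependent_explicit by blast
  obtain J where J: "J \<subseteq> basis_index n" "S = basis_elem n ` J"
    using S(2) by (auto simp: subset_image_iff)
  have inj: "inj_on (basis_elem n :: _ \<Rightarrow> 'a mpoly) J"
    using inj_on_subset[OF inj_on_basis_elem J(1)] .
  have "finite J" using S(1) J(2) inj finite_imageD by blast
  define K where "K = {t \<in> J. u (basis_elem n t) \<noteq> 0}"
  have K: "finite K" "K \<noteq> {}" using \<open>finite J\<close> S(4,5) J(2) by (auto simp: K_def)
  define M where "M = Max ((\<lambda>t. psi n (lead n t)) ` K)"
  have "M \<in> (\<lambda>t. psi n (lead n t)) ` K" unfolding M_def using K by (intro Max_in) auto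
  then obtain s where s: "s \<in> K" "psi n (lead n s) = M" by blast
  have le: "psi n (lead n t) \<le> psi n (lead n s)" if "t \<in> K" for t
    unfolding s(2) M_def using that K by (intro Max_ge) auto
  have sJ: "s \<in> J" "s \<in> basis_index n" using s J by (auto simp: K_def)
  have "0 = lookup (\<Sum>v\<in>S. Const (u v) * v) (mon (lead n s))" using S(3) by simp
  also have "\<dots> = (\<Sum>t\<in>J. u (basis_elem n t) * lookup (basis_elem n t) (mon (lead n s)))"
    unfolding J(2) lookup_sum lookup_Const_mult by (simp add: sum.reindex[OF inj])
  also have "\<dots> = (\<Sum>t\<in>J. if t = s then u (basis_elem n s) else 0)"
  proof (intro sum.cong refl)
    fix t assume t: "t \<in> J"
    show "u (basis_elem n t) * lookup (basis_elem n t) (mon (lead n s)) =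
        (if t = s then u (basis_elem n s) else 0)"
    proof (cases "t = s")
      case True
      then show ?thesis using lookup_basis_elem_lead[OF sJ(2), where ?'a = 'a] by simp
    next
      case False
      have "lookup (basis_elem n t :: 'a mpoly) (mon (lead n s)) = 0" if "t \<in> K"
      proof (rule ccontr)
        assume "lookup (basis_elem n t :: 'a mpoly) (mon (lead n s)) \<noteq> 0"
        then have "lead n s = lead n t \<or> psi n (lead n s) < psi n (lead n t)"
          using lookup_basis_elem_nonzero[OF subsetD[OF J(1) t] lead_expo[OF sJ(2)]] by blast
        then show False
          using le[OF that] False inj_onD[OF inj_on_lead, of n s t] sJ(2) subsetD[OF J(1) t] by auto
      qed
      then show ?thesis using False t by (auto simp: K_def)
    qed
  qed
  also have "\<dots> = u (basis_elem n s)" using \<open>finite J\<close> sJ by simp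
  finally show False
    using s by (simp add: K_def)
qed

section \<open>The basis in each degree\<close>

definition basis_index_deg :: "nat \<Rightarrow> nat \<Rightarrow> (signed_perm \<times> (nat \<Rightarrow> nat)) set" where
  "basis_index_deg n k = {t \<in> basis_index n. (\<Sum>i=1..n. lead n t i) = k}"

lemma bij_betw_lead: "bij_betw (lead n) (basis_index_deg n k) (expo_deg n k)"
proof -
  have "lead n ` basis_index_deg n k = expo_deg n k"
  proof (intro equalityI subsetI)
    fix a assume "a \<in> expo_deg n k"
    then show "a \<in> lead n ` basis_index_deg n k"
      using lead_surj[of a n] by (force simp: expo_deg_def basis_index_deg_def)
  qed (auto simp: expo_deg_def basis_index_deg_def lead_expo)
  moreover have "inj_on (lead n) (basis_index_deg n k)"
    by (rule inj_on_subset[OF inj_on_lead]) (auto simp: basis_index_deg_def)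
  ultimately show ?thesis by (simp add: bij_betw_def)
qed

lemma finite_basis_index_deg [simp]: "finite (basis_index_deg n k)"
  using bij_betw_finite[OF bij_betw_lead] by simp

text \<open>Solving for the leading term expresses X a by a basis element and monomials of the same
  degree with smaller \<open>psi\<close>.\<close>

lemma X_in_span_basis:
  "a \<in> expo_deg n k \<Longrightarrow> (X a :: 'a::field_char_0 mpoly) \<in> mp.span (basis_elem n ` basis_index_deg n k)"
proof (induction "nat (psi n a)" arbitrary: a rule: less_induct)
  case less
  have "a \<in> lead n ` basis_index_deg n k"
    unfolding bij_betw_imp_surj_on[OF bij_betw_lead] by (rule less.prems)
  then obtain t where t: "t \<in> basis_index_deg n k" "lead n t = a" by blast
  then have t': "t \<in> basis_index n" by (simp add: basis_index_deg_def)
  obtain A where A: "finite A" "A \<subseteq> expo n" "\<And>a. a \<in> A \<Longrightarrow> psi n a < psi n (lead n t)"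
    "\<And>a. a \<in> A \<Longrightarrow> (\<Sum>i=1..n. a i) = (\<Sum>i=1..n. lead n t i)"
    "(basis_elem n t :: 'a mpoly) = X (lead n t) + (\<Sum>a\<in>A. X a)"
    using basis_elem_lead[OF t'] by metis
  have "(X b :: 'a mpoly) \<in> mp.span (basis_elem n ` basis_index_deg n k)" if b: "b \<in> A" for b
  proof (rule less.hyps)
    show "nat (psi n b) < nat (psi n a)" using A(3)[OF b] t(2) psi_nonneg[of n b] by auto
    show "b \<in> expo_deg n k" using A(2) A(4)[OF b] b t less.prems by (auto simp: expo_deg_def)
  qed
  then have "(\<Sum>b\<in>A. X b :: 'a mpoly) \<in> mp.span (basis_elem n ` basis_index_deg n k)"
    by (rule mp.span_sum)
  moreover have "(basis_elem n t :: 'a mpoly) \<in> mp.span (basis_elem n ` basis_index_deg n k)"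
    using t by (intro mp.span_base imageI)
  moreover have "(X a :: 'a mpoly) = basis_elem n t - (\<Sum>b\<in>A. X b)" using A(5) t(2) by simp
  ultimately show ?case using mp.span_diff by metis
qed

lemma basis_elem_homogeneous:
  assumes "t \<in> basis_index_deg n k"
  shows "(basis_elem n t :: 'a::field_char_0 mpoly) \<in> homogeneous_polys n k"
proof -
  have t: "t \<in> basis_index n" "(\<Sum>i=1..n. lead n t i) = k"
    using assms by (auto simp: basis_index_deg_def)
  obtain A where A: "finite A" "A \<subseteq> expo n" "\<And>a. a \<in> A \<Longrightarrow> (\<Sum>i=1..n. a i) = (\<Sum>i=1..n. lead n t i)"
    "(basis_elem n t :: 'a mpoly) = X (lead n t) + (\<Sum>a\<in>A. X a)"
    using basis_elem_lead[OF t(1)] by metis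
  show ?thesis unfolding A(4) homogeneous_polys_eq_span using A(2,3) t lead_expo[OF t(1)]
    by (intro mp.span_add mp.span_sum mp.span_base imageI) (auto simp: expo_deg_def)
qed

lemma homogeneous_polys_eq_span_basis:
  "homogeneous_polys n k = (mp.span (basis_elem n ` basis_index_deg n k) :: 'a::field_char_0 mpoly set)"
proof
  show "homogeneous_polys n k \<subseteq> (mp.span (basis_elem n ` basis_index_deg n k) :: 'a mpoly set)"
    unfolding homogeneous_polys_eq_span
    by (intro mp.span_minimal mp.subspace_span image_subsetI X_in_span_basis)
  have "mp.subspace (homogeneous_polys n k :: 'a mpoly set)"
    unfolding homogeneous_polys_eq_span by (rule mp.subspace_span)
  then show "(mp.span (basis_elem n ` basis_index_deg n k) :: 'a mpoly set) \<subseteq> homogeneous_polys n k"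
    by (intro mp.span_minimal image_subsetI basis_elem_homogeneous)
qed

lemma polys_eq_span_basis: "polys n = (mp.span (basis_elem n ` basis_index n) :: 'a::field_char_0 mpoly set)"
proof
  show "polys n \<subseteq> (mp.span (basis_elem n ` basis_index n) :: 'a mpoly set)" unfolding polys_eq_span
  proof (intro mp.span_minimal mp.subspace_span image_subsetI)
    fix a assume "a \<in> expo n"
    then have "a \<in> expo_deg n (\<Sum>i=1..n. a i)" by (simp add: expo_deg_def)
    then have "(X a :: 'a mpoly) \<in> mp.span (basis_elem n ` basis_index_deg n (\<Sum>i=1..n. a i))"
      by (rule X_in_span_basis)
    moreover have "basis_index_deg n (\<Sum>i=1..n. a i) \<subseteq> basis_index n"
      by (auto simp: basis_index_deg_def)
    ultimately show "(X a :: 'a mpoly) \<in> mp.span (basis_elem n ` basis_index n)"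
      using mp.span_mono[OF image_mono] by blast
  qed
  have "(basis_elem n t :: 'a mpoly) \<in> polys n" if "t \<in> basis_index n" for t
  proof -
    have "(basis_elem n t :: 'a mpoly) \<in> homogeneous_polys n (\<Sum>i=1..n. lead n t i)"
      using that by (intro basis_elem_homogeneous) (simp add: basis_index_deg_def)
    then show ?thesis by (simp add: homogeneous_polys_def)
  qed
  then show "(mp.span (basis_elem n ` basis_index n) :: 'a mpoly set) \<subseteq> polys n"
    by (intro mp.span_minimal polys_subspace image_subsetI)
qed

subsection \<open>Invariants and the coinvariant ideal\<close>

lemma orbit_sum_polys: "l \<in> expo n \<Longrightarrow> orbit_sum n l \<in> polys n"
  unfolding orbit_sum_def by (blast intro: mp.subspace_sum[OF polys_subspace] X_in_polys orbit_of_expo)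

lemma act_sign_even:
  assumes "\<And>i. even (b i)" and "w \<in> signed_perms n"
  shows "act_sign n w (\<lambda>i. b i + a i) = act_sign n w a"
  unfolding act_sign_def
proof (intro prod.cong refl)
  fix i assume "i \<in> {1..n}"
  then have "w (int i) \<noteq> 0" using signed_perm_abs_range(1)[OF assms(2)] by simp
  then have "sgn (w (int i)) ^ b i = 1" using assms(1)[of i] by (auto simp: sgn_if elim!: evenE)
  then show "sgn (w (int i)) ^ (b i + a i) = sgn (w (int i)) ^ a i" by (simp add: power_add)
qed

lemma orbit_sum_reindex:
  assumes "\<pi> permutes {1..n}"
  shows "(\<Sum>b\<in>orbit_of n l. f (b \<circ> \<pi>)) = (\<Sum>b\<in>orbit_of n l. f b)"
proof (rule sum.reindex_bij_witness[where i = "\<lambda>b. b \<circ> inv \<pi>" and j = "\<lambda>b. b \<circ> \<pi>"])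
qed (auto simp: comp_assoc permutes_inv_o[OF assms] intro: orbit_of_compose assms permutes_inv)

text \<open>This is linearity of the action over the invariants. On monomials, the exponents of the
  first factor are even, so the sign comes from the second factor alone, and permuting variables
  permutes the orbit.\<close>

lemma act_orbit_sum_mult:
  assumes w: "w \<in> signed_perms n" and l: "l \<in> even_partitions n" and p: "(p :: 'a::field_char_0 mpoly) \<in> polys n"
  shows "act w (orbit_sum n l * p) = orbit_sum n l * act w p"
  using p unfolding polys_eq_span
proof (induction rule: mp.span_induct_alt)
  case (step c x y)
  then obtain a where a: "a \<in> expo n" "x = X a" by auto
  let ?u = "wabs (inv w)"
  note l' = even_partitionsD[OF l]
  have "act w (orbit_sum n l * x) = (\<Sum>b\<in>orbit_of n l. X (b \<circ> ?u) * act w x)"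
    unfolding orbit_sum_def sum_distrib_right act_sum
  proof (intro sum.cong refl)
    fix b assume b: "b \<in> orbit_of n l"
    have be: "b \<in> expo n" by (rule orbit_of_expo[OF l'(1) b])
    have even: "even (b i)" for i using b l'(2) by (auto simp: orbit_of_def)
    have "act w (X b * x) = Const (of_int (act_sign n w (\<lambda>i. b i + a i))) * X ((\<lambda>i. b i + a i) \<circ> ?u)"
      unfolding a(2) X_mult[OF be a(1)] act_X[OF w expo_add[OF be a(1)]] ..
    also have "X ((\<lambda>i. b i + a i) \<circ> ?u) = X (b \<circ> ?u) * (X (a \<circ> ?u) :: 'a mpoly)"
      using X_mult[OF expo_permute[OF be wabs_inv_permutes[OF w]] expo_permute[OF a(1) wabs_inv_permutes[OF w]], where ?'a = 'a]
      by (simp add: comp_def)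
    finally show "act w (X b * x) = X (b \<circ> ?u) * act w x"
      unfolding act_sign_even[OF even w] a(2) act_X[OF w a(1)] by (simp only: mult.left_commute)
  qed
  also have "\<dots> = orbit_sum n l * act w x"
    unfolding orbit_sum_def sum_distrib_right by (rule orbit_sum_reindex[OF wabs_inv_permutes[OF w]])
  finally have "act w (orbit_sum n l * x) = orbit_sum n l * act w x" .
  then show ?case using step by (simp add: act_add act_scale distrib_left mult.left_commute)
qed simp

lemma X_zero: "X (\<lambda>_. 0) = 1"
  by (simp add: X_def mon_def)

lemma orbit_sum_zero: "orbit_sum n (\<lambda>_. 0) = 1"
proof -
  have "orbit_of n (\<lambda>_. 0) = {\<lambda>_. 0}"
    using orbit_of_refl[of "\<lambda>_. 0" n] by (auto simp: orbit_of_def comp_def)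
  then show ?thesis by (simp add: orbit_sum_def X_zero)
qed

lemma zero_even_partition: "(\<lambda>_. 0) \<in> even_partitions n"
  by (simp add: even_partitions_def expo_def decreasing_on_def)

lemma one_polys: "1 \<in> polys n"
  using X_in_polys[of "\<lambda>_. 0" n] by (simp add: X_zero expo_def)

lemma act_one: "w \<in> signed_perms n \<Longrightarrow> act w (1 :: 'a::field_char_0 mpoly) = 1"
  using act_X[of w n "\<lambda>_. 0", where ?'a = 'a] by (simp add: X_zero expo_def act_sign_def comp_def)

lemma act_orbit_sum:
  assumes "w \<in> signed_perms n" "l \<in> even_partitions n"
  shows "act w (orbit_sum n l :: 'a::field_char_0 mpoly) = orbit_sum n l"
  using act_orbit_sum_mult[OF assms one_polys, where ?'a = 'a] act_one[OF assms(1), where ?'a = 'a] by simp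

lemma lookup_orbit_sum:
  assumes "l \<in> expo n" "a \<in> expo n"
  shows "lookup (orbit_sum n l :: 'a::field_char_0 mpoly) (mon a) = of_bool (a \<in> orbit_of n l)"
proof -
  have "lookup (orbit_sum n l :: 'a mpoly) (mon a) = (\<Sum>b\<in>orbit_of n l. if b = a then 1 else 0)"
    unfolding orbit_sum_def lookup_sum
    by (intro sum.cong refl) (simp add: lookup_X[OF orbit_of_expo[OF assms(1)] assms(2)])
  then show ?thesis by simp
qed

text \<open>The permutation comes from \<open>combine_surj\<close>: decreasing keys force weakly
  decreasing exponents.\<close>

lemma sorted_rearrangement:
  assumes a: "a \<in> expo n"
  obtains \<pi> where "\<pi> permutes {1..n}" "decreasing_on n (a \<circ> \<pi>)"
proof -
  obtain w l where w: "w \<in> signed_perms n" and l: "l \<in> even_partitions n" and eq: "a = combine n w l"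
    by (rule combine_surj[OF a])
  let ?u = "wabs (inv w)"
  have "a (?u j) \<le> a (?u i)" if "1 \<le> i" "i \<le> j" "j \<le> n" for i j
  proof -
    have mem: "?u i \<in> {1..n}" "?u j \<in> {1..n}" using wabs_mem[OF inv_signed_perm[OF w]] that by auto
    have "\<not> wabs w (?u j) < wabs w (?u i)" using that by (simp add: wabs_inv[OF w])
    then have "\<not> key n a (?u i) < key n a (?u j)"
      unfolding eq key_combine_mono[OF w even_partitionsD(3)[OF l] mem(2) mem(1)] .
    then show ?thesis using key_less_iff[OF mem(2) mem(1), of a] by auto
  qed
  then show ?thesis using that[OF wabs_inv_permutes[OF w]] by (simp add: decreasing_on_def)
qed

lemma signed_ext_perm:
  assumes \<pi>: "\<pi> permutes {1..n}"
  shows "signed_ext n (\<lambda>i. int (\<pi> i)) \<in> signed_perms n" (is "?w \<in> _")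
    and "act_sign n (signed_ext n (\<lambda>i. int (\<pi> i))) a = 1"
    and "wabs (inv (signed_ext n (\<lambda>i. int (\<pi> i)))) = inv \<pi>"
proof -
  show w: "?w \<in> signed_perms n" using permutes_imp_bij[OF \<pi>] by (intro signed_ext_signed_perm) simp
  have val: "?w (int i) = int (\<pi> i)" if "i \<in> {1..n}" for i using that by simp
  have "sgn (?w (int i)) = 1" if "i \<in> {1..n}" for i
  proof -
    have "\<pi> i \<in> {1..n}" using permutes_in_image[OF \<pi>] that by blast
    then show ?thesis unfolding val[OF that] by simp
  qed
  then show "act_sign n ?w a = 1"
    unfolding act_sign_def by (intro prod.neutral ballI) (simp only: power_one)
  have "wabs ?w i = \<pi> i" for i
    using val[of i] wabs_outside[OF w, of i] permutes_not_in[OF \<pi>, of i] by (cases "i \<in> {1..n}") (auto simp: wabs_def)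
  then have "wabs ?w = \<pi>" by (rule ext)
  then have "\<pi> \<circ> wabs (inv ?w) = id" using wabs_inv(2)[OF w] by (auto simp: fun_eq_iff)
  then show "wabs (inv ?w) = inv \<pi>" by (metis comp_assoc comp_id id_comp permutes_inv_o(2)[OF \<pi>])
qed

lemma signed_ext_flip:
  assumes k: "k \<in> {1..n}"
  shows "signed_ext n (\<lambda>i. if i = k then - int i else int i) \<in> signed_perms n" (is "?w \<in> _")
    and "act_sign n (signed_ext n (\<lambda>i. if i = k then - int i else int i)) a = (- 1) ^ a k"
    and "wabs (inv (signed_ext n (\<lambda>i. if i = k then - int i else int i))) = id"
proof -
  have "bij_betw (\<lambda>i. nat \<bar>if i = k then - int i else int i\<bar>) {1..n} {1..n}"
    by (rule bij_betw_cong[THEN iffD1, OF _ bij_betw_id]) auto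
  then show w: "?w \<in> signed_perms n" by (rule signed_ext_signed_perm)
  have "act_sign n ?w a = (\<Prod>i=1..n. if i = k then (- 1) ^ a k else 1)"
    unfolding act_sign_def by (intro prod.cong) (auto simp: sgn_if)
  then show "act_sign n ?w a = (- 1) ^ a k" using k by simp
  have "wabs ?w i = i" for i
    using wabs_outside[OF w, of i] by (cases "i \<in> {1..n}") (auto simp: wabs_def)
  then show "wabs (inv ?w) = id" using wabs_inv(2)[OF w] by (auto simp: fun_eq_iff)
qed

text \<open>Permuting variables makes the coefficients constant on orbits. Changing the sign of x_i
  shows that a coefficient with odd exponent at i is its own negative, hence zero in characteristic
  zero.\<close>

lemma lookup_invariant:
  assumes g: "(g :: 'a::field_char_0 mpoly) \<in> polys n" and inv: "\<forall>w\<in>signed_perms n. act w g = g" and a: "a \<in> expo n"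
  shows "\<pi> permutes {1..n} \<Longrightarrow> lookup g (mon (a \<circ> \<pi>)) = lookup g (mon a)"
    and "lookup g (mon a) \<noteq> 0 \<Longrightarrow> even (a i)"
proof -
  show "lookup g (mon (a \<circ> \<pi>)) = lookup g (mon a)" if \<pi>: "\<pi> permutes {1..n}"
    using lookup_act[OF signed_ext_perm(1)[OF permutes_inv[OF \<pi>]] g a]
      signed_ext_perm(1)[OF permutes_inv[OF \<pi>]] inv
    by (simp add: signed_ext_perm(2,3)[OF permutes_inv[OF \<pi>]] permutes_inv_inv[OF \<pi>])
  show "even (a i)" if nz: "lookup g (mon a) \<noteq> 0"
  proof (cases "i \<in> {1..n}")
    case True
    have "lookup g (mon a) = (- 1) ^ a i * lookup g (mon a)"
      using lookup_act[OF signed_ext_flip(1)[OF True] g a] signed_ext_flip(1)[OF True] inv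
      by (simp add: signed_ext_flip(2,3)[OF True])
    with nz show ?thesis by (cases "even (a i)") auto
  next
    case False
    then show ?thesis using a by (simp add: expo_def del: atLeastAtMost_iff)
  qed
qed

text \<open>Subtracting a multiple of the orbit sum of a sorted exponent vector removes a whole
  orbit of monomials and adds none, so the number of monomials falls. The generators are restricted
  to the l that occur in g so that a vanishing constant term excludes l = 0.\<close>

lemma invariant_in_span:
  assumes "(g :: 'a::field_char_0 mpoly) \<in> polys n" and "\<forall>w\<in>signed_perms n. act w g = g"
  shows "g \<in> mp.span (orbit_sum n ` {l \<in> even_partitions n. lookup g (mon l) \<noteq> 0})"
  using assms
proof (induction "card (keys g)" arbitrary: g rule: less_induct)
  case less
  note inv = lookup_invariant[OF less.prems]
  let ?L = "\<lambda>g :: 'a mpoly. {l \<in> even_partitions n. lookup g (mon l) \<noteq> 0}"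
  show ?case
  proof (cases "g = 0")
    case False
    then obtain m where m: "m \<in> keys g" by (metis all_not_in_conv keys_eq_empty)
    define a where "a = lookup m"
    have a: "a \<in> expo n" "mon a = m"
      using less.prems(1) m lookup_in_expo by (auto simp: polys_def a_def)
    have nz: "lookup g (mon a) \<noteq> 0" using m a by (simp add: in_keys_iff)
    obtain \<pi> where \<pi>: "\<pi> permutes {1..n}" "decreasing_on n (a \<circ> \<pi>)"
      by (rule sorted_rearrangement[OF a(1)])
    define l where "l = a \<circ> \<pi>"
    define c where "c = lookup g (mon l)"
    have c: "c \<noteq> 0" using inv(1)[OF a(1) \<pi>(1)] nz by (simp add: c_def l_def)
    have l: "l \<in> even_partitions n"
      using inv(2)[OF a(1) nz] expo_permute[OF a(1) \<pi>(1)] \<pi>(2) by (simp add: even_partitions_def l_def)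
    note l' = even_partitionsD(1)[OF l]
    define h where "h = g - Const c * orbit_sum n l"
    have hp: "h \<in> polys n" unfolding h_def using less.prems(1) orbit_sum_polys[OF l']
      by (intro mp.subspace_diff[OF polys_subspace] mp.subspace_scale[OF polys_subspace])
    have hi: "\<forall>w\<in>signed_perms n. act w h = h"
      using less.prems(2) by (simp add: h_def act_diff act_scale act_orbit_sum[OF _ l])
    have lookup_h: "lookup h (mon b) = (if b \<in> orbit_of n l then 0 else lookup g (mon b))"
      if b: "b \<in> expo n" for b
    proof (cases "b \<in> orbit_of n l")
      case True
      then obtain \<rho> where \<rho>: "b = l \<circ> \<rho>" "\<rho> permutes {1..n}" by (auto simp: orbit_of_def)
      then have "lookup g (mon b) = c" using inv(1)[OF l' \<rho>(2)] by (simp add: c_def)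
      then show ?thesis
        using True lookup_orbit_sum[OF l' b, where ?'a = 'a] by (simp add: h_def lookup_minus)
    next
      case False
      then show ?thesis
        using lookup_orbit_sum[OF l' b, where ?'a = 'a] by (simp add: h_def lookup_minus)
    qed
    have "keys h \<subset> keys g"
    proof (intro psubsetI subsetI notI)
      fix m' assume m': "m' \<in> keys h"
      then have "lookup m' \<in> expo n" using hp lookup_in_expo by (auto simp: polys_def)
      then show "m' \<in> keys g"
        using lookup_h[of "lookup m'"] m' by (auto simp: in_keys_iff split: if_splits)
    next
      assume "keys h = keys g"
      moreover have "mon l \<notin> keys h"
        using lookup_h[OF l'] orbit_of_refl[of l n] by (simp add: in_keys_iff)
      moreover have "mon l \<in> keys g" using c by (simp add: in_keys_iff c_def)
      ultimately show False
        by simp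
    qed
    then have "card (keys h) < card (keys g)" by (intro psubset_card_mono) auto
    then have "h \<in> mp.span (orbit_sum n ` ?L h)" using less.hyps hp hi by blast
    moreover have "?L h \<subseteq> ?L g" using lookup_h even_partitionsD(1) by (auto split: if_splits)
    ultimately have "h \<in> mp.span (orbit_sum n ` ?L g)" using mp.span_mono[OF image_mono] by blast
    moreover have "orbit_sum n l \<in> mp.span (orbit_sum n ` ?L g)"
      using l c by (intro mp.span_base imageI) (simp add: c_def)
    ultimately have "h + Const c * orbit_sum n l \<in> mp.span (orbit_sum n ` ?L g)"
      by (intro mp.span_add mp.span_scale)
    then show ?thesis by (simp add: h_def)
  qed (simp add: mp.span_zero)
qed

section \<open>Products of orbit sums and the coinvariant ideal\<close>

definition positive_partitions :: "nat \<Rightarrow> (nat \<Rightarrow> nat) set" where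
  "positive_partitions n = even_partitions n - {\<lambda>_. 0}"

text \<open>The product is again invariant. If l' is nonzero, all exponent vectors in the product
  are nonzero, so its constant term vanishes. One case of the \<open>if\<close> serves the ideal,
  both together serve freeness over the invariants.\<close>

lemma orbit_sum_mult_in_span:
  assumes l: "l \<in> even_partitions n" and l': "l' \<in> even_partitions n"
  shows "orbit_sum n l * orbit_sum n l' \<in>
    (mp.span (orbit_sum n ` (if l' = (\<lambda>_. 0) then even_partitions n else positive_partitions n)) :: 'a::field_char_0 mpoly set)"
proof -
  let ?g = "orbit_sum n l * orbit_sum n l' :: 'a mpoly"
  note le = even_partitionsD(1)[OF l] even_partitionsD(1)[OF l']
  have "?g \<in> polys n" by (intro polys_mult orbit_sum_polys le)
  moreover have "\<forall>w\<in>signed_perms n. act w ?g = ?g"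
    by (simp add: act_orbit_sum_mult[OF _ l orbit_sum_polys[OF le(2)]] act_orbit_sum[OF _ l'])
  ultimately have "?g \<in> mp.span (orbit_sum n ` {l \<in> even_partitions n. lookup ?g (mon l) \<noteq> 0})"
    by (rule invariant_in_span)
  moreover have "lookup ?g (mon (\<lambda>_. 0)) = 0" if nz: "l' \<noteq> (\<lambda>_. 0)"
  proof -
    have z: "(\<lambda>_. 0) \<in> expo n" by (simp add: expo_def)
    have "?g = (\<Sum>b\<in>orbit_of n l. \<Sum>b'\<in>orbit_of n l'. X (\<lambda>i. b i + b' i))"
      unfolding orbit_sum_def sum_product using X_mult[OF orbit_of_expo[OF le(1)] orbit_of_expo[OF le(2)]]
      by (intro sum.cong) auto
    moreover have "lookup (X (\<lambda>i. b i + b' i) :: 'a mpoly) (mon (\<lambda>_. 0)) = 0"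
      if b: "b \<in> orbit_of n l" "b' \<in> orbit_of n l'" for b b'
    proof -
      have "b' \<noteq> (\<lambda>_. 0)" using orbit_of_sym[OF b(2)] nz by (auto simp: orbit_of_def comp_def)
      then have "(\<lambda>i. b i + b' i) \<noteq> (\<lambda>_. 0)" by (auto simp: fun_eq_iff)
      then show ?thesis
        using lookup_X[OF expo_add[OF orbit_of_expo[OF le(1) b(1)] orbit_of_expo[OF le(2) b(2)]] z, where ?'a = 'a]
        by simp
    qed
    ultimately show ?thesis by (simp add: lookup_sum)
  qed
  then have "{l \<in> even_partitions n. lookup ?g (mon l) \<noteq> 0} \<subseteq>
      (if l' = (\<lambda>_. 0) then even_partitions n else positive_partitions n)"
    by (auto simp: positive_partitions_def)
  ultimately show ?thesis using mp.span_mono[OF image_mono] by blast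
qed

lemma span_mult_right:
  assumes "p \<in> mp.span S"
  shows "p * q \<in> mp.span ((\<lambda>x. x * q) ` S)"
  using assms
proof (induction rule: mp.span_induct_alt)
  case (step c x y)
  then have "x * q \<in> mp.span ((\<lambda>x. x * q) ` S)" by (intro mp.span_base imageI)
  then have "Const c * (x * q) + y * q \<in> mp.span ((\<lambda>x. x * q) ` S)"
    using step by (intro mp.span_add mp.span_scale)
  then show ?case by (simp add: algebra_simps)
qed (simp add: mp.span_zero)

lemma orbit_sum_in_invariants0:
  assumes "l \<in> positive_partitions n"
  shows "(orbit_sum n l :: 'a::field_char_0 mpoly) \<in> invariants0 n"
proof -
  have l: "l \<in> even_partitions n" "l \<noteq> (\<lambda>_. 0)" using assms by (auto simp: positive_partitions_def)
  have "(\<lambda>_. 0) \<notin> orbit_of n l"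
    using orbit_of_sym[of "\<lambda>_. 0" n l] l(2) by (auto simp: orbit_of_def comp_def)
  then have "lookup (orbit_sum n l :: 'a mpoly) (mon (\<lambda>_. 0)) = 0"
    using lookup_orbit_sum[OF even_partitionsD(1)[OF l(1)], of "\<lambda>_. 0", where ?'a = 'a] by (simp add: expo_def)
  then show ?thesis
    by (simp add: invariants0_def mon_def orbit_sum_polys[OF even_partitionsD(1)[OF l(1)]]
        act_orbit_sum[OF _ l(1)])
qed

lemma ideal_subspace: "mp.subspace (ideal_of n G)"
proof (rule mp.subspaceI)
  show "0 \<in> ideal_of n G" unfolding ideal_of_def by (intro CollectI exI[of _ "{}"]) auto
next
  fix p q assume "p \<in> ideal_of n G" "q \<in> ideal_of n G"
  then obtain A h A' h' where A: "finite A" "A \<subseteq> G" "\<forall>g\<in>A. h g \<in> polys n" "p = (\<Sum>g\<in>A. h g * g)"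
    and A': "finite A'" "A' \<subseteq> G" "\<forall>g\<in>A'. h' g \<in> polys n" "q = (\<Sum>g\<in>A'. h' g * g)"
    unfolding ideal_of_def by blast
  \<comment> \<open>Both families of coefficients are extended by 0 to the union, so that common
    generators receive the sum.\<close>
  let ?h = "\<lambda>g. (if g \<in> A then h g else 0) + (if g \<in> A' then h' g else 0)"
  have "p = (\<Sum>g\<in>A \<union> A'. (if g \<in> A then h g else 0) * g)"
    unfolding A(4) using A(1) A'(1) by (intro sum.mono_neutral_cong_left) auto
  moreover have "q = (\<Sum>g\<in>A \<union> A'. (if g \<in> A' then h' g else 0) * g)"
    unfolding A'(4) using A(1) A'(1) by (intro sum.mono_neutral_cong_left) auto
  ultimately have "p + q = (\<Sum>g\<in>A \<union> A'. ?h g * g)" by (simp add: distrib_right sum.distrib)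
  moreover have "?h g \<in> polys n" for g
    using A(3) A'(3) by (intro mp.subspace_add[OF polys_subspace]) (auto intro: mp.subspace_0[OF polys_subspace])
  ultimately show "p + q \<in> ideal_of n G"
    unfolding ideal_of_def using A(1,2) A'(1,2) by (intro CollectI exI[of _ "A \<union> A'"] exI[of _ ?h]) auto
next
  fix c p assume "p \<in> ideal_of n G"
  then obtain A h where A: "finite A" "A \<subseteq> G" "\<forall>g\<in>A. h g \<in> polys n" "p = (\<Sum>g\<in>A. h g * g)"
    unfolding ideal_of_def by blast
  have "Const c * p = (\<Sum>g\<in>A. (Const c * h g) * g)"
    unfolding A(4) by (simp add: sum_distrib_left mult.assoc)
  then show "Const c * p \<in> ideal_of n G" unfolding ideal_of_def using A(1-3)
    by (intro CollectI exI[of _ A] exI[of _ "\<lambda>g. Const c * h g"])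
       (auto intro: mp.subspace_scale[OF polys_subspace])
qed

lemma ideal_of_mult: "g \<in> G \<Longrightarrow> h \<in> polys n \<Longrightarrow> h * g \<in> ideal_of n G"
  unfolding ideal_of_def by (intro CollectI exI[of _ "{g}"] exI[of _ "\<lambda>_. h"]) auto

definition positive_basis :: "nat \<Rightarrow> 'a::field_char_0 mpoly set" where
  "positive_basis n = basis_elem n ` (signed_perms n \<times> positive_partitions n)"

lemma orbit_sum_times_X_in_span:
  assumes w: "w \<in> signed_perms n" and L: "L \<subseteq> even_partitions n"
    and g: "(g :: 'a::field_char_0 mpoly) \<in> mp.span (orbit_sum n ` L)"
  shows "g * X (descent_expo n w) \<in> mp.span (basis_elem n ` ({w} \<times> L))"
proof -
  have "(\<lambda>x. x * X (descent_expo n w)) ` orbit_sum n ` L = (basis_elem n ` ({w} \<times> L) :: 'a mpoly set)"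
    by (auto simp: basis_elem_def image_iff)
  then show ?thesis using span_mult_right[OF g, of "X (descent_expo n w)"] by simp
qed

text \<open>To expand a multiple of an invariant g without constant term, write the other factor in
  the basis. The orbit sum of l times g is again such an invariant, hence a combination of orbit
  sums with nonzero index, and the descent monomial is carried along unchanged.\<close>

lemma coinv_ideal_eq_span: "coinv_ideal n = (mp.span (positive_basis n) :: 'a::field_char_0 mpoly set)"
proof
  show "mp.span (positive_basis n) \<subseteq> (coinv_ideal n :: 'a mpoly set)" unfolding coinv_ideal_def
  proof (rule mp.span_minimal[OF _ ideal_subspace], rule subsetI)
    fix p :: "'a mpoly" assume "p \<in> positive_basis n"
    then obtain w l where "w \<in> signed_perms n" "l \<in> positive_partitions n" "p = X (descent_expo n w) * orbit_sum n l"
      by (auto simp: positive_basis_def basis_elem_def mult.commute)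
    then show "p \<in> ideal_of n (invariants0 n)"
      using ideal_of_mult[OF orbit_sum_in_invariants0 X_in_polys[OF descent_expo_expo]] by blast
  qed
next
  have prod: "h * g \<in> mp.span (positive_basis n)"
    if h: "h \<in> polys n" and g: "g \<in> invariants0 n" for h g :: "'a mpoly"
  proof -
    have g': "g \<in> mp.span (orbit_sum n ` positive_partitions n)"
    proof -
      have "g \<in> mp.span (orbit_sum n ` {l \<in> even_partitions n. lookup g (mon l) \<noteq> 0})"
        using g by (intro invariant_in_span) (auto simp: invariants0_def)
      moreover have "{l \<in> even_partitions n. lookup g (mon l) \<noteq> 0} \<subseteq> positive_partitions n"
        using g by (auto simp: invariants0_def positive_partitions_def mon_def)
      ultimately show ?thesis using mp.span_mono[OF image_mono] by blast
    qed
    have base: "orbit_sum n l * g \<in> mp.span (orbit_sum n ` positive_partitions n)" if l: "l \<in> even_partitions n" for l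
      using g'
    proof (induction rule: mp.span_induct_alt)
      case (step c x y)
      then obtain l' where l': "l' \<in> positive_partitions n" "x = orbit_sum n l'" by auto
      then have "orbit_sum n l * x \<in> mp.span (orbit_sum n ` positive_partitions n)"
        using orbit_sum_mult_in_span[OF l, of l', where ?'a = 'a] by (auto simp: positive_partitions_def)
      then have "Const c * (orbit_sum n l * x) + orbit_sum n l * y \<in> mp.span (orbit_sum n ` positive_partitions n)"
        using step by (intro mp.span_add mp.span_scale)
      then show ?case by (simp add: distrib_left mult.left_commute)
    qed (simp add: mp.span_zero)
    show ?thesis using h unfolding polys_eq_span_basis
    proof (induction rule: mp.span_induct_alt)
      case (step c x y)
      then obtain w l where wl: "w \<in> signed_perms n" "l \<in> even_partitions n" "x = orbit_sum n l * X (descent_expo n w)"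
        by (auto simp: basis_index_def basis_elem_def)
      have "(orbit_sum n l * g) * X (descent_expo n w) \<in> mp.span (basis_elem n ` ({w} \<times> positive_partitions n))"
        using orbit_sum_times_X_in_span[OF wl(1) _ base[OF wl(2)]] by (auto simp: positive_partitions_def)
      moreover have "basis_elem n ` ({w} \<times> positive_partitions n) \<subseteq> (positive_basis n :: 'a mpoly set)"
        unfolding positive_basis_def using wl(1) by (intro image_mono) auto
      ultimately have "(orbit_sum n l * g) * X (descent_expo n w) \<in> mp.span (positive_basis n)"
        using mp.span_mono by blast
      then have "Const c * ((orbit_sum n l * g) * X (descent_expo n w)) + y * g \<in> mp.span (positive_basis n)"
        using step by (intro mp.span_add mp.span_scale)
      then show ?case by (simp add: wl(3) algebra_simps)
    qed (simp add: mp.span_zero)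
  qed
  show "coinv_ideal n \<subseteq> (mp.span (positive_basis n) :: 'a mpoly set)"
  proof
    fix p :: "'a mpoly" assume "p \<in> coinv_ideal n"
    then obtain A h where A: "A \<subseteq> invariants0 n" "\<forall>g\<in>A. h g \<in> polys n" "p = (\<Sum>g\<in>A. h g * g)"
      unfolding coinv_ideal_def ideal_of_def by blast
    then show "p \<in> mp.span (positive_basis n)" using prod by (auto intro!: mp.span_sum)
  qed
qed

subsection \<open>Traces on quotients\<close>

definition quotient_coords :: "'a::field_char_0 mpoly set \<Rightarrow> 'a mpoly set \<Rightarrow> 'a mpoly \<Rightarrow> 'a mpoly \<Rightarrow> 'a" where
  "quotient_coords U B v = (THE c. coords_mod U B v c)"

lemma quotient_coords_eqI:
  assumes "basis_mod V U B" "v \<in> V" "coords_mod U B v c"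
  shows "quotient_coords U B v = c"
  unfolding quotient_coords_def using assms by (intro the1_equality) (auto simp: basis_mod_def)

lemma coords_mod_quotient_coords:
  assumes "basis_mod V U B" "v \<in> V"
  shows "coords_mod U B v (quotient_coords U B v)"
  using assms unfolding quotient_coords_def basis_mod_def by (metis theI')

lemma quotient_coords_cong:
  assumes B: "basis_mod V U B" and U: "mp.subspace U" and v: "v \<in> V" "v' \<in> V" and "v - v' \<in> U"
  shows "quotient_coords U B v = quotient_coords U B v'"
proof (rule quotient_coords_eqI[OF B v(1)])
  let ?c = "quotient_coords U B v'"
  have "coords_mod U B v' ?c" by (rule coords_mod_quotient_coords[OF B v(2)])
  moreover from this have "(v - v') + (v' - (\<Sum>b\<in>B. Const (?c b) * b)) \<in> U"
    using \<open>v - v' \<in> U\<close> by (intro mp.subspace_add[OF U]) (auto simp: coords_mod_def)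
  ultimately show "coords_mod U B v ?c" by (simp add: coords_mod_def)
qed

lemma quotient_coords_sum:
  assumes B: "basis_mod V U B" and U: "mp.subspace U" and V: "mp.subspace V"
    and f: "\<And>i. i \<in> I \<Longrightarrow> f i \<in> V"
  shows "quotient_coords U B (\<Sum>i\<in>I. Const (k i) * f i) b = (\<Sum>i\<in>I. k i * quotient_coords U B (f i) b)"
proof -
  let ?c = "\<lambda>b. \<Sum>i\<in>I. k i * quotient_coords U B (f i) b"
  have c: "coords_mod U B (f i) (quotient_coords U B (f i))" if "i \<in> I" for i
    by (rule coords_mod_quotient_coords[OF B f[OF that]])
  have "quotient_coords U B (\<Sum>i\<in>I. Const (k i) * f i) = ?c"
  proof (rule quotient_coords_eqI[OF B])
    show "(\<Sum>i\<in>I. Const (k i) * f i) \<in> V"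
      using f by (intro mp.subspace_sum[OF V] mp.subspace_scale[OF V])
    have "(\<Sum>i\<in>I. Const (k i) * (f i - (\<Sum>b\<in>B. Const (quotient_coords U B (f i) b) * b))) \<in> U"
      using c by (intro mp.subspace_sum[OF U] mp.subspace_scale[OF U]) (simp add: coords_mod_def)
    also have "(\<Sum>i\<in>I. Const (k i) * (f i - (\<Sum>b\<in>B. Const (quotient_coords U B (f i) b) * b))) =
        (\<Sum>i\<in>I. Const (k i) * f i) - (\<Sum>i\<in>I. \<Sum>b\<in>B. Const (k i * quotient_coords U B (f i) b) * b)"
      by (simp add: right_diff_distrib sum_subtractf sum_distrib_left Const_mult flip: mult.assoc)
    also have "(\<Sum>i\<in>I. \<Sum>b\<in>B. Const (k i * quotient_coords U B (f i) b) * b) = (\<Sum>b\<in>B. Const (?c b) * b)"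
      by (subst sum.swap) (simp add: mp.scale_sum_left)
    finally show "coords_mod U B (\<Sum>i\<in>I. Const (k i) * f i) ?c" using c by (simp add: coords_mod_def)
  qed
  then show ?thesis by simp
qed

text \<open>The identity tr(PQ) = tr(QP) for the transition coordinates: b is expanded in B', T is
  applied, the double sum is swapped, and the inner sum is reassembled into the coordinates of T b'
  in B'.\<close>

lemma trace_basis_independent:
  assumes B: "basis_mod V U B" and B': "basis_mod V U B'" and U: "mp.subspace U" and V: "mp.subspace V"
    and T: "\<And>p q. T (p - q) = T p - T q" "\<And>(f :: 'a::field_char_0 mpoly \<Rightarrow> 'a mpoly) A. T (sum f A) = (\<Sum>x\<in>A. T (f x))"
      "\<And>c p. T (Const c * p) = Const c * T p" "\<And>p. p \<in> V \<Longrightarrow> T p \<in> V" "\<And>p. p \<in> U \<Longrightarrow> T p \<in> U"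
  shows "(\<Sum>b\<in>B. quotient_coords U B (T b) b) = (\<Sum>b\<in>B'. quotient_coords U B' (T b) b)"
proof -
  let ?c = "quotient_coords U B" and ?c' = "quotient_coords U B'"
  have sub: "B \<subseteq> V" "B' \<subseteq> V" using B B' by (auto simp: basis_mod_def)
  have "?c (T b) b = (\<Sum>b'\<in>B'. ?c' b b' * ?c (T b') b)" if b: "b \<in> B" for b
  proof -
    let ?s = "\<Sum>b'\<in>B'. Const (?c' b b') * b'"
    have bV: "b \<in> V" using b sub by blast
    have "b - ?s \<in> U" using coords_mod_quotient_coords[OF B' bV] by (simp add: coords_mod_def)
    then have "T (b - ?s) \<in> U" by (rule T)
    also have "T (b - ?s) = T b - (\<Sum>b'\<in>B'. Const (?c' b b') * T b')" by (simp add: T)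
    finally have "?c (T b) = ?c (\<Sum>b'\<in>B'. Const (?c' b b') * T b')"
      using sub bV by (intro quotient_coords_cong[OF B U] T mp.subspace_sum[OF V] mp.subspace_scale[OF V]) auto
    then show ?thesis using quotient_coords_sum[OF B U V, of B' T "?c' b" b] T(4) sub by auto
  qed
  then have "(\<Sum>b\<in>B. ?c (T b) b) = (\<Sum>b'\<in>B'. \<Sum>b\<in>B. ?c (T b') b * ?c' b b')"
    by (simp add: sum.swap[of _ B' B] mult.commute)
  also have "\<dots> = (\<Sum>b'\<in>B'. ?c' (T b') b')"
  proof (intro sum.cong refl)
    fix b' assume "b' \<in> B'"
    then have Tb': "T b' \<in> V" using sub T(4) by blast
    let ?s = "\<Sum>b\<in>B. Const (?c (T b') b) * b"
    have "T b' - ?s \<in> U" using coords_mod_quotient_coords[OF B Tb'] by (simp add: coords_mod_def)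
    then have "?c' (T b') = ?c' ?s"
      using sub Tb' by (intro quotient_coords_cong[OF B' U] mp.subspace_sum[OF V] mp.subspace_scale[OF V]) auto
    then show "(\<Sum>b\<in>B. ?c (T b') b * ?c' b b') = ?c' (T b') b'"
      using quotient_coords_sum[where f = "\<lambda>b. b" and I = B and k = "?c (T b')" and b = b',
          OF B' U V subsetD[OF sub(1)]] by simp
  qed
  finally show ?thesis .
qed

lemma trace_mod_act:
  assumes B: "basis_mod V U B" and U: "mp.subspace U" and V: "mp.subspace V"
    and "\<And>p. p \<in> V \<Longrightarrow> act w p \<in> V" "\<And>p. p \<in> U \<Longrightarrow> act w p \<in> U"
  shows "trace_mod V U (act w) = (\<Sum>b\<in>B. quotient_coords U B (act w b) b)"
proof -
  define B' where "B' = (SOME B. basis_mod V U B)"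
  have B': "basis_mod V U B'" unfolding B'_def using B by (rule someI)
  have "trace_mod V U (act w) = (\<Sum>b\<in>B'. quotient_coords U B' (act w b) b)"
    by (simp add: trace_mod_def quotient_coords_def B'_def Let_def)
  also have "\<dots> = (\<Sum>b\<in>B. quotient_coords U B (act w b) b)"
    by (rule trace_basis_independent[OF B' B U V]) (simp_all add: act_diff act_sum act_scale assms)
  finally show ?thesis .
qed

lemma representation_span_disjoint:
  assumes "mp.independent S" "N \<subseteq> S" "u \<in> mp.span N" "b \<notin> N"
  shows "mp.representation S u b = 0"
  using mp.representation_extend[OF assms(1,3,2)] mp.representation_ne_zero[of N u b] assms(4) by metis

text \<open>Coordinates modulo the span of N are the coordinates in S with those at N dropped. N may
  leave V: the basis of the coinvariant ideal has elements in degrees other than that of the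
  component considered.\<close>

lemma basis_mod_span:
  assumes S: "mp.independent S" and fin: "finite B" and sub: "B \<subseteq> S" "N \<subseteq> S" and disj: "B \<inter> N = {}"
    and V: "V \<subseteq> mp.span (B \<union> N)" "B \<subseteq> V"
  shows "basis_mod V (mp.span N) B"
    and "\<And>v. v \<in> V \<Longrightarrow> quotient_coords (mp.span N) B v = (\<lambda>b. if b \<in> B then mp.representation S v b else 0)"
proof -
  let ?U = "mp.span N" and ?r = "\<lambda>v b. if b \<in> B then mp.representation S v b else 0"
  have ex: "coords_mod ?U B v (?r v)" if v: "v \<in> V" for v
  proof -
    have vs: "v \<in> mp.span (B \<union> N)" "v \<in> mp.span S"
      using v V(1) sub mp.span_mono[of "B \<union> N" S] by blast+
    let ?R = "mp.representation S v" and ?K = "{b. mp.representation S v b \<noteq> 0}"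
    have K: "finite ?K" "?K \<subseteq> B \<union> N"
      using mp.finite_representation representation_span_disjoint[OF S _ vs(1)] sub by blast+
    have "v = (\<Sum>b\<in>?K. Const (?R b) * b)" using mp.sum_nonzero_representation_eq[OF S vs(2)] by simp
    also have "\<dots> = (\<Sum>b\<in>?K \<union> B. Const (?R b) * b)" using K fin by (intro sum.mono_neutral_left) auto
    also have "\<dots> = (\<Sum>b\<in>?K - B. Const (?R b) * b) + (\<Sum>b\<in>B. Const (?R b) * b)"
      using K fin by (subst sum.union_disjoint[symmetric]) (auto intro!: sum.cong)
    finally have "v - (\<Sum>b\<in>B. Const (?R b) * b) = (\<Sum>b\<in>?K - B. Const (?R b) * b)"
      unfolding diff_eq_eq .
    also have "\<dots> \<in> ?U" using K(2) by (intro mp.span_sum mp.span_scale mp.span_base) auto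
    finally have "v - (\<Sum>b\<in>B. Const (?r v b) * b) \<in> ?U" by (simp cong: sum.cong)
    then show ?thesis by (simp add: coords_mod_def)
  qed
  have unique: "c = ?r v" if v: "v \<in> V" and c: "coords_mod ?U B v c" for v c
  proof
    fix b
    show "c b = ?r v b"
    proof (cases "b \<in> B")
      case True
      have vs: "v \<in> mp.span S" using v V(1) sub mp.span_mono[of "B \<union> N" S] by blast
      have Bs: "x \<in> mp.span S" if "x \<in> B" for x using that sub by (intro mp.span_base) auto
      have "mp.representation S (v - (\<Sum>x\<in>B. Const (c x) * x)) b = 0"
        using c True disj by (intro representation_span_disjoint[OF S sub(2)]) (auto simp: coords_mod_def)
      also have "mp.representation S (v - (\<Sum>x\<in>B. Const (c x) * x)) b =
          mp.representation S v b - (\<Sum>x\<in>B. mp.representation S (Const (c x) * x) b)"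
        using Bs by (subst mp.representation_diff[OF S _ vs])
          (auto intro!: mp.span_sum mp.span_scale simp: mp.representation_sum[OF S] mp.span_scale)
      also have "(\<Sum>x\<in>B. mp.representation S (Const (c x) * x) b) = (\<Sum>x\<in>B. if x = b then c b else 0)"
        using Bs sub by (intro sum.cong refl) (auto simp: mp.representation_scale[OF S] mp.representation_basis[OF S subsetD])
      also have "\<dots> = c b" using True fin by simp
      finally show ?thesis using True by simp
    next
      case False
      then show ?thesis using c by (simp add: coords_mod_def)
    qed
  qed
  show bm: "basis_mod V ?U B" unfolding basis_mod_def using fin V(2) ex unique by blast
  show "quotient_coords ?U B v = ?r v" if "v \<in> V" for v
    by (rule quotient_coords_eqI[OF bm that ex[OF that]])
qed

lemma inj_on_X: "inj_on (X :: _ \<Rightarrow> 'a::field_char_0 mpoly) (expo n)"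
  by (rule inj_onI) (metis keys_X mon_inject singleton_inject)

lemma independent_monomials: "mp.independent (X ` expo n :: 'a::field_char_0 mpoly set)"
proof
  assume "mp.dependent (X ` expo n :: 'a mpoly set)"
  then obtain S u v where S: "finite S" "S \<subseteq> X ` expo n"
    "(\<Sum>v\<in>S. Const (u v) * v) = (0 :: 'a mpoly)" "v \<in> S" "u v \<noteq> 0"
    unfolding mp.dependent_explicit by blast
  obtain a where a: "a \<in> expo n" "v = X a" using S(2,4) by blast
  have "0 = lookup (\<Sum>v\<in>S. Const (u v) * v) (mon a)" using S(3) by simp
  also have "\<dots> = (\<Sum>x\<in>S. if x = v then u v else 0)" unfolding lookup_sum lookup_Const_mult
  proof (intro sum.cong refl)
    fix x assume "x \<in> S"
    then obtain b where b: "b \<in> expo n" "x = X b" using S(2) by blast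
    have "(X b :: 'a mpoly) = X a \<Longrightarrow> b = a" by (rule inj_onD[OF inj_on_X _ b(1) a(1)])
    then show "u x * lookup x (mon a) = (if x = v then u v else 0)"
      using a b by (auto simp: lookup_X[OF b(1) a(1)])
  qed
  also have "\<dots> = u v" using S(1,4) by simp
  finally show False
    using S(5) by simp
qed

lemma homogeneous_subspace: "mp.subspace (homogeneous_polys n k)"
  unfolding homogeneous_polys_eq_span by (rule mp.subspace_span)

text \<open>The action permutes monomials up to sign, so only fixed exponent vectors meet the
  diagonal. The quotient by {0} expresses the trace on polynomials in the same formalism as that on
  coinvariants.\<close>

lemma trace_polys_monomials:
  assumes w: "w \<in> signed_perms n"
  shows "trace_mod (homogeneous_polys n k) {0} (act w :: 'a::field_char_0 mpoly \<Rightarrow> _) =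
    of_int (\<Sum>a | a \<in> expo_deg n k \<and> a \<circ> wabs (inv w) = a. act_sign n w a)"
proof -
  let ?B = "X ` expo_deg n k :: 'a mpoly set" and ?S = "X ` expo n :: 'a mpoly set"
  have sub: "expo_deg n k \<subseteq> expo n" by (auto simp: expo_deg_def)
  have V: "homogeneous_polys n k \<subseteq> mp.span (?B \<union> {})" "?B \<subseteq> homogeneous_polys n k"
    unfolding homogeneous_polys_eq_span by (auto intro: mp.span_base)
  have fin: "finite ?B" and disj: "?B \<inter> {} = {}" by simp_all
  note bm = basis_mod_span[OF independent_monomials fin image_mono[OF sub] empty_subsetI disj V, unfolded mp.span_empty]
  have "trace_mod (homogeneous_polys n k) {0} (act w :: 'a mpoly \<Rightarrow> _) =
      (\<Sum>b\<in>?B. quotient_coords {0} ?B (act w b) b)"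
    using bm(1) by (intro trace_mod_act) (auto simp: homogeneous_subspace act_homogeneous[OF w])
  also have "\<dots> = (\<Sum>b\<in>?B. mp.representation ?S (act w b) b)"
    using bm(2)[OF act_homogeneous[OF w subsetD[OF V(2)]]] by (intro sum.cong refl) simp
  also have "\<dots> = (\<Sum>a\<in>expo_deg n k. mp.representation ?S (act w (X a)) (X a))"
    by (simp add: sum.reindex[OF inj_on_subset[OF inj_on_X sub]])
  also have "\<dots> = (\<Sum>a\<in>expo_deg n k. if a \<circ> wabs (inv w) = a then of_int (act_sign n w a) else 0)"
  proof (intro sum.cong refl)
    fix a assume "a \<in> expo_deg n k"
    then have a: "a \<in> expo n" "a \<circ> wabs (inv w) \<in> expo n"
      using sub expo_permute wabs_inv_permutes[OF w] by blast+
    have "(X a :: 'a mpoly) = X (a \<circ> wabs (inv w)) \<longleftrightarrow> a \<circ> wabs (inv w) = a"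
      using inj_onD[OF inj_on_X _ a] by metis
    moreover have "(X (a \<circ> wabs (inv w)) :: 'a mpoly) \<in> ?S" using a by blast
    ultimately show "mp.representation ?S (act w (X a)) (X a) =
        (if a \<circ> wabs (inv w) = a then of_int (act_sign n w a) else 0)"
      unfolding act_X[OF w a(1)]
      by (simp add: mp.representation_scale[OF independent_monomials] mp.span_base
          mp.representation_basis[OF independent_monomials])
  qed
  also have "\<dots> = (\<Sum>a | a \<in> expo_deg n k \<and> a \<circ> wabs (inv w) = a. of_int (act_sign n w a))"
    by (simp add: sum.inter_filter)
  finally show ?thesis by simp
qed

section \<open>The action in the basis of orbit sums times descent monomials\<close>

lemma basis_elem_zero: "basis_elem n (w, \<lambda>_. 0) = X (descent_expo n w)"
  by (simp add: basis_elem_def orbit_sum_zero)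

lemma sum_lead:
  assumes "w \<in> signed_perms n"
  shows "(\<Sum>i=1..n. lead n (w, l) i) = fmaj n (inv w) + (\<Sum>i=1..n. l i)"
proof -
  have "(\<Sum>i=1..n. l (wabs w i)) = (\<Sum>i=1..n. l i)"
    using sum.permute[OF wabs_permutes[OF assms], of l] by (simp add: o_def)
  then show ?thesis using sum_descent_expo[OF assms] by (simp add: lead_def combine_def sum.distrib)
qed

text \<open>The diagonal matrix entry at the descent monomial of v. These entries make up the trace
  on coinvariants, and each recurs with every l in the trace on polynomials.\<close>

definition diag_coeff :: "nat \<Rightarrow> signed_perm \<Rightarrow> signed_perm \<Rightarrow> 'a::field_char_0" where
  "diag_coeff n w v = mp.representation (basis_elem n ` basis_index n)
     (act w (X (descent_expo n v))) (X (descent_expo n v))"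

text \<open>
  The coefficient of \<open>orbit_sum n l * X d\<close> in \<open>orbit_sum n l * q\<close>, where \<open>q\<close> has the degree of
  \<open>X d\<close>: multiplying by invariants does not mix descent monomials, and for degree reasons only the
  scalar coefficient of \<open>X d\<close> in \<open>q\<close> contributes.
\<close>

lemma representation_act_basis_elem:
  assumes w: "w \<in> signed_perms n" and v: "v \<in> signed_perms n" and l: "l \<in> even_partitions n"
  shows "mp.representation (basis_elem n ` basis_index n) (act w (basis_elem n (v, l))) (basis_elem n (v, l)) =
    (diag_coeff n w v :: 'a::field_char_0)"
proof -
  let ?S = "basis_elem n ` basis_index n :: 'a mpoly set" and ?j = "fmaj n (inv v)"
  let ?I = "basis_index_deg n ?j" and ?z = "\<lambda>_. 0 :: nat"
  let ?q = "act w (X (descent_expo n v)) :: 'a mpoly" and ?b = "basis_elem n (v, l) :: 'a mpoly"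
  note S = independent_basis[of n, where ?'a = 'a]
  have vl: "(v, l) \<in> basis_index n" and vz: "(v, ?z) \<in> ?I"
    using v l sum_lead[OF v, of ?z] by (auto simp: basis_index_def basis_index_deg_def zero_even_partition)
  have Isub: "?I \<subseteq> basis_index n" by (auto simp: basis_index_deg_def)
  have inj: "inj_on (basis_elem n :: _ \<Rightarrow> 'a mpoly) ?I"
    by (rule inj_on_subset[OF inj_on_basis_elem Isub])
  have Ssub: "basis_elem n ` ?I \<subseteq> ?S" using Isub by blast
  have ind: "mp.independent (basis_elem n ` ?I :: 'a mpoly set)"
    using S Ssub mp.independent_mono by blast
  have "(X (descent_expo n v) :: 'a mpoly) \<in> homogeneous_polys n ?j"
    using basis_elem_homogeneous[OF vz, where ?'a = 'a] by (simp add: basis_elem_zero)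
  then have q: "?q \<in> mp.span (basis_elem n ` ?I)"
    using act_homogeneous[OF w] unfolding homogeneous_polys_eq_span_basis by blast
  let ?R = "mp.representation ?S ?q"
  have "mp.representation (basis_elem n ` ?I) ?q = ?R"
    using mp.representation_extend[OF S q Ssub] by simp
  then have "?q = (\<Sum>b\<in>basis_elem n ` ?I. Const (?R b) * b)"
    using mp.sum_representation_eq[OF ind q, of "basis_elem n ` ?I"] by simp
  also have "\<dots> = (\<Sum>t\<in>?I. Const (?R (basis_elem n t)) * basis_elem n t)"
    by (simp add: sum.reindex[OF inj])
  finally have q_eq: "?q = (\<Sum>t\<in>?I. Const (?R (basis_elem n t)) * basis_elem n t)" .
  have product: "orbit_sum n l * basis_elem n t \<in> mp.span ?S \<and>
      mp.representation ?S (orbit_sum n l * basis_elem n t) ?b = (if t = (v, ?z) then 1 else 0)"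
    if t: "t \<in> ?I" for t
  proof -
    obtain v' l' where t': "t = (v', l')" "v' \<in> signed_perms n" "l' \<in> even_partitions n"
      using t by (auto simp: basis_index_deg_def basis_index_def)
    let ?N = "basis_elem n ` ({v'} \<times> even_partitions n) :: 'a mpoly set"
    have "orbit_sum n l * orbit_sum n l' \<in> (mp.span (orbit_sum n ` even_partitions n) :: 'a mpoly set)"
    proof -
      have "(if l' = ?z then even_partitions n else positive_partitions n) \<subseteq> even_partitions n"
        by (auto simp: positive_partitions_def)
      then show ?thesis
        using orbit_sum_mult_in_span[OF l t'(3), where ?'a = 'a] mp.span_mono[OF image_mono] by blast
    qed
    then have "(orbit_sum n l * orbit_sum n l') * X (descent_expo n v') \<in> mp.span ?N"
      by (intro orbit_sum_times_X_in_span[OF t'(2)]) auto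
    then have in_N: "orbit_sum n l * basis_elem n t \<in> mp.span ?N"
      by (simp add: t' basis_elem_def mult.assoc)
    have NS: "?N \<subseteq> ?S" using t'(2) by (auto simp: basis_index_def)
    show ?thesis
    proof (cases "v' = v")
      case True
      \<comment> \<open>Since t has the degree of the descent monomial of v itself, nothing is left
        for l'.\<close>
      then have "(\<Sum>i=1..n. l' i) = 0"
        using t t' sum_lead[OF v, of l'] by (simp add: basis_index_deg_def)
      then have "l' i = 0" for i
        using even_partitionsD(1)[OF t'(3)] by (cases "i \<in> {1..n}") (auto simp: expo_def)
      then have tz: "t = (v, ?z)" using t' True by auto
      then have "orbit_sum n l * basis_elem n t = ?b" by (simp add: basis_elem_def orbit_sum_zero)
      then show ?thesis using tz vl mp.representation_basis[OF S, of ?b] by (simp add: mp.span_base)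
    next
      case False
      have "?b \<notin> ?N"
      proof
        assume "?b \<in> ?N"
        then obtain l'' where "l'' \<in> even_partitions n" "?b = basis_elem n (v', l'')" by auto
        moreover from this have "(v', l'') \<in> basis_index n"
          using t'(2) by (simp add: basis_index_def)
        ultimately have "(v, l) = (v', l'')" using inj_onD[OF inj_on_basis_elem] vl by metis
        with False show False
          by simp
      qed
      then show ?thesis
        using False t' representation_span_disjoint[OF S NS in_N] in_N mp.span_mono[OF NS] by auto
    qed
  qed
  have "act w ?b = orbit_sum n l * ?q" unfolding basis_elem_def prod.case
    by (rule act_orbit_sum_mult[OF w l X_in_polys[OF descent_expo_expo]])
  also have "\<dots> = (\<Sum>t\<in>?I. Const (?R (basis_elem n t)) * (orbit_sum n l * basis_elem n t))"
    by (subst q_eq) (simp add: sum_distrib_left mult.left_commute)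
  finally have "mp.representation ?S (act w ?b) ?b =
      (\<Sum>t\<in>?I. mp.representation ?S (Const (?R (basis_elem n t)) * (orbit_sum n l * basis_elem n t)) ?b)"
    using product by (simp add: mp.representation_sum[OF S] mp.span_scale)
  also have "\<dots> = (\<Sum>t\<in>?I. if t = (v, ?z) then ?R (basis_elem n (v, ?z)) else 0)"
    using product by (intro sum.cong refl) (auto simp: mp.representation_scale[OF S])
  also have "\<dots> = ?R (basis_elem n (v, ?z))" using vz by simp
  finally show ?thesis by (simp add: diag_coeff_def basis_elem_zero)
qed

lemma trace_polys_basis:
  assumes w: "w \<in> signed_perms n"
  shows "trace_mod (homogeneous_polys n k) {0} (act w :: 'a::field_char_0 mpoly \<Rightarrow> _) =
    (\<Sum>t\<in>basis_index_deg n k. diag_coeff n w (fst t))"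
proof -
  let ?I = "basis_index_deg n k"
  let ?B = "basis_elem n ` ?I :: 'a mpoly set" and ?S = "basis_elem n ` basis_index n :: 'a mpoly set"
  have sub: "?I \<subseteq> basis_index n" by (auto simp: basis_index_deg_def)
  have V: "homogeneous_polys n k \<subseteq> mp.span (?B \<union> {})" "?B \<subseteq> homogeneous_polys n k"
    unfolding homogeneous_polys_eq_span_basis by (auto intro: mp.span_base)
  have fin: "finite ?B" and disj: "?B \<inter> {} = {}" by simp_all
  note bm = basis_mod_span[OF independent_basis fin image_mono[OF sub] empty_subsetI disj V, unfolded mp.span_empty]
  have "trace_mod (homogeneous_polys n k) {0} (act w :: 'a mpoly \<Rightarrow> _) =
      (\<Sum>b\<in>?B. quotient_coords {0} ?B (act w b) b)"
    using bm(1) by (intro trace_mod_act) (auto simp: homogeneous_subspace act_homogeneous[OF w])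
  also have "\<dots> = (\<Sum>b\<in>?B. mp.representation ?S (act w b) b)"
    using bm(2)[OF act_homogeneous[OF w subsetD[OF V(2)]]] by (intro sum.cong refl) simp
  also have "\<dots> = (\<Sum>t\<in>?I. mp.representation ?S (act w (basis_elem n t)) (basis_elem n t))"
    by (simp add: sum.reindex[OF inj_on_subset[OF inj_on_basis_elem sub]])
  also have "\<dots> = (\<Sum>t\<in>?I. diag_coeff n w (fst t))"
    using representation_act_basis_elem[OF w, where ?'a = 'a]
    by (intro sum.cong refl) (auto simp: basis_index_deg_def basis_index_def)
  finally show ?thesis .
qed

lemma act_coinv_ideal:
  assumes w: "w \<in> signed_perms n" and p: "(p :: 'a::field_char_0 mpoly) \<in> coinv_ideal n"
  shows "act w p \<in> coinv_ideal n"
  using p unfolding coinv_ideal_eq_span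
proof (induction rule: mp.span_induct_alt)
  case (step c x y)
  then obtain v l where vl: "v \<in> signed_perms n" "l \<in> positive_partitions n"
    "x = orbit_sum n l * X (descent_expo n v)"
    by (auto simp: positive_basis_def basis_elem_def)
  have "act w x = act w (X (descent_expo n v)) * orbit_sum n l" unfolding vl(3) using vl(2)
    by (subst act_orbit_sum_mult[OF w _ X_in_polys[OF descent_expo_expo]])
       (auto simp: positive_partitions_def mult.commute)
  also have "\<dots> \<in> coinv_ideal n" unfolding coinv_ideal_def
    by (rule ideal_of_mult[OF orbit_sum_in_invariants0[OF vl(2)] act_polys[OF w X_in_polys[OF descent_expo_expo]]])
  finally have "act w x \<in> mp.span (positive_basis n)" by (simp add: coinv_ideal_eq_span)
  then show ?case using step by (simp add: act_add act_scale mp.span_add mp.span_scale)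
qed (simp add: mp.span_zero)

text \<open>With S the whole basis and N its elements with nonzero l, \<open>basis_mod_span\<close>
  yields the descent monomials of degree k as a basis of the quotient.\<close>

lemma coinv_char_eq:
  assumes w: "w \<in> signed_perms n"
  shows "(coinv_char n k w :: 'a::field_char_0) =
    (\<Sum>v | v \<in> signed_perms n \<and> fmaj n (inv v) = k. diag_coeff n w v)"
proof -
  let ?W = "{v \<in> signed_perms n. fmaj n (inv v) = k}" and ?z = "\<lambda>_. 0 :: nat"
  let ?J = "(\<lambda>v. (v, ?z)) ` ?W"
  let ?B = "basis_elem n ` ?J :: 'a mpoly set" and ?S = "basis_elem n ` basis_index n :: 'a mpoly set"
  have J: "?J \<subseteq> basis_index_deg n k"
    using sum_lead[of _ n ?z] by (auto simp: basis_index_deg_def basis_index_def zero_even_partition)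
  then have J': "?J \<subseteq> basis_index n" by (auto simp: basis_index_deg_def)
  have P: "signed_perms n \<times> positive_partitions n \<subseteq> basis_index n"
    by (auto simp: basis_index_def positive_partitions_def)
  have disj: "?B \<inter> positive_basis n = {}"
  proof -
    have "?J \<inter> (signed_perms n \<times> positive_partitions n) = {}"
      by (auto simp: positive_partitions_def)
    then show ?thesis
      unfolding positive_basis_def using inj_on_image_Int[OF inj_on_basis_elem J' P, where ?'a1 = 'a] by simp
  qed
  have V: "homogeneous_polys n k \<subseteq> mp.span (?B \<union> positive_basis n)" "?B \<subseteq> homogeneous_polys n k"
  proof -
    have "basis_index_deg n k \<subseteq> ?J \<union> (signed_perms n \<times> positive_partitions n)"
    proof
      fix t assume t: "t \<in> basis_index_deg n k"
      then obtain v l where vl: "t = (v, l)" "v \<in> signed_perms n" "l \<in> even_partitions n"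
        by (auto simp: basis_index_deg_def basis_index_def)
      show "t \<in> ?J \<union> (signed_perms n \<times> positive_partitions n)"
      proof (cases "l = ?z")
        case True
        then show ?thesis using t vl sum_lead[OF vl(2), of l] by (auto simp: basis_index_deg_def)
      next
        case False
        then show ?thesis using vl by (auto simp: positive_partitions_def)
      qed
    qed
    then have "(basis_elem n ` basis_index_deg n k :: 'a mpoly set) \<subseteq> ?B \<union> positive_basis n"
      unfolding positive_basis_def image_Un[symmetric] by (rule image_mono)
    then show "homogeneous_polys n k \<subseteq> mp.span (?B \<union> positive_basis n)"
      unfolding homogeneous_polys_eq_span_basis by (rule mp.span_mono)
    show "?B \<subseteq> homogeneous_polys n k" using basis_elem_homogeneous[where ?'a = 'a] J by blast
  qed
  have fin: "finite ?B" by simp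
  have PS: "(positive_basis n :: 'a mpoly set) \<subseteq> ?S"
    unfolding positive_basis_def using P by (rule image_mono)
  note bm = basis_mod_span[OF independent_basis fin image_mono[OF J'] PS disj V]
  have "coinv_char n k w = (\<Sum>b\<in>?B. quotient_coords (coinv_ideal n) ?B (act w b) b)"
    unfolding coinv_char_def using bm(1)
    by (intro trace_mod_act) (auto simp: homogeneous_subspace act_homogeneous[OF w] coinv_ideal_eq_span
        act_coinv_ideal[OF w, unfolded coinv_ideal_eq_span])
  also have "\<dots> = (\<Sum>b\<in>?B. mp.representation ?S (act w b) b)"
    using bm(2)[OF act_homogeneous[OF w subsetD[OF V(2)]]] unfolding coinv_ideal_eq_span
    by (intro sum.cong refl) simp
  also have "\<dots> = (\<Sum>t\<in>?J. mp.representation ?S (act w (basis_elem n t)) (basis_elem n t))"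
    by (subst sum.reindex[OF inj_on_subset[OF inj_on_basis_elem J']]) (simp only: o_def)
  also have "\<dots> = (\<Sum>v\<in>?W. mp.representation ?S (act w (basis_elem n (v, ?z))) (basis_elem n (v, ?z)))"
    by (subst sum.reindex) (auto simp: inj_on_def)
  also have "\<dots> = (\<Sum>v\<in>?W. diag_coeff n w v)"
    by (intro sum.cong refl) (simp add: diag_coeff_def basis_elem_zero)
  finally show ?thesis .
qed

text \<open>Multiplication by the Hilbert series of the invariants, written on coefficients. It is
  applied to diagonal coefficients and to weights, hence the general f.\<close>

lemma sum_basis_index_deg:
  fixes f :: "signed_perm \<Rightarrow> 'b::comm_ring_1"
  shows "(\<Sum>t\<in>basis_index_deg n k. f (fst t)) =
    (\<Sum>j\<le>k. (\<Sum>v | v \<in> signed_perms n \<and> fmaj n (inv v) = j. f v) *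
       of_nat (card {l \<in> even_partitions n. (\<Sum>i=1..n. l i) = k - j}))"
proof -
  let ?W = "\<lambda>j. {v \<in> signed_perms n. fmaj n (inv v) = j}"
  let ?L = "\<lambda>j. {l \<in> even_partitions n. (\<Sum>i=1..n. l i) = j}"
  have fin: "finite (?L j)" for j
    by (rule finite_subset[OF _ finite_expo_deg[of n j]]) (auto simp: expo_deg_def even_partitions_def)
  have eq: "basis_index_deg n k = (\<Union>j\<in>{..k}. ?W j \<times> ?L (k - j))"
    using sum_lead[of _ n] by (auto simp: basis_index_deg_def basis_index_def)
  have "(\<Sum>t\<in>basis_index_deg n k. f (fst t)) = (\<Sum>j\<le>k. \<Sum>t\<in>?W j \<times> ?L (k - j). f (fst t))"
    unfolding eq using fin by (intro sum.UNION_disjoint) auto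
  also have "\<dots> = (\<Sum>j\<le>k. \<Sum>v\<in>?W j. of_nat (card (?L (k - j))) * f v)"
  proof (intro sum.cong refl)
    fix j
    have "(\<Sum>t\<in>?W j \<times> ?L (k - j). f (fst t)) = (\<Sum>v\<in>?W j. \<Sum>l\<in>?L (k - j). f v)"
      unfolding sum.cartesian_product by (simp add: case_prod_unfold)
    then show "(\<Sum>t\<in>?W j \<times> ?L (k - j). f (fst t)) = (\<Sum>v\<in>?W j. of_nat (card (?L (k - j))) * f v)"
      by simp
  qed
  finally show ?thesis by (simp add: sum_distrib_right mult.commute)
qed

subsection \<open>Monomials fixed by a signed permutation\<close>

definition block_functions :: "nat set set \<Rightarrow> nat \<Rightarrow> (nat \<Rightarrow> nat) set" where
  "block_functions \<C> k =
    {a. (\<forall>x. x \<notin> \<Union>\<C> \<longrightarrow> a x = 0) \<and> (\<forall>C\<in>\<C>. \<forall>x\<in>C. \<forall>y\<in>C. a x = a y) \<and> (\<Sum>x\<in>\<Union>\<C>. a x) = k}"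

lemma finite_block_functions:
  assumes "finite (\<Union>\<C>)"
  shows "finite (block_functions \<C> k)"
proof (rule finite_subset)
  show "block_functions \<C> k \<subseteq> {a. \<forall>x. (x \<in> \<Union>\<C> \<longrightarrow> a x \<in> {..k}) \<and> (x \<notin> \<Union>\<C> \<longrightarrow> a x = 0)}"
  proof (intro subsetI CollectI allI conjI impI)
    fix a x assume a: "a \<in> block_functions \<C> k"
    show "a x \<in> {..k}" if "x \<in> \<Union>\<C>"
      using a member_le_sum[OF that, of a] assms by (auto simp: block_functions_def)
    show "a x = 0" if "x \<notin> \<Union>\<C>" using a that by (auto simp: block_functions_def)
  qed
  show "finite {a. \<forall>x. (x \<in> \<Union>\<C> \<longrightarrow> a x \<in> {..k}) \<and> (x \<notin> \<Union>\<C> \<longrightarrow> a x = 0)}"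
    by (rule finite_set_of_finite_funs[OF assms]) simp
qed

text \<open>The value t on a block C contributes t times \<open>card C\<close> to the degree and the
  t-th power of the product of \<open>\<sigma>\<close> over C to the weight, so every block gives a
  geometric series.\<close>

lemma sum_block_functions:
  fixes \<sigma> :: "nat \<Rightarrow> int"
  assumes "finite \<C>" and "\<And>C. C \<in> \<C> \<Longrightarrow> finite C \<and> C \<noteq> {}"
    and "\<And>C D. C \<in> \<C> \<Longrightarrow> D \<in> \<C> \<Longrightarrow> C \<noteq> D \<Longrightarrow> C \<inter> D = {}"
  shows "(\<Sum>a\<in>block_functions \<C> k. \<Prod>x\<in>\<Union>\<C>. \<sigma> x ^ a x) =
    fps_nth (\<Prod>C\<in>\<C>. geo_fps (card C) (\<Prod>x\<in>C. \<sigma> x)) k"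
  using assms
proof (induction \<C> arbitrary: k rule: finite_induct)
  case empty
  have "block_functions {} k = (if k = 0 then {\<lambda>_. 0} else {})" by (auto simp: block_functions_def)
  then show ?case by simp
next
  case (insert C \<C>)
  let ?U = "\<Union>\<C>" and ?m = "card C" and ?s = "\<Prod>x\<in>C. \<sigma> x"
  have C: "finite C" "C \<noteq> {}" using insert.prems(1) by auto
  obtain x0 where x0: "x0 \<in> C" using C by blast
  have disj: "C \<inter> ?U = {}" using insert.prems(2)[of C] insert.hyps(2) by blast
  have finU: "finite ?U" using insert.hyps(1) insert.prems(1) by blast
  have m: "0 < ?m" using C by (simp add: card_gt_0_iff)
  let ?wt = "\<lambda>a. \<Prod>x\<in>?U. \<sigma> x ^ a x"
  let ?J = "{j \<in> {0..k}. ?m dvd j}"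
  have IH: "(\<Sum>a\<in>block_functions \<C> j. ?wt a) = fps_nth (\<Prod>C\<in>\<C>. geo_fps (card C) (\<Prod>x\<in>C. \<sigma> x)) j" for j
    using insert.prems by (intro insert.IH) auto
  have "fps_nth (\<Prod>C\<in>insert C \<C>. geo_fps (card C) (\<Prod>x\<in>C. \<sigma> x)) k =
      (\<Sum>j=0..k. (if ?m dvd j then ?s ^ (j div ?m) else 0) * (\<Sum>a\<in>block_functions \<C> (k - j). ?wt a))"
    using insert.hyps by (simp add: fps_mult_nth IH) (simp add: geo_fps_def)
  also have "\<dots> = (\<Sum>j\<in>?J. ?s ^ (j div ?m) * (\<Sum>a\<in>block_functions \<C> (k - j). ?wt a))"
    by (rule sum.mono_neutral_cong_right) auto
  also have "\<dots> = (\<Sum>(j, a)\<in>(SIGMA j:?J. block_functions \<C> (k - j)). ?s ^ (j div ?m) * ?wt a)"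
    unfolding sum_distrib_left by (rule sum.Sigma) (auto simp: finite_block_functions[OF finU])
  also have "\<dots> = (\<Sum>a\<in>block_functions (insert C \<C>) k. \<Prod>x\<in>\<Union>(insert C \<C>). \<sigma> x ^ a x)"
  \<comment> \<open>The degree j spent on C is spread evenly over C. Conversely, the value at the
    representative \<open>x0\<close> returns j, and the function is reset to 0 on C to have its
    support in the other blocks.\<close>
  proof (rule sum.reindex_bij_witness[where j = "\<lambda>(j, a) x. if x \<in> C then j div ?m else a x"
        and i = "\<lambda>a. (?m * a x0, \<lambda>x. if x \<in> C then 0 else a x)"])
    fix p assume "p \<in> (SIGMA j:?J. block_functions \<C> (k - j))"
    then obtain j a where p: "p = (j, a)" "j \<le> k" "?m dvd j" "a \<in> block_functions \<C> (k - j)" by auto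
    let ?b = "\<lambda>x. if x \<in> C then j div ?m else a x"
    have zero: "a x = 0" if "x \<in> C" for x
      using p(4) that disj unfolding block_functions_def by blast
    have agree: "?b x = a x" if "x \<in> ?U" for x using that disj by auto
    show "(\<lambda>a. (?m * a x0, \<lambda>x. if x \<in> C then 0 else a x)) ((\<lambda>(j, a) x. if x \<in> C then j div ?m else a x) p) = p"
      using p(3) x0 zero by (auto simp: p(1) fun_eq_iff)
    have "(\<Sum>x\<in>\<Union>(insert C \<C>). ?b x) = (\<Sum>x\<in>C. ?b x) + (\<Sum>x\<in>?U. ?b x)"
      using sum.union_disjoint[OF C(1) finU disj, of ?b] by simp
    also have "\<dots> = ?m * (j div ?m) + (\<Sum>x\<in>?U. a x)" using agree by simp
    also have "\<dots> = k" using p by (simp add: block_functions_def)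
    finally have "(\<Sum>x\<in>\<Union>(insert C \<C>). ?b x) = k" .
    moreover have "?b x = ?b y" if "D \<in> insert C \<C>" "x \<in> D" "y \<in> D" for D x y
    proof (cases "D = C")
      case False
      then have D: "D \<in> \<C>" using that(1) by simp
      then have b: "?b x = a x" "?b y = a y" using that agree by blast+
      have "a x = a y" using p(4) D that(2,3) unfolding block_functions_def by blast
      then show ?thesis unfolding b .
    qed (use that in simp)
    moreover have "?b x = 0" if "x \<notin> \<Union>(insert C \<C>)" for x
      using that p(4) by (simp add: block_functions_def)
    ultimately show "(\<lambda>(j, a) x. if x \<in> C then j div ?m else a x) p \<in> block_functions (insert C \<C>) k"
      unfolding p(1) prod.case block_functions_def by blast
    have "(\<Prod>x\<in>\<Union>(insert C \<C>). \<sigma> x ^ ?b x) = (\<Prod>x\<in>C. \<sigma> x ^ ?b x) * (\<Prod>x\<in>?U. \<sigma> x ^ ?b x)"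
      using prod.union_disjoint[OF C(1) finU disj, of "\<lambda>x. \<sigma> x ^ ?b x"] by simp
    also have "\<dots> = ?s ^ (j div ?m) * ?wt a"
    proof -
      have "(\<Prod>x\<in>?U. \<sigma> x ^ ?b x) = ?wt a" using agree by (intro prod.cong) auto
      moreover have "(\<Prod>x\<in>C. \<sigma> x ^ ?b x) = ?s ^ (j div ?m)" by (simp add: prod_power_distrib)
      ultimately show ?thesis by simp
    qed
    finally show "(\<Prod>x\<in>\<Union>(insert C \<C>). \<sigma> x ^ ((\<lambda>(j, a) x. if x \<in> C then j div ?m else a x) p) x) =
        (case p of (j, a) \<Rightarrow> ?s ^ (j div ?m) * ?wt a)"
      by (simp only: p(1) prod.case)
  next
    fix a assume a: "a \<in> block_functions (insert C \<C>) k"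
    then have supp: "\<forall>x. x \<notin> \<Union>(insert C \<C>) \<longrightarrow> a x = 0"
      and const: "\<forall>D\<in>insert C \<C>. \<forall>x\<in>D. \<forall>y\<in>D. a x = a y" and deg: "(\<Sum>x\<in>\<Union>(insert C \<C>). a x) = k"
      unfolding block_functions_def by blast+
    let ?a = "\<lambda>x. if x \<in> C then 0 else a x"
    have constC: "a x = a x0" if "x \<in> C" for x using const that x0 by blast
    have "(\<Sum>x\<in>\<Union>(insert C \<C>). a x) = (\<Sum>x\<in>C. a x) + (\<Sum>x\<in>?U. a x)"
      using sum.union_disjoint[OF C(1) finU disj, of a] by simp
    also have "(\<Sum>x\<in>C. a x) = (\<Sum>x\<in>C. a x0)" using constC by (intro sum.cong refl)
    also have "(\<Sum>x\<in>?U. a x) = (\<Sum>x\<in>?U. ?a x)" using disj by (intro sum.cong) auto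
    finally have k: "k = ?m * a x0 + (\<Sum>x\<in>?U. ?a x)" using deg by simp
    have "?a \<in> block_functions \<C> (k - ?m * a x0)" unfolding block_functions_def
    proof (intro CollectI conjI allI impI ballI)
      show "?a x = 0" if "x \<notin> ?U" for x using supp that by auto
      show "?a x = ?a y" if "D \<in> \<C>" "x \<in> D" "y \<in> D" for D x y
      proof -
        have "x \<notin> C" "y \<notin> C" using that disj by blast+
        moreover have "a x = a y" using const that by blast
        ultimately show ?thesis by simp
      qed
    qed (use k in simp)
    then show "(?m * a x0, ?a) \<in> (SIGMA j:?J. block_functions \<C> (k - j))" using k by simp
    show "(\<lambda>(j, a) x. if x \<in> C then j div ?m else a x) (?m * a x0, ?a) = a"
    proof (rule ext)
      show "(\<lambda>(j, a) x. if x \<in> C then j div ?m else a x) (?m * a x0, ?a) x = a x" for x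
        using m by (cases "x \<in> C") (simp_all add: constC[of x])
    qed
  qed
  finally show ?case ..
qed

lemma cycles_of_eq: "cycles_of n w = orbit (wabs w) ` {1..n}"
  by (simp add: cycles_of_def wabs_def[abs_def])

lemma cycles_of_partition:
  assumes w: "w \<in> signed_perms n"
  shows "finite (cycles_of n w)" and "\<Union>(cycles_of n w) = {1..n}"
    and "C \<in> cycles_of n w \<Longrightarrow> finite C \<and> C \<noteq> {}"
    and "C \<in> cycles_of n w \<Longrightarrow> D \<in> cycles_of n w \<Longrightarrow> C \<noteq> D \<Longrightarrow> C \<inter> D = {}"
proof -
  let ?g = "wabs w"
  note g = wabs_permutes[OF w]
  have perm: "permutation ?g" using g permutation_permutes by blast
  have sub: "orbit ?g i \<subseteq> {1..n}" if "i \<in> {1..n}" for i by (rule permutes_orbit_subset[OF g that])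
  show "finite (cycles_of n w)" by (simp add: cycles_of_eq)
  show "\<Union>(cycles_of n w) = {1..n}"
    unfolding cycles_of_eq using sub permutation_self_in_orbit[OF perm] by blast
  show "finite C \<and> C \<noteq> {}" if "C \<in> cycles_of n w"
    using that sub orbit_nonempty[of ?g] finite_subset unfolding cycles_of_eq
    by (metis finite_atLeastAtMost imageE)
  show "C \<inter> D = {}" if C: "C \<in> cycles_of n w" and D: "D \<in> cycles_of n w" and "C \<noteq> D"
  proof (rule ccontr)
    assume "C \<inter> D \<noteq> {}"
    then obtain x where "x \<in> C" "x \<in> D" by blast
    moreover have "cyclic_on ?g C" "cyclic_on ?g D"
      using C D cyclic_on_orbit'[OF perm] unfolding cycles_of_eq by blast+
    ultimately have "C = D" using orbit_cyclic_eq3 by metis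
    with \<open>C \<noteq> D\<close> show False
      by simp
  qed
qed

lemma fixed_exponents_eq_block_functions:
  assumes w: "w \<in> signed_perms n"
  shows "{a. a \<in> expo_deg n k \<and> a \<circ> wabs (inv w) = a} = block_functions (cycles_of n w) k"
proof -
  let ?g = "wabs w"
  have perm: "permutation ?g" using wabs_permutes[OF w] permutation_permutes by blast
  have fixed: "a \<circ> wabs (inv w) = a \<longleftrightarrow> (\<forall>i. a (?g i) = a i)" for a :: "nat \<Rightarrow> nat"
    using wabs_inv[OF w] by (auto simp: fun_eq_iff) metis+
  have const: "(\<forall>i. a (?g i) = a i) \<longleftrightarrow> (\<forall>C\<in>cycles_of n w. \<forall>x\<in>C. \<forall>y\<in>C. a x = a y)" for a :: "nat \<Rightarrow> nat"
  proof
    assume inv: "\<forall>i. a (?g i) = a i"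
    have "a y = a i" if "y \<in> orbit ?g i" for i y using that inv by induction auto
    then show "\<forall>C\<in>cycles_of n w. \<forall>x\<in>C. \<forall>y\<in>C. a x = a y" unfolding cycles_of_eq by (metis imageE)
  next
    assume const: "\<forall>C\<in>cycles_of n w. \<forall>x\<in>C. \<forall>y\<in>C. a x = a y"
    show "\<forall>i. a (?g i) = a i"
    proof
      fix i
      show "a (?g i) = a i"
      proof (cases "i \<in> {1..n}")
        case True
        then have "orbit ?g i \<in> cycles_of n w" unfolding cycles_of_eq by blast
        then show ?thesis
          using const permutation_self_in_orbit[OF perm, of i] orbit.base[of ?g i] by blast
      next
        case False
        then show ?thesis by (subst wabs_outside[OF w]) auto
      qed
    qed
  qed
  show ?thesis
    unfolding block_functions_def cycles_of_partition(2)[OF w] fixed const expo_deg_def expo_def by blast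
qed

section \<open>Cycle types and the comparison of both sides\<close>

lemma prod_sgn_cycle:
  assumes w: "w \<in> signed_perms n" and C: "C \<in> cycles_of n w"
  shows "(\<Prod>x\<in>C. sgn (w (int x))) = (if positive_cycle w C then 1 else - 1)"
proof -
  have fin: "finite C" and sub: "C \<subseteq> {1..n}" using cycles_of_partition(2,3)[OF w] C by blast+
  have "(\<Prod>x\<in>C. sgn (w (int x))) = (\<Prod>x\<in>C. if w (int x) < 0 then - 1 else 1)"
  proof (intro prod.cong refl)
    fix x assume "x \<in> C"
    then have "w (int x) \<noteq> 0" using sub signed_perm_abs_range(1)[OF w] by blast
    then show "sgn (w (int x)) = (if w (int x) < 0 then - 1 else 1)" by (simp add: sgn_if)
  qed
  also have "\<dots> = (- 1) ^ card {x \<in> C. w (int x) < 0}" by (simp add: prod.If_cases[OF fin] Int_def)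
  finally show ?thesis by (simp add: positive_cycle_def)
qed

text \<open>The factors depend on length and sign only. This lemma and its analogue for
  \<open>\<gamma>\<close> express both products through the type, where they can be
  compared.\<close>

lemma prod_cycles_eq_type:
  fixes f :: "nat \<Rightarrow> int \<Rightarrow> 'a::comm_monoid_mult"
  assumes w: "w \<in> signed_perms n"
  shows "(\<Prod>C\<in>cycles_of n w. f (card C) (\<Prod>x\<in>C. sgn (w (int x)))) =
    (\<Prod>m\<in>#fst (signed_cycle_type n w). f m 1) * (\<Prod>m\<in>#snd (signed_cycle_type n w). f m (- 1))"
proof -
  let ?P = "{C \<in> cycles_of n w. positive_cycle w C}" and ?N = "{C \<in> cycles_of n w. \<not> positive_cycle w C}"
  have "cycles_of n w = ?P \<union> ?N" by blast
  then have "(\<Prod>C\<in>cycles_of n w. f (card C) (\<Prod>x\<in>C. sgn (w (int x)))) =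
      (\<Prod>C\<in>?P \<union> ?N. f (card C) (\<Prod>x\<in>C. sgn (w (int x))))"
    by simp
  also have "\<dots> = (\<Prod>C\<in>?P. f (card C) (\<Prod>x\<in>C. sgn (w (int x)))) * (\<Prod>C\<in>?N. f (card C) (\<Prod>x\<in>C. sgn (w (int x))))"
    using cycles_of_partition(1)[OF w] by (intro prod.union_disjoint) auto
  also have "\<dots> = (\<Prod>C\<in>?P. f (card C) 1) * (\<Prod>C\<in>?N. f (card C) (- 1))"
    using prod_sgn_cycle[OF w] by (intro arg_cong2[of _ _ _ _ "(*)"] prod.cong) auto
  also have "\<dots> = (\<Prod>m\<in>#fst (signed_cycle_type n w). f m 1) * (\<Prod>m\<in>#snd (signed_cycle_type n w). f m (- 1))"
    by (simp add: signed_cycle_type_def prod_unfold_prod_mset multiset.map_comp o_def)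
  finally show ?thesis .
qed

lemma prod_composition_eq_type:
  fixes f :: "nat \<Rightarrow> int \<Rightarrow> 'a::comm_monoid_mult"
  assumes "0 \<notin> set \<gamma>"
  shows "prod_list (map (\<lambda>c. f (nat \<bar>c\<bar>) (if c < 0 then - 1 else 1)) \<gamma>) =
    (\<Prod>m\<in>#fst (composition_type \<gamma>). f m 1) * (\<Prod>m\<in>#snd (composition_type \<gamma>). f m (- 1))"
  using assms
proof (induction \<gamma>)
  case (Cons c \<gamma>)
  then consider "c > 0" | "c < 0"
    by (cases c "0 :: int" rule: linorder_cases) auto
  then show ?case using Cons by cases (simp_all add: composition_type_def mult_ac)
qed (simp add: composition_type_def)

text \<open>Both sides are the coefficient of t^k in a product of series 1/(1 - t^m) and 1/(1 +
  t^m), taken over the cycles of w on the left and over the parts of \<open>\<gamma>\<close> on the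
  right.\<close>

lemma sum_act_sign_eq_sum_wt:
  assumes w: "w \<in> signed_perms n" and \<gamma>: "signed_composition n \<gamma>" and "1 \<le> n"
    and type: "signed_cycle_type n w = composition_type \<gamma>"
  shows "(\<Sum>a | a \<in> expo_deg n k \<and> a \<circ> wabs (inv w) = a. act_sign n w a) =
    (\<Sum>t\<in>basis_index_deg n k. wt \<gamma> (sDes n (fst t)))"
proof -
  have "(\<Sum>a | a \<in> expo_deg n k \<and> a \<circ> wabs (inv w) = a. act_sign n w a) =
      fps_nth (\<Prod>C\<in>cycles_of n w. geo_fps (card C) (\<Prod>x\<in>C. sgn (w (int x)))) k"
    unfolding fixed_exponents_eq_block_functions[OF w] act_sign_def cycles_of_partition(2)[OF w, symmetric]
    by (rule sum_block_functions) (use cycles_of_partition[OF w] in blast)+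
  also have "\<dots> = fps_nth (prod_list (map (\<lambda>c. geo_fps (nat \<bar>c\<bar>) (if c < 0 then - 1 else 1)) \<gamma>)) k"
    using \<gamma> unfolding prod_cycles_eq_type[OF w] type
    by (subst prod_composition_eq_type) (auto simp: signed_composition_def)
  also have "\<dots> = (\<Sum>xs\<in>words n k. list_weight \<gamma> xs)" by (rule sum_list_weight[OF \<gamma>, symmetric])
  also have "\<dots> = (\<Sum>a\<in>expo_deg n k. list_weight \<gamma> (map a [1..<n + 1]))"
    by (rule sum.reindex_bij_betw[OF bij_betw_expo_deg_words, symmetric])
  also have "\<dots> = (\<Sum>a\<in>expo_deg n k. wt \<gamma> (word_sDes n a))" by (simp only: wt_word_sDes[OF \<gamma> \<open>1 \<le> n\<close>])
  also have "\<dots> = (\<Sum>t\<in>basis_index_deg n k. wt \<gamma> (word_sDes n (lead n t)))"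
    by (rule sum.reindex_bij_betw[OF bij_betw_lead, symmetric])
  also have "\<dots> = (\<Sum>t\<in>basis_index_deg n k. wt \<gamma> (sDes n (fst t)))"
    by (intro sum.cong) (auto simp: basis_index_deg_def basis_index_def lead_def sDes_combine)
  finally show ?thesis .
qed

text \<open>Both sequences have the same convolution with the coefficients h of the Hilbert series
  of the invariants. As \<open>h 0 = 1\<close>, the k-th term is determined by the earlier ones, and
  strong induction takes the place of a division by that series.\<close>

lemma coinv_char_eq_sum_wt:
  assumes w: "w \<in> signed_perms n" and \<gamma>: "signed_composition n \<gamma>" and n: "1 \<le> n"
    and type: "signed_cycle_type n w = composition_type \<gamma>"
  shows "(coinv_char n k w :: 'a::field_char_0) =
    of_int (\<Sum>v | v \<in> signed_perms n \<and> fmaj n (inv v) = k. wt \<gamma> (sDes n v))"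
proof (induction k rule: less_induct)
  case (less k)
  define c where "c j = (\<Sum>v | v \<in> signed_perms n \<and> fmaj n (inv v) = j. wt \<gamma> (sDes n v))" for j
  define h where "h j = card {l \<in> even_partitions n. (\<Sum>i=1..n. l i) = j}" for j
  have "{l \<in> even_partitions n. (\<Sum>i=1..n. l i) = 0} = {\<lambda>_. 0}"
  proof (intro equalityI subsetI)
    fix l assume l: "l \<in> {l \<in> even_partitions n. (\<Sum>i=1..n. l i) = 0}"
    then have "l i = 0" for i by (cases "i \<in> {1..n}") (auto simp: even_partitions_def expo_def)
    then show "l \<in> {\<lambda>_. 0}" by auto
  qed (simp add: zero_even_partition)
  then have h0: "h 0 = 1" unfolding h_def by simp
  have "(\<Sum>j\<le>k. (coinv_char n j w :: 'a) * of_nat (h (k - j))) =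
      (\<Sum>t\<in>basis_index_deg n k. diag_coeff n w (fst t))"
    unfolding sum_basis_index_deg coinv_char_eq[OF w] h_def ..
  \<comment> \<open>One trace on homogeneous polynomials, evaluated in the basis of products and in
    the basis of monomials.\<close>
  also have "\<dots> = of_int (\<Sum>t\<in>basis_index_deg n k. wt \<gamma> (sDes n (fst t)))"
    using trace_polys_basis[OF w, of k, where ?'a = 'a] trace_polys_monomials[OF w, of k, where ?'a = 'a]
      sum_act_sign_eq_sum_wt[OF w \<gamma> n type, of k] by simp
  also have "\<dots> = (\<Sum>j\<le>k. of_int (c j) * of_nat (h (k - j)))"
    unfolding sum_basis_index_deg[where f = "\<lambda>v. wt \<gamma> (sDes n v)"] c_def h_def by simp
  finally have eq: "(\<Sum>j\<le>k. (coinv_char n j w :: 'a) * of_nat (h (k - j))) = (\<Sum>j\<le>k. of_int (c j) * of_nat (h (k - j)))" .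
  have split: "{..k} = insert k {..<k}" by auto
  have "(\<Sum>j<k. (coinv_char n j w :: 'a) * of_nat (h (k - j))) = (\<Sum>j<k. of_int (c j) * of_nat (h (k - j)))"
    using less.IH by (intro sum.cong) (auto simp: c_def)
  then have "(coinv_char n k w :: 'a) = of_int (c k)" using eq unfolding split by (simp add: h0)
  then show ?case by (simp add: c_def)
qed

lemma is_signed_set_sDes: "1 \<le> n \<Longrightarrow> is_signed_set n (sDes n w)"
  by (auto simp: is_signed_set_def sDes_def)

theorem theorem6p3:
  fixes n k :: nat
  assumes "1 \<le> n" and "k \<le> n\<^sup>2"
  shows "fine_set n (coinv_char n k :: signed_perm \<Rightarrow> 'a::field_char_0)
           {w \<in> signed_perms n. finv n (inv w) = k} (sDes n) \<and>
         fine_set n (coinv_char n k :: signed_perm \<Rightarrow> 'a::field_char_0)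
           {w \<in> signed_perms n. fmaj n (inv w) = k} (sDes n)"
proof -
  have "(coinv_char n k w :: 'a) = of_int (\<Sum>v | v \<in> signed_perms n \<and> fmaj n (inv v) = k. wt \<gamma> (sDes n v))"
    "(coinv_char n k w :: 'a) = of_int (\<Sum>v | v \<in> signed_perms n \<and> finv n (inv v) = k. wt \<gamma> (sDes n v))"
    if "signed_composition n \<gamma>" "w \<in> signed_perms n" "signed_cycle_type n w = composition_type \<gamma>" for \<gamma> w
    unfolding sum_finv_eq_sum_fmaj[where f = "wt \<gamma>"]
    by (rule coinv_char_eq_sum_wt[OF that(2,1) assms(1) that(3)])+
  then show ?thesis unfolding fine_set_def using is_signed_set_sDes[OF assms(1)] by auto
qed

end
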